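(* Fix $m\ge 1$, a probability vector $\mathbf p=(p_1,\dots,p_m)$ with all $p_i>0$, and positive integers $m_i$ ($1\le i\le m$) and $m_{ij}$ ($1\le i\le m$, $1\le j\le m_i$). There exists $\varepsilon>0$ such that for every admissible family of numbers $(a_{ijk}, b_{ij}, c_{ijk}, d_{ij})$ (as defined in the context) satisfying the genericity hypothesis (G) for each $t\in[0,1]$ there exist $1\le i\le m$ and $1\le j<j'\le m_i$ with $\sum_{k=1}^{m_{ij}} a_{ijk}^t\neq\sum_{k=1}^{m_{ij'}} a_{ij'k}^t$, and at least one of the two hypotheses (R1) for each $i\in\{1,\dots,m\}$ there exist numbers $0<a_i\le b_i<1$ such that $(1+\varepsilon)^{-1}<\frac{b_{ij}}{b_i}<1+\varepsilon$ and $(1+\varepsilon)^{-1}<\frac{a_{ijk}}{a_i}<1+\varepsilon$ for all $(j,k)\in\mathcal J_i$; (R2) $\frac{b_{ij}}{a_{ijk}}<1+\varepsilon$ for all $i\in\{1,\dots,m\}$ and all $(j,k)\in\mathcal J_i$; one has $$\dim_{\mathrm H}\Lambda_{\mathbf i}=\sup_{\mathbf P}\{\lambda(\mathbf P)+t(\mathbf P)\}\quad\text{for }\mathbf p\text{-a.e. }\mathbf i\in\mathcal I,$$ where the supremum is over all collections $\mathbf P=(p_{ij})_{1\le i\le m,\,1\le j\le m_i}$ of non-negative numbers with $\sum_{j=1}^{m_i}p_{ij}=p_i$ for $i=1,\dots,m$.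
   Context: $\dim_{\mathrm H}$ denotes Hausdorff dimension. $\mathcal I=\{1,\dots,m\}^{\mathbb N}$ is equipped with the Bernoulli (product) measure given by the probability vector $\mathbf p$; "$\mathbf p$-a.e. $\mathbf i$" refers to this measure. Put $\mathcal J_i=\{(j,k): 1\le j\le m_i,\ 1\le k\le m_{ij}\}$. An admissible family consists of real numbers $a_{ijk},b_{ij},c_{ijk},d_{ij}$ ($1\le i\le m$, $(j,k)\in\mathcal J_i$) such that: - $0<a_{ijk}\le b_{ij}<1$, $\sum_{j=1}^{m_i}b_{ij}\le1$, and $\sum_{k=1}^{m_{ij}}a_{ijk}\le 1$; - $0\le d_{i1}<d_{i2}<\dots<d_{im_i}<1$, $d_{i(j+1)}-d_{ij}\ge b_{ij}$, and $1-d_{im_i}\ge b_{im_i}$; - $0\le c_{ij1}<c_{ij2}<\dots<c_{ijm_{ij}}<1$, $c_{ij(k+1)}-c_{ijk}\ge a_{ijk}$, and $1-c_{ijm_{ij}}\ge a_{ijm_{ij}}$. Let $A_{ijk}:\mathbb R^2\to\mathbb R^2$ be the affine map $A_{ijk}(x)=\begin{pmatrix}a_{ijk}&0\\0&b_{ij}\end{pmatrix}x+\begin{pmatrix}c_{ijk}\\d_{ij}\end{pmatrix}$. For $\mathbf i=(i_1,i_2,\dots)\in\mathcal I$ let $$\Lambda_{\mathbf i}=\bigcap_{n=1}^\infty\ \bigcup_{(j_1,k_1)\in\mathcal J_{i_1},\dots,(j_n,k_n)\in\mathcal J_{i_n}}A_{i_1j_1k_1}\circ\cdots\circ A_{i_nj_nk_n}([0,1]^2).$$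 For $\mathbf P=(p_{ij})$ as in the claim, with the convention $0\log0=0$, $$\lambda(\mathbf P)=\frac{\sum_{i,j}p_{ij}\log p_{ij}-\sum_ip_i\log p_i}{\sum_{i,j}p_{ij}\log b_{ij}},$$ and $t(\mathbf P)$ is the unique real number in $[0,1]$ satisfying $\sum_{i,j}p_{ij}\log\Bigl(\sum_{k=1}^{m_{ij}}a_{ijk}^{t(\mathbf P)}\Bigr)=0$. *)

theory Defs
  imports "HOL-Probability.Probability"
begin

section \<open>Hausdorff measure and dimension\<close>

text \<open>
  The gauge is the s-th power of the diameter, with the usual convention that the 0-th power
  is 1 for every nonempty set (note that \<^term>\<open>(0::real) powr 0 = 0\<close>) and that the empty
  set contributes 0. Covering sets are required to be bounded since \<^const>\<open>diameter\<close> is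
  not meaningful for unbounded sets.
\<close>

definition diam_pow :: "real \<Rightarrow> 'a::metric_space set \<Rightarrow> ennreal" where
  "diam_pow s U =
     (if U = {} then 0 else if s = 0 then 1 else ennreal (diameter U powr s))"

definition hausdorff_premeasure :: "real \<Rightarrow> real \<Rightarrow> 'a::metric_space set \<Rightarrow> ennreal" where
  "hausdorff_premeasure s \<delta> S =
     Inf {(\<Sum>n. diam_pow s (U n)) | U :: nat \<Rightarrow> 'a set.
            S \<subseteq> (\<Union>n. U n) \<and> (\<forall>n. bounded (U n) \<and> diameter (U n) \<le> \<delta>)}"

definition hausdorff_measure :: "real \<Rightarrow> 'a::metric_space set \<Rightarrow> ennreal" where
  "hausdorff_measure s S = (SUP \<delta>\<in>{0<..}. hausdorff_premeasure s \<delta> S)"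

definition hausdorff_dim :: "'a::metric_space set \<Rightarrow> ereal" where
  "hausdorff_dim S = Inf {ereal s | s. 0 \<le> s \<and> hausdorff_measure s S = 0}"


section \<open>Random self-affine carpets\<close>

text \<open>
  Throughout, \<open>m\<close> is the number of systems, \<open>M i\<close> the number of rows of system \<open>i\<close> and
  \<open>N i j\<close> the number of maps in row \<open>j\<close> of system \<open>i\<close>; all of these indices start at 1.
\<close>

definition bernoulli_seq :: "nat \<Rightarrow> (nat \<Rightarrow> real) \<Rightarrow> (nat \<Rightarrow> nat) measure" where
  "bernoulli_seq m p = (\<Pi>\<^sub>M n\<in>(UNIV :: nat set). point_measure {1..m} (\<lambda>i. ennreal (p i)))"

definition index_set :: "(nat \<Rightarrow> nat) \<Rightarrow> (nat \<Rightarrow> nat \<Rightarrow> nat) \<Rightarrow> nat \<Rightarrow> (nat \<times> nat) set" where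
  "index_set M N i = (SIGMA j:{1..M i}. {1..N i j})"

definition admissible ::
  "nat \<Rightarrow> (nat \<Rightarrow> nat) \<Rightarrow> (nat \<Rightarrow> nat \<Rightarrow> nat) \<Rightarrow>
   (nat \<Rightarrow> nat \<Rightarrow> nat \<Rightarrow> real) \<Rightarrow> (nat \<Rightarrow> nat \<Rightarrow> real) \<Rightarrow>
   (nat \<Rightarrow> nat \<Rightarrow> nat \<Rightarrow> real) \<Rightarrow> (nat \<Rightarrow> nat \<Rightarrow> real) \<Rightarrow> bool" where
  "admissible m M N a b c d \<longleftrightarrow>
     (\<forall>i\<in>{1..m}.
        (\<forall>(j, k)\<in>index_set M N i. 0 < a i j k \<and> a i j k \<le> b i j \<and> b i j < 1) \<and>
        (\<Sum>j=1..M i. b i j) \<le> 1 \<and>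
        (\<forall>j\<in>{1..M i}. (\<Sum>k=1..N i j. a i j k) \<le> 1) \<and>
        0 \<le> d i 1 \<and> d i (M i) < 1 \<and>
        (\<forall>j\<in>{1..<M i}. d i j < d i (j + 1) \<and> b i j \<le> d i (j + 1) - d i j) \<and>
        b i (M i) \<le> 1 - d i (M i) \<and>
        (\<forall>j\<in>{1..M i}.
           0 \<le> c i j 1 \<and> c i j (N i j) < 1 \<and>
           (\<forall>k\<in>{1..<N i j}. c i j k < c i j (k + 1) \<and> a i j k \<le> c i j (k + 1) - c i j k) \<and>
           a i j (N i j) \<le> 1 - c i j (N i j)))"

definition generic_family ::
  "nat \<Rightarrow> (nat \<Rightarrow> nat) \<Rightarrow> (nat \<Rightarrow> nat \<Rightarrow> nat) \<Rightarrow> (nat \<Rightarrow> nat \<Rightarrow> nat \<Rightarrow> real) \<Rightarrow> bool" where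
  "generic_family m M N a \<longleftrightarrow>
     (\<forall>t\<in>{0..1}. \<exists>i\<in>{1..m}. \<exists>j\<in>{1..M i}. \<exists>j'\<in>{1..M i}. j < j' \<and>
        (\<Sum>k=1..N i j. a i j k powr t) \<noteq> (\<Sum>k=1..N i j'. a i j' k powr t))"

definition nearly_homogeneous ::
  "real \<Rightarrow> nat \<Rightarrow> (nat \<Rightarrow> nat) \<Rightarrow> (nat \<Rightarrow> nat \<Rightarrow> nat) \<Rightarrow>
   (nat \<Rightarrow> nat \<Rightarrow> nat \<Rightarrow> real) \<Rightarrow> (nat \<Rightarrow> nat \<Rightarrow> real) \<Rightarrow> bool" where
  "nearly_homogeneous \<epsilon> m M N a b \<longleftrightarrow>
     (\<forall>i\<in>{1..m}. \<exists>a0 b0. 0 < a0 \<and> a0 \<le> b0 \<and> b0 < 1 \<and>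
        (\<forall>(j, k)\<in>index_set M N i.
           inverse (1 + \<epsilon>) < b i j / b0 \<and> b i j / b0 < 1 + \<epsilon> \<and>
           inverse (1 + \<epsilon>) < a i j k / a0 \<and> a i j k / a0 < 1 + \<epsilon>))"

definition nearly_conformal ::
  "real \<Rightarrow> nat \<Rightarrow> (nat \<Rightarrow> nat) \<Rightarrow> (nat \<Rightarrow> nat \<Rightarrow> nat) \<Rightarrow>
   (nat \<Rightarrow> nat \<Rightarrow> nat \<Rightarrow> real) \<Rightarrow> (nat \<Rightarrow> nat \<Rightarrow> real) \<Rightarrow> bool" where
  "nearly_conformal \<epsilon> m M N a b \<longleftrightarrow>
     (\<forall>i\<in>{1..m}. \<forall>(j, k)\<in>index_set M N i. b i j / a i j k < 1 + \<epsilon>)"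

text \<open>
  The metric on \<^typ>\<open>real \<times> real\<close> is the Euclidean one. The map below has linear part
  diag(\<open>a i j k\<close>, \<open>b i j\<close>) and translation part (\<open>c i j k\<close>, \<open>d i j\<close>).
\<close>

definition carpet_map ::
  "(nat \<Rightarrow> nat \<Rightarrow> nat \<Rightarrow> real) \<Rightarrow> (nat \<Rightarrow> nat \<Rightarrow> real) \<Rightarrow>
   (nat \<Rightarrow> nat \<Rightarrow> nat \<Rightarrow> real) \<Rightarrow> (nat \<Rightarrow> nat \<Rightarrow> real) \<Rightarrow>
   nat \<Rightarrow> nat \<times> nat \<Rightarrow> real \<times> real \<Rightarrow> real \<times> real" where
  "carpet_map a b c d i = (\<lambda>(j, k) (x, y). (a i j k * x + c i j k, b i j * y + d i j))"

text \<open>\<open>compose_upto f n\<close> is the composition of \<open>f 0, \<dots>, f (n - 1)\<close>, with \<open>f 0\<close> outermost.\<close>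

primrec compose_upto :: "(nat \<Rightarrow> 'a \<Rightarrow> 'a) \<Rightarrow> nat \<Rightarrow> 'a \<Rightarrow> 'a" where
  "compose_upto f 0 = id"
| "compose_upto f (Suc n) = compose_upto f n \<circ> f n"

text \<open>
  The driving sequence is indexed from 0, so \<open>\<omega> l\<close> is the mathematical \<open>i\<close> with subscript
  \<open>l + 1\<close>; the word \<open>w\<close> lists the index pairs used at levels \<open>0, \<dots>, n - 1\<close>.
\<close>

definition random_carpet ::
  "(nat \<Rightarrow> nat) \<Rightarrow> (nat \<Rightarrow> nat \<Rightarrow> nat) \<Rightarrow>
   (nat \<Rightarrow> nat \<Rightarrow> nat \<Rightarrow> real) \<Rightarrow> (nat \<Rightarrow> nat \<Rightarrow> real) \<Rightarrow>
   (nat \<Rightarrow> nat \<Rightarrow> nat \<Rightarrow> real) \<Rightarrow> (nat \<Rightarrow> nat \<Rightarrow> real) \<Rightarrow>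
   (nat \<Rightarrow> nat) \<Rightarrow> (real \<times> real) set" where
  "random_carpet M N a b c d \<omega> =
     (\<Inter>n\<in>{1..}. \<Union>w\<in>(\<Pi>\<^sub>E l\<in>{..<n}. index_set M N (\<omega> l)).
        compose_upto (\<lambda>l. carpet_map a b c d (\<omega> l) (w l)) n ` ({0..1} \<times> {0..1}))"


section \<open>The variational formula\<close>

definition row_distributions ::
  "nat \<Rightarrow> (nat \<Rightarrow> real) \<Rightarrow> (nat \<Rightarrow> nat) \<Rightarrow> (nat \<Rightarrow> nat \<Rightarrow> real) set" where
  "row_distributions m p M =
     {P. \<forall>i\<in>{1..m}. (\<forall>j\<in>{1..M i}. 0 \<le> P i j) \<and> (\<Sum>j=1..M i. P i j) = p i}"

text \<open>The convention 0 log 0 = 0 holds automatically.\<close>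

definition lambda_dim ::
  "nat \<Rightarrow> (nat \<Rightarrow> real) \<Rightarrow> (nat \<Rightarrow> nat) \<Rightarrow> (nat \<Rightarrow> nat \<Rightarrow> real) \<Rightarrow>
   (nat \<Rightarrow> nat \<Rightarrow> real) \<Rightarrow> real" where
  "lambda_dim m p M b P =
     ((\<Sum>i=1..m. \<Sum>j=1..M i. P i j * ln (P i j)) - (\<Sum>i=1..m. p i * ln (p i))) /
     (\<Sum>i=1..m. \<Sum>j=1..M i. P i j * ln (b i j))"

text \<open>
  For an admissible family and a row distribution, the sum below is continuous and strictly
  decreasing in \<open>t\<close>, nonnegative at 0 and nonpositive at 1, so the description is proper.
\<close>

definition t_dim ::
  "nat \<Rightarrow> (nat \<Rightarrow> nat) \<Rightarrow> (nat \<Rightarrow> nat \<Rightarrow> nat) \<Rightarrow> (nat \<Rightarrow> nat \<Rightarrow> nat \<Rightarrow> real) \<Rightarrow>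
   (nat \<Rightarrow> nat \<Rightarrow> real) \<Rightarrow> real" where
  "t_dim m M N a P =
     (THE t. t \<in> {0..1} \<and>
        (\<Sum>i=1..m. \<Sum>j=1..M i. P i j * ln (\<Sum>k=1..N i j. a i j k powr t)) = 0)"

end

theory Submission
  imports Defs
begin

text \<open>
  Only the frequencies of a typical \<open>\<omega>\<close> matter, and the formula holds for all of these.

  Lower bound: given \<open>P\<close>, choose rows with the conditional probabilities \<open>P i j / p i\<close> and, within a
  row, the column \<open>k\<close> with probability proportional to \<open>a i j k powr t\<close>, where \<open>t = t(P)\<close>. By the law
  of large numbers almost every approximate square of side \<open>r\<close> has mass about
  \<open>r powr (\<lambda>(P) + t(P))\<close>. A set of diameter \<open>r\<close> meets boundedly many approximate squares of that
  side, since these have disjoint interiors and area comparable to \<open>r\<^sup>2\<close>; the mass distribution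
  principle applies.

  Upper bound: an approximate square is determined by \<open>n\<close> rows and \<open>k \<le> n\<close> columns. Weigh it with the
  product measure built from its own row frequencies \<open>q\<close> at time \<open>n\<close> and from \<open>t(q')\<close>, where \<open>q'\<close> are
  its row frequencies at time \<open>k\<close>: its weight is about \<open>r powr (\<lambda>(q) + t(q'))\<close>, and there are only
  polynomially many choices of \<open>(q, q')\<close>. As \<open>\<lambda>(q') + t(q')\<close> is at most the supremum, it is enough to
  cover by squares with \<open>\<lambda>(q) \<le> \<lambda>(q') + \<delta>\<close>. Every point lies in arbitrarily small squares of this kind:
  otherwise \<open>\<lambda>\<close> would drop by \<open>\<delta>\<close> at each step of the iteration \<open>n \<mapsto> k(n) \<mapsto> k(k(n)) \<mapsto> \<dots>\<close>, but it is
  nonnegative and bounded.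
\<close>

section \<open>Laws of large numbers on product spaces\<close>

text \<open>A square reads more rows than columns, and the row frequencies may drift between the
  times \<open>k\<close> and \<open>n\<close>; this is why its weight mixes two frequency vectors.
  The column factors are read only below \<open>k\<close>, so their normalising sums
  \<open>S\<close> cancel on average when \<open>t\<close> is tuned to the frequencies at time
  \<open>k\<close>, while entropy and height are governed by those at time \<open>n\<close>. The
  resulting exponent is not a value of the functional under the supremum; the comparison of the two
  values of \<open>lam\<close> repairs this. As the weights depend on the square, their sum over a
  level is not 1, and the averages along the driving sequence must be controlled uniformly over all
  integrands that squares can produce. Frequencies are conditional on the system, so that those of
  the systems themselves can always be replaced by \<open>p\<close>. In the lower bound, words may
  share points on the boundaries of their cells, and the coding map is not shown to be measurable.
  Hence the mass stays on the code space: preimages of small sets are covered by cylinders, and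
  these are counted in the plane through their open cells.\<close>

lemma indep_vars_PiM_coordinates:
  assumes "\<And>l. prob_space (K l)"
  shows "prob_space.indep_vars (PiM UNIV K) K (\<lambda>l w. w l) (UNIV :: 'i set)"
proof -
  interpret product_prob_space K UNIV
    by (intro product_prob_spaceI assms)
  show ?thesis
  proof (subst indep_vars_iff_distr_eq_PiM')
    have "distr (PiM UNIV K) (K l) (\<lambda>w. w l) = K l" for l
      by (rule distr_PiM_component) (auto intro: assms)
    then show "distr (PiM UNIV K) (PiM UNIV K) (\<lambda>x. \<lambda>l\<in>UNIV. x l)
        = (\<Pi>\<^sub>M l\<in>UNIV. distr (PiM UNIV K) (K l) (\<lambda>w. w l))"
      by (simp add: restrict_UNIV distr_id)
  qed auto
qed

lemma summable_exp_neg: "summable (\<lambda>n. exp (- (c * real n)))" if "c > 0"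
proof -
  have "exp (- (c * real n)) = exp (- c) ^ n" for n
    by (simp flip: exp_of_nat_mult)
  then show ?thesis using that by (simp add: summable_geometric)
qed

text \<open>The factors may differ from level to level, as those of \<open>mu\<close> below do, so a
  law for identically distributed variables would not suffice. Hoeffding's inequality gives
  exponentially small, hence summable, deviation probabilities, and Borel-Cantelli turns them into
  almost sure convergence.\<close>

lemma strong_law_PiM:
  fixes K :: "nat \<Rightarrow> 'a measure" and f :: "nat \<Rightarrow> 'a \<Rightarrow> real"
  assumes K: "\<And>l. prob_space (K l)"
    and f [measurable]: "\<And>l. f l \<in> borel_measurable (K l)"
    and bound: "\<And>l x. x \<in> space (K l) \<Longrightarrow> \<bar>f l x\<bar> \<le> B"
  shows "AE w in PiM UNIV K.
    (\<lambda>n. (\<Sum>l<n. f l (w l) - integral\<^sup>L (K l) (f l)) / real n) \<longlonglongrightarrow> 0"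
proof -
  interpret product_prob_space K UNIV
    by (intro product_prob_spaceI K)
  \<comment> \<open>Hoeffding's bound divides by the total squared width of the ranges; the maximum
    with 1 keeps it positive.\<close>
  define C where "C = max B 1"
  have C: "C > 0" "\<And>l x. x \<in> space (K l) \<Longrightarrow> \<bar>f l x\<bar> \<le> C"
    using bound by (auto simp: C_def le_max_iff_disj)
  define S where "S n w = (\<Sum>l<n. f l (w l) - integral\<^sup>L (K l) (f l))" for n w
  have mS [measurable]: "S n \<in> borel_measurable (PiM UNIV K)" for n
    unfolding S_def by measurable
  have indep: "indep_vars (\<lambda>_. borel) (\<lambda>l w. f l (w l)) UNIV"
    by (rule indep_vars_compose2[OF indep_vars_PiM_coordinates[OF K]]) auto
  have expect: "expectation (\<lambda>w. f l (w l)) = integral\<^sup>L (K l) (f l)" for l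
  proof -
    have "integral\<^sup>L (distr (PiM UNIV K) (K l) (\<lambda>w. w l)) (f l) = expectation (\<lambda>w. f l (w l))"
      by (rule integral_distr) auto
    then show ?thesis
      by (subst (asm) distr_PiM_component) (auto intro: K)
  qed
  have hoeff: "prob {w \<in> space (PiM UNIV K). \<bar>S n w\<bar> \<ge> \<delta> * n} \<le> 2 * exp (- (\<delta>\<^sup>2 / (2 * C\<^sup>2) * n))"
    if "\<delta> > 0" for \<delta> :: real and n :: nat
  proof (cases "n = 0")
    case True
    then show ?thesis using prob_le_1 by (auto intro: order.trans)
  next
    case False
    interpret H: Hoeffding_ineq "PiM UNIV K" "{..<n}" "\<lambda>l w. f l (w l)" "\<lambda>_. - C" "\<lambda>_. C"
      "\<Sum>l<n. integral\<^sup>L (K l) (f l)"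
    proof (unfold_locales, goal_cases)
      case 2
      show ?case by (rule indep_vars_subset[OF indep]) simp
    next
      case (3 i)
      have "AE w in PiM UNIV K. w i \<in> space (K i)"
        by (rule AE_I2) (auto simp: space_PiM)
      then show ?case by eventually_elim (use C(2) in \<open>auto simp: abs_le_iff\<close>, force+)
    next
      case 4
      show "(\<Sum>l<n. integral\<^sup>L (K l) (f l)) \<equiv> \<Sum>l<n. expectation (\<lambda>w. f l (w l))"
        by (simp add: expect)
    qed auto
    have "prob {w \<in> space (PiM UNIV K). \<bar>S n w\<bar> \<ge> \<delta> * n}
      \<le> 2 * exp (- 2 * (\<delta> * n)\<^sup>2 / (\<Sum>l<n. (C - - C)\<^sup>2))"
      using H.Hoeffding_ineq_abs_ge[of "\<delta> * n"] False that C(1)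
      by (simp add: S_def sum_subtractf)
    also have "- 2 * (\<delta> * n)\<^sup>2 / (\<Sum>l<n. (C - - C)\<^sup>2) = - (\<delta>\<^sup>2 / (2 * C\<^sup>2) * n)"
      using False C(1) by (simp add: field_simps power2_eq_square)
    finally show ?thesis .
  qed
  have "AE w in PiM UNIV K. eventually (\<lambda>n. \<bar>S n w\<bar> < n / Suc k) sequentially" for k
  proof -
    define A where "A n = {w \<in> space (PiM UNIV K). \<bar>S n w\<bar> \<ge> 1 / Suc k * n}" for n
    have A [measurable]: "A n \<in> sets (PiM UNIV K)" for n
      unfolding A_def by measurable
    have "summable (\<lambda>n. 2 * exp (- ((1 / Suc k)\<^sup>2 / (2 * C\<^sup>2) * real n)))"
      by (intro summable_mult summable_exp_neg) (use C(1) in auto)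
    then have "summable (\<lambda>n. prob (A n))"
      by (rule summable_comparison_test') (use hoeff[of "1 / Suc k"] in \<open>simp add: A_def\<close>)
    then have "AE w in PiM UNIV K. eventually (\<lambda>n. w \<in> space (PiM UNIV K) - A n) sequentially"
      by (intro borel_cantelli_AE1) (auto simp: emeasure_eq_measure)
    then show ?thesis
      by eventually_elim (auto elim!: eventually_mono simp: A_def)
  qed
  then have "AE w in PiM UNIV K. \<forall>k. eventually (\<lambda>n. \<bar>S n w\<bar> < n / Suc k) sequentially"
    by (simp add: AE_all_countable)
  then show ?thesis
  proof eventually_elim
    case (elim w)
    show ?case
    proof (rule tendstoI)
      fix e :: real assume "e > 0"
      then obtain k where k: "inverse (real (Suc k)) < e"
        using reals_Archimedean by blast
      show "eventually (\<lambda>n. dist ((\<Sum>l<n. f l (w l) - integral\<^sup>L (K l) (f l)) / real n) 0 < e) sequentially"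
        using elim[rule_format, of k] eventually_gt_at_top[of 0]
      proof eventually_elim
        case (elim n)
        then have "\<bar>S n w\<bar> / n < inverse (Suc k)"
          by (simp add: field_simps)
        then show ?case using k elim by (simp add: S_def)
      qed
    qed
  qed
qed

lemma random_frequencies:
  assumes nonneg: "\<And>i. i \<in> {1..m} \<Longrightarrow> 0 \<le> p i" and p1: "(\<Sum>i=1..m. p i) = 1"
  shows "AE \<omega> in bernoulli_seq m p. (\<forall>l. \<omega> l \<in> {1..m}) \<and>
    (\<forall>i\<in>{1..m}. (\<lambda>n. real (card {l. l < n \<and> \<omega> l = i}) / real n) \<longlonglongrightarrow> p i)"
proof -
  define K where "K = point_measure {1..m} (\<lambda>i. ennreal (p i))"
  have "emeasure K (space K) = (\<Sum>i=1..m. ennreal (p i))"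
    by (simp add: K_def space_point_measure emeasure_point_measure_finite)
  also have "\<dots> = 1"
    by (subst sum_ennreal) (use nonneg p1 in auto)
  finally have K: "prob_space K" by (rule prob_spaceI)
  interpret product_prob_space "\<lambda>_. K" "UNIV :: nat set"
    by (intro product_prob_spaceI K)
  have [measurable]: "f \<in> borel_measurable K" for f :: "nat \<Rightarrow> real"
    by (auto simp: K_def measurable_point_measure_eq1)
  have "AE \<omega> in PiM UNIV (\<lambda>_. K). \<forall>i\<in>{1..m}.
     (\<lambda>n. (\<Sum>l<n. indicator {i} (\<omega> l) - integral\<^sup>L K (indicator {i})) / real n) \<longlonglongrightarrow> (0::real)"
    by (intro AE_finite_allI strong_law_PiM[where B = 1] K) (auto simp: indicator_def)
  moreover have "AE \<omega> in PiM UNIV (\<lambda>_. K). \<omega> \<in> space (PiM UNIV (\<lambda>_. K))"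
    by simp
  ultimately have "AE \<omega> in PiM UNIV (\<lambda>_. K). (\<forall>l. \<omega> l \<in> {1..m}) \<and>
    (\<forall>i\<in>{1..m}. (\<lambda>n. real (card {l. l < n \<and> \<omega> l = i}) / real n) \<longlonglongrightarrow> p i)"
  proof eventually_elim
    case (elim \<omega>)
    have "(\<lambda>n. real (card {l. l < n \<and> \<omega> l = i}) / real n) \<longlonglongrightarrow> p i" if i: "i \<in> {1..m}" for i
    proof -
      have "emeasure K {i} = ennreal (p i)"
        using i by (simp add: K_def emeasure_point_measure_finite)
      then have "integral\<^sup>L K (indicator {i} :: nat \<Rightarrow> real) = p i"
        using i nonneg by (simp add: measure_def K_def space_point_measure)
      moreover have "(\<Sum>l<n. indicator {i} (\<omega> l)) = real (card {l. l < n \<and> \<omega> l = i})" for n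
      proof -
        have "(\<Sum>l<n. indicator {i} (\<omega> l) :: real) = (\<Sum>l\<in>{l\<in>{..<n}. \<omega> l = i}. 1)"
          by (rule sum.mono_neutral_cong_right) (auto simp: indicator_def)
        then show ?thesis by simp
      qed
      ultimately have "(\<lambda>n. (real (card {l. l < n \<and> \<omega> l = i}) - real n * p i) / real n) \<longlonglongrightarrow> 0"
        using elim(1)[rule_format, OF i] by (simp add: sum_subtractf)
      then have "(\<lambda>n. (real (card {l. l < n \<and> \<omega> l = i}) - real n * p i) / real n + p i) \<longlonglongrightarrow> 0 + p i"
        by (intro tendsto_add tendsto_const)
      moreover have "eventually (\<lambda>n. (real (card {l. l < n \<and> \<omega> l = i}) - real n * p i) / real n + p i
          = real (card {l. l < n \<and> \<omega> l = i}) / real n) sequentially"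
        using eventually_gt_at_top[of 0] by eventually_elim (simp add: field_simps)
      ultimately show ?thesis
        by (simp add: tendsto_cong)
    qed
    with elim(2) show ?case
      by (auto simp: space_PiM K_def space_point_measure PiE_iff)
  qed
  then show ?thesis by (simp only: bernoulli_seq_def K_def)
qed

section \<open>Hausdorff measure\<close>

text \<open>Padding with empty sets turns a finite cover into the sequence demanded by the
  definition; they contribute 0 for every \<open>s\<close>, including \<open>s = 0\<close>.\<close>

lemma hausdorff_premeasure_le_finite_sum:
  assumes "finite I" and cover: "S \<subseteq> (\<Union>i\<in>I. V i)"
    and V: "\<And>i. i \<in> I \<Longrightarrow> bounded (V i) \<and> diameter (V i) \<le> \<delta>" and "\<delta> > 0"
  shows "hausdorff_premeasure s \<delta> S \<le> (\<Sum>i\<in>I. diam_pow s (V i))"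
proof -
  obtain g :: "nat \<Rightarrow> _" where g: "bij_betw g {..<card I} I"
    using ex_bij_betw_nat_finite[OF \<open>finite I\<close>] by (auto simp: lessThan_atLeast0)
  define U where "U n = (if n < card I then V (g n) else {})" for n
  have "(\<Sum>n. diam_pow s (U n)) = (\<Sum>n<card I. diam_pow s (U n))"
    by (rule suminf_finite) (auto simp: U_def diam_pow_def)
  also have "\<dots> = (\<Sum>n<card I. diam_pow s (V (g n)))"
    by (simp add: U_def)
  also have "\<dots> = (\<Sum>i\<in>I. diam_pow s (V i))"
    by (rule sum.reindex_bij_betw[OF g])
  finally have eq: "(\<Sum>i\<in>I. diam_pow s (V i)) = (\<Sum>n. diam_pow s (U n))" by simp
  have gI: "g n \<in> I" if "n < card I" for n using g that by (auto simp: bij_betw_def)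
  have "S \<subseteq> (\<Union>n. U n)"
  proof
    fix x assume "x \<in> S"
    then obtain i where i: "i \<in> I" "x \<in> V i" using cover by auto
    then obtain n where "n < card I" "i = g n" using g by (auto simp: bij_betw_def)
    with i show "x \<in> (\<Union>n. U n)" by (auto simp: U_def)
  qed
  moreover have "\<forall>n. bounded (U n) \<and> diameter (U n) \<le> \<delta>"
    using V gI \<open>\<delta> > 0\<close> by (auto simp: U_def diameter_empty)
  ultimately show ?thesis
    unfolding hausdorff_premeasure_def eq by (intro Inf_lower) auto
qed

lemma hausdorff_dim_leI:
  assumes "0 \<le> s" and "\<And>\<delta> \<eta>. 0 < \<delta> \<Longrightarrow> 0 < \<eta> \<Longrightarrow> hausdorff_premeasure s \<delta> S \<le> ennreal \<eta>"
  shows "hausdorff_dim S \<le> ereal s"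
proof -
  have "hausdorff_premeasure s \<delta> S = 0" if "\<delta> > 0" for \<delta>
  proof (rule antisym)
    show "hausdorff_premeasure s \<delta> S \<le> 0"
      by (rule ennreal_le_epsilon) (use assms(2) that in auto)
  qed auto
  then have "hausdorff_measure s S = 0"
    by (simp add: hausdorff_measure_def)
  then show ?thesis
    unfolding hausdorff_dim_def using \<open>0 \<le> s\<close> by (intro Inf_lower) auto
qed

text \<open>Mass distribution principle with the mass kept on a code space. No pushforward along
  \<open>f\<close> is formed: the part of \<open>E\<close> sent into a small set only has to be
  caught by a measurable \<open>G\<close> of small measure.\<close>

lemma mass_distribution:
  assumes "E \<in> sets \<mu>" "emeasure \<mu> E > 0" "f ` E \<subseteq> S" and "C > 0" "\<delta> > 0"
    and bound: "\<And>U. bounded U \<Longrightarrow> diameter U \<le> \<delta> \<Longrightarrow>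
       \<exists>G\<in>sets \<mu>. E \<inter> f -` U \<subseteq> G \<and> emeasure \<mu> G \<le> ennreal C * diam_pow s U"
  shows "hausdorff_measure s S \<noteq> 0"
proof
  assume "hausdorff_measure s S = 0"
  moreover have "hausdorff_premeasure s \<delta> S \<le> hausdorff_measure s S"
    unfolding hausdorff_measure_def by (rule SUP_upper) (use \<open>\<delta> > 0\<close> in simp)
  ultimately have "hausdorff_premeasure s \<delta> S = 0"
    by (metis le_zero_eq)
  moreover have "emeasure \<mu> E / ennreal C \<le> hausdorff_premeasure s \<delta> S"
    unfolding hausdorff_premeasure_def
  proof (rule Inf_greatest, clarify)
    fix U :: "nat \<Rightarrow> _" assume U: "S \<subseteq> (\<Union>n. U n)" "\<forall>n. bounded (U n) \<and> diameter (U n) \<le> \<delta>"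
    then have "\<exists>G\<in>sets \<mu>. E \<inter> f -` U n \<subseteq> G \<and> emeasure \<mu> G \<le> ennreal C * diam_pow s (U n)" for n
      by (intro bound) auto
    then obtain G where G: "\<And>n. G n \<in> sets \<mu>" "\<And>n. E \<inter> f -` U n \<subseteq> G n"
      "\<And>n. emeasure \<mu> (G n) \<le> ennreal C * diam_pow s (U n)" by metis
    have "E \<subseteq> (\<Union>n. G n)"
    proof
      fix x assume x: "x \<in> E"
      then have "f x \<in> (\<Union>n. U n)" using assms(3) U(1) by auto
      then obtain n where "f x \<in> U n" by auto
      then have "x \<in> E \<inter> f -` U n" using x by simp
      then have "x \<in> G n" by (rule subsetD[OF G(2)])
      then show "x \<in> (\<Union>n. G n)" by auto
    qed
    then have "emeasure \<mu> E \<le> emeasure \<mu> (\<Union>n. G n)"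
      using G by (intro emeasure_mono) auto
    also have "\<dots> \<le> (\<Sum>n. emeasure \<mu> (G n))"
      using G by (intro emeasure_subadditive_countably) auto
    also have "\<dots> \<le> (\<Sum>n. ennreal C * diam_pow s (U n))"
      by (intro suminf_le G) auto
    also have "\<dots> = ennreal C * (\<Sum>n. diam_pow s (U n))" by simp
    finally show "emeasure \<mu> E / ennreal C \<le> (\<Sum>n. diam_pow s (U n))"
      by (intro divide_le_posI_ennreal) (use \<open>C > 0\<close> in \<open>simp_all add: mult.commute\<close>)
  qed
  ultimately have "emeasure \<mu> E / ennreal C = 0" by (metis le_zero_eq)
  then show False
    using assms(2) by (simp add: ennreal_divide_eq_0_iff)
qed

lemma hausdorff_dim_geI:
  assumes "\<And>s. 0 \<le> s \<Longrightarrow> s < D \<Longrightarrow> hausdorff_measure s S \<noteq> 0"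
  shows "ereal D \<le> hausdorff_dim S"
  unfolding hausdorff_dim_def
  by (rule Inf_greatest) (use assms in \<open>auto simp: not_less[symmetric]\<close>)

section \<open>Nested intervals\<close>

text \<open>Left end point of the image of [0,1] under the first \<open>n\<close> maps x -> r l * x
  + s l, the map of index 0 being outermost; \<open>prod r {..<n}\<close> is the length of that
  interval. Both coordinates of the carpet have this form.\<close>

definition offset :: "(nat \<Rightarrow> real) \<Rightarrow> (nat \<Rightarrow> real) \<Rightarrow> nat \<Rightarrow> real" where
  "offset r s n = (\<Sum>l<n. prod r {..<l} * s l)"

lemma offset_Suc: "offset r s (Suc n) = offset r s n + prod r {..<n} * s n"
  by (simp add: offset_def)

lemma offset_cong: "(\<And>l. l < n \<Longrightarrow> r l = r' l \<and> s l = s' l) \<Longrightarrow> offset r s n = offset r' s' n"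
  unfolding offset_def by (intro sum.cong refl arg_cong2[where f = "(*)"] prod.cong) auto

text \<open>Under these conditions every map sends [0,1] into itself, so deeper intervals lie inside
  earlier ones.\<close>

lemma offset_nested:
  assumes "\<And>l. l < n \<Longrightarrow> 0 \<le> r l \<and> 0 \<le> s l \<and> s l + r l \<le> 1" "k \<le> n"
  shows "offset r s k \<le> offset r s n"
    and "offset r s n + prod r {..<n} \<le> offset r s k + prod r {..<k}"
proof -
  have "offset r s k \<le> offset r s n \<and> offset r s n + prod r {..<n} \<le> offset r s k + prod r {..<k}"
    using \<open>k \<le> n\<close> assms(1)
  proof (induction n rule: dec_induct)
    case (step n)
    have nn: "0 \<le> prod r {..<n}"
      using step.prems by (intro prod_nonneg) auto
    have "prod r {..<n} * (s n + r n) \<le> prod r {..<n} * 1"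
      by (rule mult_left_mono[OF _ nn]) (use step.prems[of n] in simp)
    moreover have "0 \<le> prod r {..<n} * s n"
      by (rule mult_nonneg_nonneg[OF nn]) (use step.prems[of n] in simp)
    moreover have "offset r s k \<le> offset r s n \<and> offset r s n + prod r {..<n} \<le> offset r s k + prod r {..<k}"
      by (rule step.IH) (rule step.prems, simp)
    ultimately show ?case
      unfolding offset_Suc prod.lessThan_Suc distrib_left by linarith
  qed auto
  then show "offset r s k \<le> offset r s n"
    and "offset r s n + prod r {..<n} \<le> offset r s k + prod r {..<k}" by auto
qed

text \<open>Up to level \<open>l\<close> both sequences have the same interval, level
  \<open>l\<close> selects two pieces of it in the right order, and all deeper intervals stay inside
  these pieces. The depths \<open>n\<close> and \<open>n'\<close> are independent because stopping
  times of different words will be compared.\<close>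

lemma offset_separated:
  assumes 1: "\<And>l. l < n \<Longrightarrow> 0 \<le> r l \<and> 0 \<le> s l \<and> s l + r l \<le> 1"
    and 2: "\<And>l. l < n' \<Longrightarrow> 0 \<le> r' l \<and> 0 \<le> s' l \<and> s' l + r' l \<le> 1"
    and eq: "\<And>q. q < l \<Longrightarrow> r q = r' q \<and> s q = s' q" and l: "l < n" "l < n'"
    and sep: "s l + r l \<le> s' l"
  shows "offset r s n + prod r {..<n} \<le> offset r' s' n'"
proof -
  have eq_l: "offset r s l = offset r' s' l" "prod r {..<l} = prod r' {..<l}"
    using eq by (auto intro!: offset_cong prod.cong)
  have "offset r s n + prod r {..<n} \<le> offset r s (Suc l) + prod r {..<Suc l}"
    by (rule offset_nested) (use 1 l in auto)
  also have "offset r s (Suc l) + prod r {..<Suc l} = offset r s l + prod r {..<l} * (s l + r l)"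
    by (simp add: offset_Suc algebra_simps)
  also have "\<dots> \<le> offset r s l + prod r {..<l} * s' l"
    by (intro add_left_mono mult_left_mono sep prod_nonneg) (use 1 l in auto)
  also have "\<dots> = offset r' s' l + prod r' {..<l} * s' l"
    by (simp only: eq_l)
  also have "\<dots> = offset r' s' (Suc l)" by (simp add: offset_Suc)
  also have "\<dots> \<le> offset r' s' n'"
    by (rule offset_nested) (use 2 l in auto)
  finally show ?thesis .
qed

lemma gaps_separated:
  fixes x e :: "nat \<Rightarrow> real"
  assumes gap: "\<And>k. k \<in> {1..<K} \<Longrightarrow> x k < x (k + 1) \<and> e k \<le> x (k + 1) - x k"
    and k: "1 \<le> k" "k < k'" "k' \<le> K"
  shows "x k + e k \<le> x k'"
proof -
  have "Suc k \<le> k'" using k by simp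
  then show ?thesis using k(3)
  proof (induction k' rule: dec_induct)
    case base
    then show ?case using gap[of k] k by simp
  next
    case (step n)
    then show ?case using gap[of n] k by simp
  qed
qed

lemma mem_scaled_interval:
  assumes "0 < p"
  shows "(\<exists>t\<in>{0..1}. z = p * t + o') \<longleftrightarrow> z \<in> {o' .. o' + (p :: real)}"
proof
  assume "z \<in> {o' .. o' + p}"
  then have "(z - o') / p \<in> {0..1}" "z = p * ((z - o') / p) + o'"
    using assms by (auto simp: field_simps)
  then show "\<exists>t\<in>{0..1}. z = p * t + o'" by blast
qed (use assms mult_left_le in \<open>auto intro: mult_left_le\<close>)

section \<open>Geometry of the carpet\<close>

locale carpet =
  fixes m :: nat and M :: "nat \<Rightarrow> nat" and N :: "nat \<Rightarrow> nat \<Rightarrow> nat"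
    and a :: "nat \<Rightarrow> nat \<Rightarrow> nat \<Rightarrow> real" and b :: "nat \<Rightarrow> nat \<Rightarrow> real"
    and c :: "nat \<Rightarrow> nat \<Rightarrow> nat \<Rightarrow> real" and d :: "nat \<Rightarrow> nat \<Rightarrow> real"
  assumes m1: "1 \<le> m"
    and M1: "\<And>i. i \<in> {1..m} \<Longrightarrow> 1 \<le> M i"
    and N1: "\<And>i j. i \<in> {1..m} \<Longrightarrow> j \<in> {1..M i} \<Longrightarrow> 1 \<le> N i j"
    and adm: "admissible m M N a b c d"
begin

lemma ab:
  assumes "i \<in> {1..m}" "j \<in> {1..M i}" "k \<in> {1..N i j}"
  shows "0 < a i j k" "a i j k \<le> b i j" "b i j < 1"
  using adm assms unfolding admissible_def index_set_def by fast+

lemma b_pos: "i \<in> {1..m} \<Longrightarrow> j \<in> {1..M i} \<Longrightarrow> 0 < b i j"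
  using ab[of i j 1] N1[of i j] by simp

lemma row_sum_le_1: "i \<in> {1..m} \<Longrightarrow> j \<in> {1..M i} \<Longrightarrow> (\<Sum>k=1..N i j. a i j k) \<le> 1"
  using adm unfolding admissible_def by blast

lemma d_separated:
  assumes "i \<in> {1..m}" "j \<in> {1..M i}" "j' \<in> {1..M i}" "j < j'"
  shows "d i j + b i j \<le> d i j'"
proof (rule gaps_separated)
  show "d i k < d i (k + 1) \<and> b i k \<le> d i (k + 1) - d i k" if "k \<in> {1..<M i}" for k
    using adm assms(1) that unfolding admissible_def by blast
qed (use assms in auto)

lemma d_bounds:
  assumes i: "i \<in> {1..m}" and j: "j \<in> {1..M i}"
  shows "0 \<le> d i j" "d i j + b i j \<le> 1"
proof -
  have *: "0 \<le> d i 1" "b i (M i) \<le> 1 - d i (M i)" "d i (M i) < 1"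
    using adm i unfolding admissible_def by blast+
  have "j = 1 \<or> d i 1 + b i 1 \<le> d i j" "j = M i \<or> d i j + b i j \<le> d i (M i)"
    using d_separated[OF i, of 1 j] d_separated[OF i j, of "M i"] j M1[OF i]
    by (cases "j = 1"; cases "j = M i"; simp)+
  with * b_pos[OF i, of 1] M1[OF i] show "0 \<le> d i j" "d i j + b i j \<le> 1" by auto
qed

lemma c_separated:
  assumes "i \<in> {1..m}" "j \<in> {1..M i}" "k \<in> {1..N i j}" "k' \<in> {1..N i j}" "k < k'"
  shows "c i j k + a i j k \<le> c i j k'"
proof (rule gaps_separated)
  show "c i j k < c i j (k + 1) \<and> a i j k \<le> c i j (k + 1) - c i j k" if "k \<in> {1..<N i j}" for k
    using adm assms(1,2) that unfolding admissible_def by blast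
qed (use assms in auto)

lemma c_bounds:
  assumes i: "i \<in> {1..m}" and j: "j \<in> {1..M i}" and k: "k \<in> {1..N i j}"
  shows "0 \<le> c i j k" "c i j k + a i j k \<le> 1"
proof -
  have *: "0 \<le> c i j 1" "a i j (N i j) \<le> 1 - c i j (N i j)" "c i j (N i j) < 1"
    using adm i j unfolding admissible_def by blast+
  have "k = 1 \<or> c i j 1 + a i j 1 \<le> c i j k" "k = N i j \<or> c i j k + a i j k \<le> c i j (N i j)"
    using c_separated[OF i j, of 1 k] c_separated[OF i j k, of "N i j"] k N1[OF i j]
    by (cases "k = 1"; cases "k = N i j"; simp)+
  with * ab(1)[OF i j, of 1] N1[OF i j] show "0 \<le> c i j k" "c i j k + a i j k \<le> 1" by auto
qed

definition triples :: "(nat \<times> nat \<times> nat) set" where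
  "triples = (SIGMA i:{1..m}. index_set M N i)"

text \<open>As \<open>a i j k \<le> b i j\<close>, the interval from \<open>amin\<close> to
  \<open>bmax\<close> contains the ratios of both directions.\<close>

definition "amin = Min ((\<lambda>(i, j, k). a i j k) ` triples)"
definition "bmax = Max ((\<lambda>(i, j, k). b i j) ` triples)"

lemma triples: "finite triples" "triples \<noteq> {}"
proof -
  show "finite triples" by (auto simp: triples_def index_set_def)
  have "(1, 1, 1) \<in> triples"
    using m1 M1[of 1] N1[of 1 1] by (auto simp: triples_def index_set_def)
  then show "triples \<noteq> {}" by blast
qed

lemma amin_bmax: "0 < amin" "amin < 1" "0 < bmax" "bmax < 1"
proof -
  have "amin \<in> (\<lambda>(i, j, k). a i j k) ` triples"
    unfolding amin_def by (rule Min_in) (use triples in auto)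
  then obtain i j k where 1: "i \<in> {1..m}" "j \<in> {1..M i}" "k \<in> {1..N i j}" "amin = a i j k"
    by (auto simp: triples_def index_set_def)
  show "0 < amin" "amin < 1" using ab[OF 1(1-3)] 1(4) by auto
  have "bmax \<in> (\<lambda>(i, j, k). b i j) ` triples"
    unfolding bmax_def by (rule Max_in) (use triples in auto)
  then obtain i j k where 2: "i \<in> {1..m}" "j \<in> {1..M i}" "k \<in> {1..N i j}" "bmax = b i j"
    by (auto simp: triples_def index_set_def)
  show "0 < bmax" "bmax < 1" using ab[OF 2(1-3)] 2(4) by auto
qed

lemma amin_le: "i \<in> {1..m} \<Longrightarrow> j \<in> {1..M i} \<Longrightarrow> k \<in> {1..N i j} \<Longrightarrow> amin \<le> a i j k"
  unfolding amin_def by (rule Min_le) (use triples in \<open>force simp: triples_def index_set_def\<close>)+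

lemma le_bmax: "i \<in> {1..m} \<Longrightarrow> j \<in> {1..M i} \<Longrightarrow> b i j \<le> bmax"
  unfolding bmax_def using triples N1[of i j]
  by (intro Max_ge finite_imageI image_eqI[where x = "(i, j, 1)"])
     (auto simp: triples_def index_set_def)

lemma amin_le_b: "i \<in> {1..m} \<Longrightarrow> j \<in> {1..M i} \<Longrightarrow> amin \<le> b i j"
  using amin_le[of i j 1] ab[of i j 1] N1[of i j] by simp

section \<open>Rectangles and points coded by words\<close>

abbreviation "ra \<omega> w \<equiv> \<lambda>l. a (\<omega> l) (fst (w l)) (snd (w l))"
abbreviation "rb \<omega> w \<equiv> \<lambda>l. b (\<omega> l) (fst (w l))"
abbreviation "sc \<omega> w \<equiv> \<lambda>l. c (\<omega> l) (fst (w l)) (snd (w l))"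
abbreviation "sd \<omega> w \<equiv> \<lambda>l. d (\<omega> l) (fst (w l))"

definition pa :: "(nat \<Rightarrow> nat) \<Rightarrow> (nat \<Rightarrow> nat \<times> nat) \<Rightarrow> nat \<Rightarrow> real" where
  "pa \<omega> w n = prod (ra \<omega> w) {..<n}"
definition pb :: "(nat \<Rightarrow> nat) \<Rightarrow> (nat \<Rightarrow> nat \<times> nat) \<Rightarrow> nat \<Rightarrow> real" where
  "pb \<omega> w n = prod (rb \<omega> w) {..<n}"
definition xo :: "(nat \<Rightarrow> nat) \<Rightarrow> (nat \<Rightarrow> nat \<times> nat) \<Rightarrow> nat \<Rightarrow> real" where
  "xo \<omega> w n = offset (ra \<omega> w) (sc \<omega> w) n"
definition yo :: "(nat \<Rightarrow> nat) \<Rightarrow> (nat \<Rightarrow> nat \<times> nat) \<Rightarrow> nat \<Rightarrow> real" where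
  "yo \<omega> w n = offset (rb \<omega> w) (sd \<omega> w) n"

text \<open>Width after \<open>k\<close> levels, height after \<open>n\<close>. For a valid word and
  \<open>k = n\<close> this is the image of the unit square; for \<open>k < n\<close> it is a
  horizontal strip of the level-\<open>k\<close> rectangle, and an approximate square if
  \<open>k\<close> is chosen suitably.\<close>

definition cell :: "(nat \<Rightarrow> nat) \<Rightarrow> (nat \<Rightarrow> nat \<times> nat) \<Rightarrow> nat \<Rightarrow> nat \<Rightarrow> (real \<times> real) set" where
  "cell \<omega> w k n = {xo \<omega> w k .. xo \<omega> w k + pa \<omega> w k} \<times> {yo \<omega> w n .. yo \<omega> w n + pb \<omega> w n}"

definition valid :: "(nat \<Rightarrow> nat) \<Rightarrow> (nat \<Rightarrow> nat \<times> nat) \<Rightarrow> nat \<Rightarrow> bool" where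
  "valid \<omega> w n \<longleftrightarrow> (\<forall>l<n. \<omega> l \<in> {1..m} \<and> w l \<in> index_set M N (\<omega> l))"

lemma validD:
  assumes "valid \<omega> w n" "l < n"
  shows "\<omega> l \<in> {1..m}" "fst (w l) \<in> {1..M (\<omega> l)}" "snd (w l) \<in> {1..N (\<omega> l) (fst (w l))}"
  using assms by (auto simp: valid_def index_set_def mem_Sigma_iff split: prod.splits)

lemma valid_le: "valid \<omega> w n \<Longrightarrow> k \<le> n \<Longrightarrow> valid \<omega> w k"
  by (auto simp: valid_def)

lemma compose_eq:
  "compose_upto (\<lambda>l. carpet_map a b c d (\<omega> l) (w l)) n (x, y) =
     (pa \<omega> w n * x + xo \<omega> w n, pb \<omega> w n * y + yo \<omega> w n)"
proof (induction n arbitrary: x y)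
  case 0
  then show ?case by (simp add: pa_def pb_def xo_def yo_def offset_def)
next
  case (Suc n)
  then show ?case
    by (cases "w n")
       (simp add: carpet_map_def pa_def pb_def xo_def yo_def offset_Suc algebra_simps)
qed

lemma pa_pos: "valid \<omega> w n \<Longrightarrow> 0 < pa \<omega> w n"
  unfolding pa_def by (intro prod_pos) (use validD ab(1) in auto)

lemma pb_pos: "valid \<omega> w n \<Longrightarrow> 0 < pb \<omega> w n"
  unfolding pb_def by (intro prod_pos) (use validD b_pos in auto)

lemma compose_image:
  assumes "valid \<omega> w n"
  shows "compose_upto (\<lambda>l. carpet_map a b c d (\<omega> l) (w l)) n ` ({0..1} \<times> {0..1}) = cell \<omega> w n n"
proof -
  have "z \<in> compose_upto (\<lambda>l. carpet_map a b c d (\<omega> l) (w l)) n ` ({0..1} \<times> {0..1}) \<longleftrightarrow>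
     (\<exists>t\<in>{0..1}. fst z = pa \<omega> w n * t + xo \<omega> w n) \<and> (\<exists>t\<in>{0..1}. snd z = pb \<omega> w n * t + yo \<omega> w n)" for z
    by (cases z) (auto simp: image_iff Bex_def compose_eq)
  then show ?thesis
    unfolding mem_scaled_interval[OF pa_pos[OF assms]] mem_scaled_interval[OF pb_pos[OF assms]]
    by (intro set_eqI) (simp add: cell_def mem_Times_iff)
qed

lemma valid_ratios:
  assumes "valid \<omega> w n" "l < n"
  shows "0 \<le> ra \<omega> w l \<and> 0 \<le> sc \<omega> w l \<and> sc \<omega> w l + ra \<omega> w l \<le> 1"
    and "0 \<le> rb \<omega> w l \<and> 0 \<le> sd \<omega> w l \<and> sd \<omega> w l + rb \<omega> w l \<le> 1"
  using validD[OF assms] c_bounds[of "\<omega> l" "fst (w l)" "snd (w l)"] ab(1)[of "\<omega> l" "fst (w l)" "snd (w l)"]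
    d_bounds[of "\<omega> l" "fst (w l)"] b_pos[of "\<omega> l" "fst (w l)"] by auto

lemma cell_antimono:
  assumes v: "valid \<omega> w k" "valid \<omega> w n" and le: "k' \<le> k" "n' \<le> n"
  shows "cell \<omega> w k n \<subseteq> cell \<omega> w k' n'"
  using offset_nested[of k "ra \<omega> w" "sc \<omega> w" k'] valid_ratios(1)[OF v(1)] le
    offset_nested[of n "rb \<omega> w" "sd \<omega> w" n'] valid_ratios(2)[OF v(2)]
  unfolding cell_def xo_def yo_def pa_def pb_def by (intro Sigma_mono) auto

lemma carpet_subset_cells:
  assumes z: "z \<in> random_carpet M N a b c d \<omega>" and \<omega>: "\<And>l. \<omega> l \<in> {1..m}" and n: "1 \<le> n"
  obtains w where "valid \<omega> w n" "z \<in> cell \<omega> w n n"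
proof -
  obtain w where w: "w \<in> (\<Pi>\<^sub>E l\<in>{..<n}. index_set M N (\<omega> l))"
    "z \<in> compose_upto (\<lambda>l. carpet_map a b c d (\<omega> l) (w l)) n ` ({0..1} \<times> {0..1})"
    using z n unfolding random_carpet_def by blast
  moreover have "valid \<omega> w n" using w(1) \<omega> by (auto simp: valid_def PiE_iff)
  ultimately show thesis using that compose_image by blast
qed

lemma cell_cong:
  assumes "\<And>l. l < n \<Longrightarrow> fst (w l) = fst (w' l)" "\<And>l. l < k \<Longrightarrow> w l = w' l"
  shows "cell \<omega> w k n = cell \<omega> w' k n"
proof -
  have "xo \<omega> w k = xo \<omega> w' k" "yo \<omega> w n = yo \<omega> w' n"
    unfolding xo_def yo_def by (rule offset_cong; use assms in simp)+
  moreover have "pa \<omega> w k = pa \<omega> w' k" "pb \<omega> w n = pb \<omega> w' n"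
    unfolding pa_def pb_def by (rule prod.cong; use assms in simp)+
  ultimately show ?thesis by (simp add: cell_def)
qed

lemma compact_cell: "compact (cell \<omega> w k n)"
  unfolding cell_def by (intro compact_Times compact_Icc)

lemma coded_point:
  assumes v: "\<And>n. valid \<omega> w n"
  obtains z where "z \<in> random_carpet M N a b c d \<omega>" "\<And>k n. z \<in> cell \<omega> w k n"
proof -
  have "(\<Inter>n. cell \<omega> w n n) \<noteq> {}"
  proof (rule compact_nest)
    show "cell \<omega> w n n \<noteq> {}" for n
      using pa_pos[OF v, of n] pb_pos[OF v, of n] by (auto simp: cell_def)
  qed (auto intro: compact_cell subsetD[OF cell_antimono[OF v v]])
  then obtain z where z: "\<And>n. z \<in> cell \<omega> w n n" by blast
  have "z \<in> cell \<omega> w k n" for k n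
    using z[of "max k n"] cell_antimono[OF v v, of k "max k n" n "max k n"] by auto
  moreover have "z \<in> random_carpet M N a b c d \<omega>"
    unfolding random_carpet_def
  proof (intro INT_I UN_I)
    fix n :: nat
    \<comment> \<open>Words in \<open>random_carpet\<close> are extensional on the first
      \<open>n\<close> levels, hence the restriction; validity up to \<open>n\<close> and the cell
      are unchanged by it.\<close>
    show "restrict w {..<n} \<in> (\<Pi>\<^sub>E l\<in>{..<n}. index_set M N (\<omega> l))"
      using v[of n] by (auto simp: valid_def)
    have "valid \<omega> (restrict w {..<n}) n" using v[of n] by (simp add: valid_def)
    moreover have "cell \<omega> (restrict w {..<n}) n n = cell \<omega> w n n"
      by (rule cell_cong) auto
    ultimately show "z \<in> compose_upto (\<lambda>l. carpet_map a b c d (\<omega> l) (restrict w {..<n} l)) n ` ({0..1} \<times> {0..1})"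
      using z[of n] compose_image[of \<omega> "restrict w {..<n}" n] by simp
  qed
  ultimately show thesis using that by blast
qed

lemma diameter_cell:
  assumes "valid \<omega> w k" "valid \<omega> w n" "pa \<omega> w k \<le> pb \<omega> w n"
  shows "bounded (cell \<omega> w k n)" "diameter (cell \<omega> w k n) \<le> 2 * pb \<omega> w n"
proof -
  show "bounded (cell \<omega> w k n)" by (rule compact_imp_bounded[OF compact_cell])
  show "diameter (cell \<omega> w k n) \<le> 2 * pb \<omega> w n"
  proof (rule diameter_le)
    show "cell \<omega> w k n \<noteq> {} \<or> 0 \<le> 2 * pb \<omega> w n" using pb_pos[OF assms(2)] by simp
    fix z z' assume "z \<in> cell \<omega> w k n" "z' \<in> cell \<omega> w k n"
    then have 1: "\<bar>fst z - fst z'\<bar> \<le> pb \<omega> w n" "\<bar>snd z - snd z'\<bar> \<le> pb \<omega> w n"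
      using assms(3) by (auto simp: cell_def)
    \<comment> \<open>The factor 2 arises from bounding the Euclidean norm by the sum of the two
      coordinates.\<close>
    have "z - z' = (fst z - fst z', snd z - snd z')"
      by (simp add: prod_eq_iff)
    then have "norm (z - z') \<le> norm (fst z - fst z') + norm (snd z - snd z')"
      using norm_Pair_le[of "fst z - fst z'" "snd z - snd z'"] by simp
    with 1 show "norm (z - z') \<le> 2 * pb \<omega> w n" by simp
  qed
qed

end

section \<open>The variational formula\<close>

declare One_nat_def [simp del]

lemma xlnx_bounds: "0 \<le> x \<Longrightarrow> x \<le> 1 \<Longrightarrow> -1 \<le> x * ln x \<and> x * ln x \<le> (0 :: real)"
proof (cases "x = 0")
  case False
  assume x: "0 \<le> x" "x \<le> 1"
  have "ln (inverse x) \<le> inverse x - 1"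
    using x False by (intro ln_le_minus_one) auto
  then have "x * ln (inverse x) \<le> x * (inverse x - 1)"
    using x by (intro mult_left_mono) auto
  then have "- (x * ln x) \<le> 1 - x" using x False by (simp add: ln_inverse right_diff_distrib)
  then show ?thesis using x False by (auto intro: mult_nonneg_nonpos)
qed auto

lemma abs_convex_comb_le:
  fixes q f :: "'i \<Rightarrow> real"
  assumes "\<And>j. j \<in> J \<Longrightarrow> 0 \<le> q j" "(\<Sum>j\<in>J. q j) = 1" "\<And>j. j \<in> J \<Longrightarrow> \<bar>f j\<bar> \<le> B"
  shows "\<bar>\<Sum>j\<in>J. q j * f j\<bar> \<le> B"
proof -
  have "\<bar>\<Sum>j\<in>J. q j * f j\<bar> \<le> (\<Sum>j\<in>J. q j * B)"
    by (rule order.trans[OF sum_abs sum_mono]) (use assms in \<open>auto simp: abs_mult intro!: mult_left_mono\<close>)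
  then show ?thesis by (simp flip: sum_distrib_right add: assms)
qed

locale weighted_carpet = carpet +
  fixes p :: "nat \<Rightarrow> real"
  assumes p_pos: "\<And>i. i \<in> {1..m} \<Longrightarrow> 0 < p i" and p_sum: "(\<Sum>i=1..m. p i) = 1"
begin

text \<open>Row distributions are parametrised by their conditional probabilities \<open>q i j = P i j / p i\<close>;
  all the averages then become linear in the weights \<open>p\<close>.\<close>

definition Q :: "(nat \<Rightarrow> nat \<Rightarrow> real) set" where
  "Q = {q. \<forall>i\<in>{1..m}. (\<forall>j\<in>{1..M i}. 0 \<le> q i j) \<and> (\<Sum>j=1..M i. q i j) = 1}"
definition S :: "nat \<Rightarrow> nat \<Rightarrow> real \<Rightarrow> real" where
  "S i j t = (\<Sum>k=1..N i j. a i j k powr t)"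
text \<open>\<open>- h q i\<close> is the entropy of the choice of a row given system
  \<open>i\<close>; \<open>av (h q)\<close> will be the numerator of
  \<open>lambda_dim\<close>.\<close>

definition h :: "(nat \<Rightarrow> nat \<Rightarrow> real) \<Rightarrow> nat \<Rightarrow> real" where
  "h q i = (\<Sum>j=1..M i. q i j * ln (q i j))"
definition be :: "(nat \<Rightarrow> nat \<Rightarrow> real) \<Rightarrow> nat \<Rightarrow> real" where
  "be q i = (\<Sum>j=1..M i. q i j * ln (b i j))"
text \<open>Its average \<open>av (sg q t)\<close> is the left-hand side of the equation that
  determines \<open>t_dim\<close>.\<close>

definition sg :: "(nat \<Rightarrow> nat \<Rightarrow> real) \<Rightarrow> real \<Rightarrow> nat \<Rightarrow> real" where
  "sg q t i = (\<Sum>j=1..M i. q i j * ln (S i j t))"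
definition av :: "(nat \<Rightarrow> real) \<Rightarrow> real" where
  "av f = (\<Sum>i=1..m. p i * f i)"
definition lam :: "(nat \<Rightarrow> nat \<Rightarrow> real) \<Rightarrow> real" where
  "lam q = av (h q) / av (be q)"
definition tt :: "(nat \<Rightarrow> nat \<Rightarrow> real) \<Rightarrow> real" where
  "tt q = t_dim m M N a (\<lambda>i j. p i * q i j)"
text \<open>One bound for \<open>h q\<close>, \<open>be q\<close> and \<open>sg q t\<close> at once,
  for all \<open>q\<close> in \<open>Q\<close> and \<open>t\<close> in [0,1]. \<open>M i\<close>
  serves the entropy, whose terms are at least -1; \<open>N i j\<close> and \<open>- ln amin\<close>
  control \<open>ln (S i j t)\<close> from above and below, and \<open>- ln amin\<close> also
  controls \<open>ln (b i j)\<close>. The sums merely dominate maxima.\<close>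

definition Bd :: real where
  "Bd = real (\<Sum>i=1..m. M i) + real (\<Sum>i=1..m. \<Sum>j=1..M i. N i j) - ln amin"

lemma QD:
  assumes "q \<in> Q" "i \<in> {1..m}"
  shows "\<And>j. j \<in> {1..M i} \<Longrightarrow> 0 \<le> q i j" "(\<Sum>j=1..M i. q i j) = 1"
    "\<And>j. j \<in> {1..M i} \<Longrightarrow> q i j \<le> 1"
proof -
  show *: "\<And>j. j \<in> {1..M i} \<Longrightarrow> 0 \<le> q i j" "(\<Sum>j=1..M i. q i j) = 1"
    using assms by (auto simp: Q_def)
  show "q i j \<le> 1" if "j \<in> {1..M i}" for j
    using member_le_sum[of j "{1..M i}" "q i"] * that by auto
qed

lemma Bd_parts:
  assumes i: "i \<in> {1..m}"
  shows "real (M i) \<le> Bd" "- ln amin \<le> Bd" "j \<in> {1..M i} \<Longrightarrow> real (N i j) \<le> Bd" "Bd > 0"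
proof -
  define X Y where "X = (\<Sum>i=1..m. M i)" and "Y = (\<Sum>i=1..m. \<Sum>j=1..M i. N i j)"
  have Bd: "Bd = real X + real Y - ln amin" by (simp add: Bd_def X_def Y_def)
  have 1: "M i \<le> X" unfolding X_def using i by (intro member_le_sum) auto
  have 2: "N i j \<le> Y" if "j \<in> {1..M i}"
  proof -
    have "N i j \<le> (\<Sum>j=1..M i. N i j)" using that by (intro member_le_sum) auto
    also have "\<dots> \<le> Y" unfolding Y_def using i by (intro member_le_sum) auto
    finally show ?thesis .
  qed
  have 3: "ln amin < 0" using amin_bmax by simp
  show "real (M i) \<le> Bd" "- ln amin \<le> Bd" using 1 3 unfolding Bd by linarith+
  show "Bd > 0" using 3 unfolding Bd by linarith
  show "real (N i j) \<le> Bd" if "j \<in> {1..M i}"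
    using 2[OF that] 3 unfolding Bd by linarith
qed

lemma S_bounds:
  assumes i: "i \<in> {1..m}" and j: "j \<in> {1..M i}" and t: "0 \<le> t" "t \<le> 1"
  shows "amin \<le> S i j t" "S i j t \<le> real (N i j)" "0 < S i j t" "\<bar>ln (S i j t)\<bar> \<le> Bd"
proof -
  have ak: "0 < a i j k" "a i j k < 1" "amin \<le> a i j k" if "k \<in> {1..N i j}" for k
    using ab[OF i j that] amin_le[OF i j that] by auto
  have "amin \<le> a i j 1 powr 1" using ak[of 1] N1[OF i j] by auto
  also have "\<dots> \<le> a i j 1 powr t" using ak[of 1] N1[OF i j] t by (intro powr_mono') auto
  also have "\<dots> \<le> S i j t" unfolding S_def
    using N1[OF i j] by (intro member_le_sum) auto
  finally show 1: "amin \<le> S i j t" .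
  with amin_bmax show 2: "0 < S i j t" by linarith
  have "S i j t \<le> (\<Sum>k=1..N i j. 1)" unfolding S_def
    using ak t by (intro sum_mono powr_le1) (auto simp: less_imp_le)
  then show 3: "S i j t \<le> real (N i j)" by simp
  have "ln amin \<le> ln (S i j t)" using 1 2 amin_bmax by simp
  moreover have "ln (S i j t) \<le> S i j t" using ln_le_minus_one[OF 2] by linarith
  ultimately show "\<bar>ln (S i j t)\<bar> \<le> Bd"
    using 3 Bd_parts[OF i] j by (smt (verit))
qed

lemma lnb_bounds:
  assumes i: "i \<in> {1..m}" and j: "j \<in> {1..M i}"
  shows "ln amin \<le> ln (b i j)" "ln (b i j) \<le> ln bmax"
  using amin_le_b[OF i j] le_bmax[OF i j] amin_bmax by auto

lemma h_bounds:
  assumes "q \<in> Q" "i \<in> {1..m}"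
  shows "h q i \<le> 0" "\<bar>h q i\<bar> \<le> Bd"
proof -
  have x: "-1 \<le> q i j * ln (q i j) \<and> q i j * ln (q i j) \<le> 0" if "j \<in> {1..M i}" for j
    using xlnx_bounds QD[OF assms] that by simp
  have "h q i \<le> (\<Sum>j=1..M i. 0)" unfolding h_def by (intro sum_mono) (use x in auto)
  then show 1: "h q i \<le> 0" by simp
  have "(\<Sum>j=1..M i. -1) \<le> h q i" unfolding h_def by (intro sum_mono) (use x in auto)
  then show "\<bar>h q i\<bar> \<le> Bd" using 1 Bd_parts(1)[OF assms(2)] by simp
qed

lemma sg_bound:
  assumes "q \<in> Q" "i \<in> {1..m}" "0 \<le> t" "t \<le> 1"
  shows "\<bar>sg q t i\<bar> \<le> Bd"
  unfolding sg_def using QD[OF assms(1,2)] S_bounds(4)[OF assms(2) _ assms(3,4)]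
  by (intro abs_convex_comb_le) auto

lemma be_bounds:
  assumes "q \<in> Q" "i \<in> {1..m}"
  shows "be q i \<le> ln bmax" "\<bar>be q i\<bar> \<le> Bd"
proof -
  have "be q i \<le> (\<Sum>j=1..M i. q i j * ln bmax)" unfolding be_def
    using QD[OF assms] lnb_bounds(2)[OF assms(2)] by (intro sum_mono mult_left_mono) auto
  then show "be q i \<le> ln bmax" by (simp flip: sum_distrib_right add: QD[OF assms])
  have "\<bar>ln (b i j)\<bar> \<le> Bd" if "j \<in> {1..M i}" for j
    using lnb_bounds[OF assms(2) that] Bd_parts(2)[OF assms(2)] amin_bmax
      ln_less_zero[of bmax] by linarith
  then show "\<bar>be q i\<bar> \<le> Bd" unfolding be_def
    using QD[OF assms] by (intro abs_convex_comb_le) auto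
qed

lemma av_mono: "(\<And>i. i \<in> {1..m} \<Longrightarrow> f i \<le> g i) \<Longrightarrow> av f \<le> av g"
  unfolding av_def using p_pos by (intro sum_mono mult_left_mono) (auto simp: less_imp_le)

lemma av_const [simp]: "av (\<lambda>_. x) = x"
  by (simp add: av_def p_sum flip: sum_distrib_right)

text \<open>The two-sided bound on \<open>lam\<close> limits how often it can drop by a fixed
  amount, which ends the iteration in \<open>iterated_cap\<close>; the product form is what enters
  the exponent estimates.\<close>

lemma lam_bounds:
  assumes "q \<in> Q"
  shows "0 \<le> lam q" "lam q \<le> Bd / (- ln bmax)" "lam q * av (be q) = av (h q)" "av (be q) \<le> ln bmax"
proof -
  have b: "av (be q) \<le> ln bmax" using av_mono[of "be q" "\<lambda>_. ln bmax"] be_bounds[OF assms] by simp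
  then show "av (be q) \<le> ln bmax" .
  have h: "av (h q) \<le> 0" "- Bd \<le> av (h q)"
    using av_mono[of "h q" "\<lambda>_. 0"] av_mono[of "\<lambda>_. - Bd" "h q"] h_bounds[OF assms]
    unfolding av_const by (simp_all add: abs_le_iff) (metis minus_le_iff)
  have neg: "ln bmax < 0" using amin_bmax by simp
  have lam: "lam q = (- av (h q)) / (- av (be q))" by (simp add: lam_def)
  show "0 \<le> lam q" unfolding lam using h b neg by (intro divide_nonneg_nonneg) auto
  show "lam q \<le> Bd / (- ln bmax)" unfolding lam using h b neg by (intro frac_le) auto
  show "lam q * av (be q) = av (h q)" unfolding lam_def using b neg by auto
qed

lemma S_strict_antimono:
  assumes i: "i \<in> {1..m}" and j: "j \<in> {1..M i}" and t: "t < t'"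
  shows "S i j t' < S i j t"
  unfolding S_def
proof (rule sum_strict_mono)
  fix k assume "k \<in> {1..N i j}"
  then show "a i j k powr t' < a i j k powr t"
    using ab[OF i j, of k] t by (intro powr_less_mono') auto
qed (use N1[OF i j] in auto)

lemma t_dim_props:
  assumes P: "P \<in> row_distributions m p M"
  shows "t_dim m M N a P \<in> {0..1}"
    "(\<Sum>i=1..m. \<Sum>j=1..M i. P i j * ln (S i j (t_dim m M N a P))) = 0"
proof -
  define g where "g t = (\<Sum>i=1..m. \<Sum>j=1..M i. P i j * ln (S i j t))" for t
  have P0: "0 \<le> P i j" if "i \<in> {1..m}" "j \<in> {1..M i}" for i j
    using P that by (auto simp: row_distributions_def)
  have cont: "continuous_on {0..1} g"
    unfolding g_def S_def
  proof (intro continuous_intros)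
    fix i j assume "i \<in> {1..m}" "j \<in> {1..M i}"
    then show "\<forall>t\<in>{0..1}. (\<Sum>k=1..N i j. a i j k powr t) \<noteq> 0"
      using S_bounds(3) unfolding S_def by fastforce
    fix k assume "k \<in> {1..N i j}"
    with \<open>i \<in> _\<close> \<open>j \<in> _\<close> ab(1) show "\<forall>t\<in>{0..1}. a i j k \<noteq> 0"
      by fastforce
  qed
  have anti: "g t' < g t" if t: "0 \<le> t" "t < t'" "t' \<le> 1" for t t'
  proof -
    \<comment> \<open>A vanishing weight gives no strict decrease; since \<open>p 1 > 0\<close>,
      some row of system 1 has positive weight.\<close>
    obtain j where j: "j \<in> {1..M 1}" "P 1 j > 0"
    proof -
      have "(\<Sum>j=1..M 1. P 1 j) > 0" using P m1 p_pos[of 1] by (auto simp: row_distributions_def)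
      then have "\<exists>j\<in>{1..M 1}. P 1 j > 0"
        by (metis not_less sum_nonpos)
      then show thesis using that by blast
    qed
    have lt: "ln (S i j t') < ln (S i j t)" if "i \<in> {1..m}" "j \<in> {1..M i}" for i j
      using S_strict_antimono[OF that t(2)] S_bounds(3)[OF that, of t'] t by simp
    have le: "P i j * ln (S i j t') \<le> P i j * ln (S i j t)" if "i \<in> {1..m}" "j \<in> {1..M i}" for i j
      using lt[OF that] P0[OF that] by (intro mult_left_mono) auto
    show ?thesis unfolding g_def
    proof (rule sum_strict_mono_ex1)
      show "\<forall>i\<in>{1..m}. (\<Sum>j=1..M i. P i j * ln (S i j t')) \<le> (\<Sum>j=1..M i. P i j * ln (S i j t))"
        using le by (auto intro: sum_mono)
      have "(\<Sum>j=1..M 1. P 1 j * ln (S 1 j t')) < (\<Sum>j=1..M 1. P 1 j * ln (S 1 j t))"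
        by (rule sum_strict_mono_ex1) (use le lt m1 j in \<open>auto intro!: bexI[of _ j]\<close>)
      then show "\<exists>i\<in>{1..m}. (\<Sum>j=1..M i. P i j * ln (S i j t')) < (\<Sum>j=1..M i. P i j * ln (S i j t))"
        using m1 by (intro bexI[of _ 1]) auto
    qed auto
  qed
  have g0: "0 \<le> g 0" unfolding g_def
  proof (intro sum_nonneg mult_nonneg_nonneg P0)
    fix i j assume ij: "i \<in> {1..m}" "j \<in> {1..M i}"
    have "S i j 0 = real (N i j)" unfolding S_def using ab(1)[OF ij]
      by (simp add: less_imp_neq[symmetric])
    then show "0 \<le> ln (S i j 0)" using N1[OF ij] by simp
  qed
  have g1: "g 1 \<le> 0" unfolding g_def
  proof (intro sum_nonpos mult_nonneg_nonpos P0)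
    fix i j assume ij: "i \<in> {1..m}" "j \<in> {1..M i}"
    have "S i j 1 = (\<Sum>k=1..N i j. a i j k)" unfolding S_def
      by (intro sum.cong) (use ab(1)[OF ij] in \<open>auto simp: less_imp_le\<close>)
    then show "ln (S i j 1) \<le> 0" using row_sum_le_1[OF ij] S_bounds(3)[OF ij, of 1] by simp
  qed
  obtain t where t: "0 \<le> t" "t \<le> 1" "g t = 0"
    using IVT2'[of g 1 0 0] cont g0 g1 by auto
  have "\<exists>!t. t \<in> {0..1} \<and> g t = 0"
  proof (rule ex1I[of _ t])
    show "t' = t" if "t' \<in> {0..1} \<and> g t' = 0" for t'
      using anti[of t t'] anti[of t' t] t that by (cases t t' rule: linorder_cases) auto
  qed (use t in auto)
  from theI'[OF this]
  show "t_dim m M N a P \<in> {0..1}"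
    "(\<Sum>i=1..m. \<Sum>j=1..M i. P i j * ln (S i j (t_dim m M N a P))) = 0"
    by (auto simp: t_dim_def g_def S_def)
qed

lemma Q_imp_row_distribution: "q \<in> Q \<Longrightarrow> (\<lambda>i j. p i * q i j) \<in> row_distributions m p M"
  using p_pos by (auto simp: row_distributions_def Q_def less_imp_le simp flip: sum_distrib_left)

lemma tt_props:
  assumes "q \<in> Q"
  shows "0 \<le> tt q" "tt q \<le> 1" "av (sg q (tt q)) = 0"
  using t_dim_props[OF Q_imp_row_distribution[OF assms]]
  by (auto simp: tt_def av_def sg_def sum_distrib_left mult.assoc)

text \<open>Chain rule for entropy: the logarithm of \<open>p i * q i j\<close> splits, and since
  the \<open>q i j\<close> sum to 1 the part coming from \<open>p\<close> is exactly what
  \<open>lambda_dim\<close> subtracts.\<close>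

lemma lambda_dim_conv_lam:
  assumes q: "q \<in> Q"
  shows "lambda_dim m p M b (\<lambda>i j. p i * q i j) = lam q"
proof -
  have "(\<Sum>j=1..M i. p i * q i j * ln (p i * q i j)) - p i * ln (p i) = p i * h q i"
    if i: "i \<in> {1..m}" for i
  proof -
    have "(\<Sum>j=1..M i. p i * q i j * ln (p i * q i j))
       = (\<Sum>j=1..M i. p i * (q i j * ln (q i j)) + q i j * (p i * ln (p i)))"
    proof (rule sum.cong[OF refl])
      fix j assume "j \<in> {1..M i}"
      then show "p i * q i j * ln (p i * q i j) = p i * (q i j * ln (q i j)) + q i j * (p i * ln (p i))"
        using p_pos[OF i] QD(1)[OF q i, of j]
        by (cases "q i j = 0") (auto simp: ln_mult algebra_simps)
    qed
    also have "\<dots> = p i * h q i + (\<Sum>j=1..M i. q i j) * (p i * ln (p i))"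
      by (simp add: sum.distrib h_def sum_distrib_left sum_distrib_right)
    finally show ?thesis by (simp add: QD[OF q i])
  qed
  then have "(\<Sum>i=1..m. \<Sum>j=1..M i. p i * q i j * ln (p i * q i j)) - (\<Sum>i=1..m. p i * ln (p i)) = av (h q)"
    unfolding av_def by (simp flip: sum_subtractf)
  moreover have "(\<Sum>i=1..m. \<Sum>j=1..M i. p i * q i j * ln (b i j)) = av (be q)"
    by (simp add: av_def be_def sum_distrib_left mult.assoc)
  ultimately show ?thesis by (simp add: lambda_dim_def lam_def)
qed

lemma SUP_row_distributions:
  "(SUP P\<in>row_distributions m p M. ereal (lambda_dim m p M b P + t_dim m M N a P))
     = (SUP q\<in>Q. ereal (lam q + tt q))"
proof (rule antisym)
  show "(SUP q\<in>Q. ereal (lam q + tt q))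
    \<le> (SUP P\<in>row_distributions m p M. ereal (lambda_dim m p M b P + t_dim m M N a P))"
  proof (rule SUP_mono)
    fix q assume q: "q \<in> Q"
    show "\<exists>P\<in>row_distributions m p M.
       ereal (lam q + tt q) \<le> ereal (lambda_dim m p M b P + t_dim m M N a P)"
      by (rule bexI[OF _ Q_imp_row_distribution[OF q]])
         (simp add: lambda_dim_conv_lam[OF q] tt_def)
  qed
  show "(SUP P\<in>row_distributions m p M. ereal (lambda_dim m p M b P + t_dim m M N a P))
    \<le> (SUP q\<in>Q. ereal (lam q + tt q))"
  proof (rule SUP_mono)
    fix P assume P: "P \<in> row_distributions m p M"
    define q where "q i j = P i j / p i" for i j
    have q: "q \<in> Q" using P p_pos
      by (auto simp: Q_def q_def row_distributions_def less_imp_le simp flip: sum_divide_distrib)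
        (metis less_numeral_extra(3) atLeastAtMost_iff One_nat_def)
    have eq: "P i j = p i * q i j" if "i \<in> {1..m}" for i j
      using p_pos[OF that] by (simp add: q_def)
    have "lambda_dim m p M b P = lambda_dim m p M b (\<lambda>i j. p i * q i j)"
      unfolding lambda_dim_def by (simp add: eq)
    moreover have "t_dim m M N a P = tt q"
      unfolding t_dim_def tt_def by (simp add: eq)
    ultimately show "\<exists>q\<in>Q. ereal (lambda_dim m p M b P + t_dim m M N a P) \<le> ereal (lam q + tt q)"
      using lambda_dim_conv_lam[OF q] q by auto
  qed
qed

lemma Q_nonempty: "Q \<noteq> {}"
proof -
  have "(\<lambda>i j. 1 / real (M i)) \<in> Q"
    using M1 by (force simp: Q_def)
  then show ?thesis by blast
qed

section \<open>Driving sequences with the right letter frequencies\<close>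

definition typical :: "(nat \<Rightarrow> nat) \<Rightarrow> bool" where
  "typical \<omega> \<longleftrightarrow> (\<forall>l. \<omega> l \<in> {1..m}) \<and>
     (\<forall>i\<in>{1..m}. (\<lambda>n. real (card {l. l < n \<and> \<omega> l = i}) / real n) \<longlonglongrightarrow> p i)"

text \<open>The threshold \<open>n0\<close> is chosen before the integrand: later \<open>f\<close>
  is built from the row frequencies of whatever square is at hand. This is possible because the sum
  sees \<open>\<omega>\<close> only through its letter counts, and the total deviation of their
  frequencies from \<open>p\<close> does not involve \<open>f\<close>.\<close>

lemma typical_average:
  assumes "typical \<omega>" "e > 0"
  shows "\<exists>n0. \<forall>n\<ge>n0. \<forall>f B. (\<forall>i\<in>{1..m}. \<bar>f i\<bar> \<le> B) \<longrightarrow>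
     \<bar>(\<Sum>l<n. f (\<omega> l)) - real n * av f\<bar> \<le> e * B * real n"
proof -
  define r where "r n i = real (card {l. l < n \<and> \<omega> l = i})" for n i
  have "(\<lambda>n. \<Sum>i=1..m. \<bar>r n i / real n - p i\<bar>) \<longlonglongrightarrow> (\<Sum>i=1..m. \<bar>p i - p i\<bar>)"
    using assms(1) unfolding typical_def r_def by (intro tendsto_intros) auto
  then have "(\<lambda>n. \<Sum>i=1..m. \<bar>r n i / real n - p i\<bar>) \<longlonglongrightarrow> 0" by simp
  from order_tendstoD(2)[OF this \<open>e > 0\<close>]
  obtain n0 where n0: "\<And>n. n \<ge> n0 \<Longrightarrow> (\<Sum>i=1..m. \<bar>r n i / real n - p i\<bar>) < e"
    by (auto simp: eventually_sequentially)
  have "\<bar>(\<Sum>l<n. f (\<omega> l)) - real n * av f\<bar> \<le> e * B * real n"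
    if n: "n \<ge> max n0 1" and f: "\<And>i. i \<in> {1..m} \<Longrightarrow> \<bar>f i\<bar> \<le> B" for n f B
  proof -
    have B: "0 \<le> B" using f[of 1] m1 by auto
    have "(\<Sum>l<n. f (\<omega> l)) = (\<Sum>i=1..m. \<Sum>l\<in>{l\<in>{..<n}. \<omega> l = i}. f (\<omega> l))"
      by (rule sum.group[symmetric]) (use assms(1) in \<open>auto simp: typical_def\<close>)
    also have "\<dots> = (\<Sum>i=1..m. r n i * f i)"
      by (intro sum.cong) (auto simp: r_def)
    finally have "(\<Sum>l<n. f (\<omega> l)) - real n * av f = (\<Sum>i=1..m. (r n i - n * p i) * f i)"
      by (simp add: av_def sum_distrib_left sum_subtractf left_diff_distrib mult.assoc)
    also have "\<bar>\<dots>\<bar> \<le> (\<Sum>i=1..m. (\<bar>r n i / real n - p i\<bar>) * (n * B))"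
    proof (rule order.trans[OF sum_abs sum_mono])
      fix i assume i: "i \<in> {1..m}"
      have "\<bar>(r n i - n * p i) * f i\<bar> = \<bar>r n i / real n - p i\<bar> * n * \<bar>f i\<bar>"
      proof -
        have "r n i - n * p i = (r n i / n - p i) * n"
          using n by (simp add: left_diff_distrib)
        then show ?thesis by (simp only: abs_mult abs_of_nat)
      qed
      also have "\<dots> \<le> \<bar>r n i / real n - p i\<bar> * n * B"
        using f[OF i] by (intro mult_left_mono) auto
      finally show "\<bar>(r n i - n * p i) * f i\<bar> \<le> \<bar>r n i / real n - p i\<bar> * (n * B)" by (simp add: mult.assoc)
    qed
    also have "\<dots> = (\<Sum>i=1..m. \<bar>r n i / real n - p i\<bar>) * (n * B)"
      by (simp add: sum_distrib_right)
    also have "\<dots> \<le> e * (n * B)"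
      using n0[of n] n B by (intro mult_right_mono) auto
    finally show ?thesis by (simp add: mult_ac)
  qed
  then show ?thesis by (intro exI[of _ "max n0 1"]) blast
qed

end

section \<open>Upper bound\<close>

text \<open>The polynomial is absorbed by half of the exponential decay, through (1 + x/K)^K \<le>
  exp x with x = \<gamma> n / 2.\<close>

lemma summable_power_times_exp:
  assumes "\<gamma> > 0"
  shows "summable (\<lambda>n. real (n + 1) ^ K * exp (- (\<gamma> * real n)))"
proof (cases "K = 0")
  case True
  then show ?thesis using summable_exp_neg[OF assms] by simp
next
  case False
  \<comment> \<open>Makes n + 1 at most c (1 + \<gamma> n / (2 K)): the 1 takes care of the constant
    term, 2 K / \<gamma> of the linear one.\<close>
  define c where "c = max 1 (2 * real K / \<gamma>)"
  have c: "1 \<le> c" "2 * real K / \<gamma> \<le> c" by (auto simp: c_def)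
  have le: "real (n + 1) ^ K \<le> c ^ K * exp (\<gamma> / 2 * real n)" for n
  proof -
    have "real n = 2 * real K / \<gamma> * (\<gamma> / 2 * real n / real K)" using assms False by simp
    also have "\<dots> \<le> c * (\<gamma> / 2 * real n / real K)" using c assms by (intro mult_right_mono) auto
    finally have "real (n + 1) \<le> c * (1 + (\<gamma> / 2 * real n) / real K)" using c by (simp add: algebra_simps)
    then have "real (n + 1) ^ K \<le> (c * (1 + (\<gamma> / 2 * real n) / real K)) ^ K" by (intro power_mono) auto
    also have "\<dots> = c ^ K * (1 + (\<gamma> / 2 * real n) / real K) ^ K" by (rule power_mult_distrib)
    also have "\<dots> \<le> c ^ K * exp (\<gamma> / 2 * real n)"
    proof (rule mult_left_mono)
      have "0 \<le> \<gamma> / 2 * real n" using assms by simp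
      then show "(1 + (\<gamma> / 2 * real n) / real K) ^ K \<le> exp (\<gamma> / 2 * real n)"
        using False by (intro exp_ge_one_plus_x_over_n_power_n) linarith+
    qed (use c in auto)
    finally show ?thesis .
  qed
  show ?thesis
  proof (rule summable_comparison_test')
    show "summable (\<lambda>n. c ^ K * exp (- (\<gamma> / 2 * real n)))"
      using assms by (intro summable_mult summable_exp_neg) auto
    fix n :: nat
    have "real (n + 1) ^ K * exp (- (\<gamma> * real n)) \<le> (c ^ K * exp (\<gamma> / 2 * real n)) * exp (- (\<gamma> * real n))"
      by (rule mult_right_mono[OF le]) simp
    also have "\<dots> = c ^ K * exp (- (\<gamma> / 2 * real n))"
      by (simp add: mult.assoc flip: exp_add)
    finally show "norm (real (n + 1) ^ K * exp (- (\<gamma> * real n))) \<le> c ^ K * exp (- (\<gamma> / 2 * real n))" by simp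
  qed
qed

context weighted_carpet
begin

section \<open>Approximate squares\<close>

definition cap :: "(nat \<Rightarrow> nat) \<Rightarrow> (nat \<Rightarrow> nat \<times> nat) \<Rightarrow> nat \<Rightarrow> nat" where
  "cap \<omega> w n = (LEAST k. pa \<omega> w k \<le> pb \<omega> w n)"

text \<open>From amin^k \<le> width \<le> height \<le> bmax^n, a square with \<open>n\<close> rows
  has at least \<open>ratio * n\<close> columns; so \<open>cap\<close> shrinks \<open>n\<close> at
  most by a constant factor.\<close>

definition ratio :: real where
  "ratio = ln bmax / ln amin"

lemma ratio: "0 < ratio" "ratio \<le> 1"
proof -
  have "amin \<le> bmax"
    using amin_le_b[of 1 1] le_bmax[of 1 1] m1 M1[of 1] by auto
  then show "0 < ratio" "ratio \<le> 1"
    using amin_bmax by (auto simp: ratio_def divide_neg_neg field_simps)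
qed

lemma pa_le_pb: "valid \<omega> w n \<Longrightarrow> pa \<omega> w n \<le> pb \<omega> w n"
  unfolding pa_def pb_def
  by (intro prod_mono) (use validD ab in \<open>auto simp: less_imp_le\<close>)

lemma pb_le: "valid \<omega> w n \<Longrightarrow> pb \<omega> w n \<le> bmax ^ n"
proof -
  assume v: "valid \<omega> w n"
  have "pb \<omega> w n \<le> (\<Prod>l<n. bmax)"
    unfolding pb_def by (intro prod_mono) (use validD[OF v] b_pos le_bmax in \<open>auto simp: less_imp_le\<close>)
  then show ?thesis by simp
qed

lemma pb_le_1: "valid \<omega> w n \<Longrightarrow> pb \<omega> w n \<le> 1"
  using pb_le amin_bmax power_le_one[of bmax n] by fastforce

lemma pa_ge: "valid \<omega> w n \<Longrightarrow> amin ^ n \<le> pa \<omega> w n"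
proof -
  assume v: "valid \<omega> w n"
  have "(\<Prod>l<n. amin) \<le> pa \<omega> w n"
    unfolding pa_def by (intro prod_mono) (use validD[OF v] amin_le amin_bmax in \<open>auto simp: less_imp_le\<close>)
  then show ?thesis by simp
qed

definition square :: "(nat \<Rightarrow> nat) \<Rightarrow> (nat \<Rightarrow> nat \<times> nat) \<Rightarrow> nat \<Rightarrow> nat \<Rightarrow> bool" where
  "square \<omega> w k n \<longleftrightarrow> k \<le> n \<and> pa \<omega> w k \<le> pb \<omega> w n \<and> amin * pb \<omega> w n \<le> pa \<omega> w k"

text \<open>By minimality the width one level earlier exceeds the height, and a single map shrinks
  it at most by the factor \<open>amin\<close>. If no column is read the width is 1, and heights are
  at most 1.\<close>

lemma square_cap:
  assumes v: "valid \<omega> w n"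
  shows "square \<omega> w (cap \<omega> w n) n"
proof -
  define k where "k = cap \<omega> w n"
  have le: "pa \<omega> w k \<le> pb \<omega> w n"
    unfolding k_def cap_def by (rule LeastI[of _ n]) (rule pa_le_pb[OF v])
  have kn: "k \<le> n"
    unfolding k_def cap_def by (rule Least_le) (rule pa_le_pb[OF v])
  have "amin * pb \<omega> w n \<le> pa \<omega> w k"
  proof (cases k)
    case 0
    then show ?thesis
      using pb_le_1[OF v] pb_pos[OF v] amin_bmax mult_le_one[of amin "pb \<omega> w n"] by (simp add: pa_def)
  next
    case (Suc k')
    have "k' < (LEAST k. pa \<omega> w k \<le> pb \<omega> w n)" using Suc by (simp add: k_def cap_def)
    then have "\<not> pa \<omega> w k' \<le> pb \<omega> w n" by (rule not_less_Least)
    then have "pb \<omega> w n \<le> pa \<omega> w k'" by simp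
    moreover have "amin \<le> ra \<omega> w k'"
      using validD[OF v, of k'] amin_le Suc kn by auto
    ultimately have "amin * pb \<omega> w n \<le> ra \<omega> w k' * pa \<omega> w k'"
      using pb_pos[OF v] amin_bmax by (intro mult_mono) auto
    then show ?thesis by (simp add: Suc pa_def mult.commute)
  qed
  with le kn show ?thesis by (simp add: square_def k_def)
qed

lemma square_ratio:
  assumes v: "valid \<omega> w n" and s: "square \<omega> w k n"
  shows "ratio * real n \<le> real k"
proof -
  have "amin ^ k \<le> bmax ^ n"
    using pa_ge[OF valid_le[OF v]] pb_le[OF v] s by (force simp: square_def)
  then have "ln (amin ^ k) \<le> ln (bmax ^ n)"
    using amin_bmax by (subst ln_le_cancel_iff) auto
  then have "real k * ln amin \<le> real n * ln bmax"
    using amin_bmax by (simp add: ln_realpow)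
  moreover have "ln amin < 0" using amin_bmax by simp
  ultimately show ?thesis by (simp add: ratio_def field_simps)
qed

section \<open>Row frequencies of a word\<close>

definition rows :: "(nat \<times> nat) set" where
  "rows = (SIGMA i:{1..m}. {1..M i})"

definition cnt :: "(nat \<Rightarrow> nat) \<Rightarrow> (nat \<Rightarrow> nat \<times> nat) \<Rightarrow> nat \<Rightarrow> nat \<times> nat \<Rightarrow> nat" where
  "cnt \<omega> w n = (\<lambda>(i, j). card {l. l < n \<and> \<omega> l = i \<and> fst (w l) = j})"

text \<open>Conditional row frequencies, system by system. A system that does not occur gets the
  point mass on row 1, so that the result always belongs to \<open>Q\<close>. The value 0 outside
  \<open>rows\<close> makes it a function of the counts on \<open>rows\<close> alone, which allows
  counting the possible results.\<close>

definition normalise :: "(nat \<times> nat \<Rightarrow> nat) \<Rightarrow> nat \<Rightarrow> nat \<Rightarrow> real" where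
  "normalise r i j = (if (i, j) \<in> rows then
     (if (\<Sum>j'=1..M i. r (i, j')) = 0 then (if j = 1 then 1 else 0)
      else real (r (i, j)) / real (\<Sum>j'=1..M i. r (i, j'))) else 0)"

definition emp :: "(nat \<Rightarrow> nat) \<Rightarrow> (nat \<Rightarrow> nat \<times> nat) \<Rightarrow> nat \<Rightarrow> nat \<Rightarrow> nat \<Rightarrow> real" where
  "emp \<omega> w n = normalise (cnt \<omega> w n)"

lemma finite_rows: "finite rows"
  by (auto simp: rows_def)

lemma normalise_restrict: "normalise (restrict r rows) = normalise r"
proof (intro ext)
  fix i j
  have "(\<Sum>j'=1..M i. restrict r rows (i, j')) = (\<Sum>j'=1..M i. r (i, j'))" if "(i, j) \<in> rows"
    using that by (intro sum.cong) (auto simp: rows_def)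
  then show "normalise (restrict r rows) i j = normalise r i j"
    by (simp add: normalise_def)
qed

lemma normalise_Q: "normalise r \<in> Q"
proof -
  have "(\<Sum>j=1..M i. normalise r i j) = 1" if i: "i \<in> {1..m}" for i
  proof (cases "(\<Sum>j'=1..M i. r (i, j')) = 0")
    case True
    then have "(\<Sum>j=1..M i. normalise r i j) = (\<Sum>j=1..M i. if j = 1 then 1 else 0)"
      using i by (intro sum.cong) (auto simp: normalise_def rows_def)
    also have "\<dots> = 1" using M1[OF i] by simp
    finally show ?thesis .
  next
    case False
    then have "(\<Sum>j=1..M i. normalise r i j) = (\<Sum>j=1..M i. real (r (i, j)) / real (\<Sum>j'=1..M i. r (i, j')))"
      using i by (intro sum.cong) (auto simp: normalise_def rows_def)
    also have "\<dots> = 1" using False by (simp flip: sum_divide_distrib of_nat_sum)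
    finally show ?thesis .
  qed
  moreover have "0 \<le> normalise r i j" for i j
    by (auto simp: normalise_def intro!: divide_nonneg_nonneg sum_nonneg)
  ultimately show ?thesis by (auto simp: Q_def)
qed

lemma emp_Q: "emp \<omega> w n \<in> Q"
  by (simp add: emp_def normalise_Q)

lemma cnt_sum:
  assumes v: "valid \<omega> w n" and i: "i \<in> {1..m}"
  shows "(\<Sum>j=1..M i. cnt \<omega> w n (i, j)) = card {l. l < n \<and> \<omega> l = i}"
    and "(\<Sum>j=1..M i. real (cnt \<omega> w n (i, j)) * g j) = (\<Sum>l | l < n \<and> \<omega> l = i. g (fst (w l)))"
proof -
  have gen: "(\<Sum>j=1..M i. \<Sum>l\<in>{l\<in>{l. l < n \<and> \<omega> l = i}. fst (w l) = j}. f l) = (\<Sum>l | l < n \<and> \<omega> l = i. f l)"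
    for f :: "nat \<Rightarrow> real"
    by (rule sum.group) (use validD[OF v] in auto)
  have cnt: "real (cnt \<omega> w n (i, j)) * x = (\<Sum>l\<in>{l\<in>{l. l < n \<and> \<omega> l = i}. fst (w l) = j}. x)" for j x
    by (simp add: cnt_def conj_assoc)
  show "(\<Sum>j=1..M i. real (cnt \<omega> w n (i, j)) * g j) = (\<Sum>l | l < n \<and> \<omega> l = i. g (fst (w l)))" for g
  proof -
    have "(\<Sum>j=1..M i. real (cnt \<omega> w n (i, j)) * g j)
      = (\<Sum>j=1..M i. \<Sum>l\<in>{l\<in>{l. l < n \<and> \<omega> l = i}. fst (w l) = j}. g (fst (w l)))"
      unfolding cnt by (intro sum.cong) auto
    then show ?thesis unfolding gen .
  qed
  from this[of "\<lambda>_. 1"] show "(\<Sum>j=1..M i. cnt \<omega> w n (i, j)) = card {l. l < n \<and> \<omega> l = i}"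
    by (simp flip: of_nat_sum)
qed

text \<open>Among the levels that carry system \<open>i\<close>, averaging over the rows that occur
  is averaging with the weights \<open>emp\<close>. The new summand depends on the level only
  through \<open>\<omega> l\<close>, so \<open>typical_average\<close> becomes applicable to an
  arbitrary word.\<close>

lemma emp_average:
  assumes v: "valid \<omega> w n"
  shows "(\<Sum>l<n. g (\<omega> l) (fst (w l))) = (\<Sum>l<n. \<Sum>j=1..M (\<omega> l). emp \<omega> w n (\<omega> l) j * g (\<omega> l) j)"
proof -
  have group: "(\<Sum>l<n. f l) = (\<Sum>i=1..m. \<Sum>l | l < n \<and> \<omega> l = i. f l)" for f :: "nat \<Rightarrow> real"
  proof -
    have "(\<Sum>l<n. f l) = (\<Sum>i=1..m. \<Sum>l\<in>{l\<in>{..<n}. \<omega> l = i}. f l)"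
      by (rule sum.group[symmetric]) (use validD[OF v] in auto)
    then show ?thesis by simp
  qed
  have eq: "(\<Sum>l | l < n \<and> \<omega> l = i. g (\<omega> l) (fst (w l)))
     = (\<Sum>l | l < n \<and> \<omega> l = i. \<Sum>j=1..M (\<omega> l). emp \<omega> w n (\<omega> l) j * g (\<omega> l) j)"
    if i: "i \<in> {1..m}" for i
  proof (cases "card {l. l < n \<and> \<omega> l = i} = 0")
    case True
    then have "{l. l < n \<and> \<omega> l = i} = {}" by simp
    then show ?thesis by (simp only: sum.empty)
  next
    case False
    let ?s = "real (card {l. l < n \<and> \<omega> l = i})"
    have e: "emp \<omega> w n i j = real (cnt \<omega> w n (i, j)) / ?s" if "j \<in> {1..M i}" for j
      using that i False unfolding emp_def normalise_def cnt_sum(1)[OF v i] by (auto simp: rows_def)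
    have "(\<Sum>l | l < n \<and> \<omega> l = i. \<Sum>j=1..M (\<omega> l). emp \<omega> w n (\<omega> l) j * g (\<omega> l) j)
       = (\<Sum>l | l < n \<and> \<omega> l = i. \<Sum>j=1..M i. emp \<omega> w n i j * g i j)"
      by (intro sum.cong) auto
    also have "\<dots> = ?s * (\<Sum>j=1..M i. emp \<omega> w n i j * g i j)" by simp
    also have "\<dots> = (\<Sum>j=1..M i. real (cnt \<omega> w n (i, j)) * g i j)"
      unfolding sum_distrib_left by (intro sum.cong) (use e False in auto)
    also have "\<dots> = (\<Sum>l | l < n \<and> \<omega> l = i. g i (fst (w l)))"
      by (rule cnt_sum(2)[OF v i])
    also have "\<dots> = (\<Sum>l | l < n \<and> \<omega> l = i. g (\<omega> l) (fst (w l)))"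
      by (intro sum.cong) auto
    finally show ?thesis by simp
  qed
  show ?thesis
    unfolding group[of "\<lambda>l. g (\<omega> l) (fst (w l))"]
      group[of "\<lambda>l. \<Sum>j=1..M (\<omega> l). emp \<omega> w n (\<omega> l) j * g (\<omega> l) j"]
    by (rule sum.cong[OF refl]) (rule eq)
qed

text \<open>A row that occurs has positive frequency, so along the word the logarithm of the
  frequency is never the default \<open>ln 0\<close>.\<close>

lemma emp_pos:
  assumes v: "valid \<omega> w n" and l: "l < n"
  shows "0 < emp \<omega> w n (\<omega> l) (fst (w l))"
proof -
  have "0 < card {l'. l' < n \<and> \<omega> l' = \<omega> l}" "0 < cnt \<omega> w n (\<omega> l, fst (w l))"
    using l by (auto simp: cnt_def card_gt_0_iff)
  moreover from this have "0 < real (cnt \<omega> w n (\<omega> l, fst (w l))) / real (card {l'. l' < n \<and> \<omega> l' = \<omega> l})"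
    by (intro divide_pos_pos) simp_all
  moreover have "(\<omega> l, fst (w l)) \<in> rows"
    using validD[OF v l] by (simp add: rows_def)
  ultimately show ?thesis
    using l unfolding emp_def normalise_def cnt_sum(1)[OF v validD(1)[OF v l]] by (simp only: if_True if_False) auto
qed

text \<open>The bound \<open>n1\<close> is the same for all words, so finitely many squares, with
  \<open>n0\<close> to \<open>n1\<close> rows, will cover the carpet.\<close>

lemma iterated_cap:
  assumes "\<delta> > 0"
  shows "\<exists>n1\<ge>n0. \<forall>w. valid \<omega> w n1 \<longrightarrow>
    (\<exists>n\<in>{n0..n1}. lam (emp \<omega> w n) \<le> lam (emp \<omega> w (cap \<omega> w n)) + \<delta>)"
proof -
  define L where "L = Bd / (- ln bmax)"
  \<comment> \<open>Since \<open>lam\<close> takes values between 0 and \<open>L\<close>, it cannot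
    drop \<open>K\<close> times in succession by \<open>\<delta>\<close>.\<close>
  obtain K :: nat where K: "L < real K * \<delta>"
    using ex_less_of_nat_mult[OF \<open>\<delta> > 0\<close>] by blast
  \<comment> \<open>Large enough that \<open>K\<close> applications of \<open>cap\<close>, each
    losing at most the factor \<open>ratio\<close>, do not lead below \<open>n0\<close>.\<close>
  define n1 where "n1 = nat \<lceil>real n0 / ratio ^ K\<rceil>"
  have n1: "real n0 \<le> ratio ^ K * real n1"
  proof -
    have "real n0 / ratio ^ K \<le> real n1" unfolding n1_def by linarith
    then show ?thesis using ratio by (simp add: field_simps)
  qed
  have le: "ratio ^ K \<le> ratio ^ i" "ratio ^ i \<le> 1" if "i \<le> K" for i
    using that ratio by (auto intro: power_decreasing power_le_one)
  have "real n0 \<le> real n1"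
    using n1 le(2)[of K] mult_right_mono[of "ratio ^ K" 1 "real n1"] by simp
  moreover have "\<exists>n\<in>{n0..n1}. lam (emp \<omega> w n) \<le> lam (emp \<omega> w (cap \<omega> w n)) + \<delta>"
    if v: "valid \<omega> w n1" for w
  proof (rule ccontr)
    assume "\<not> ?thesis"
    then have step: "lam (emp \<omega> w (cap \<omega> w n)) + \<delta> \<le> lam (emp \<omega> w n)" if "n \<in> {n0..n1}" for n
      using that by force
    have "i \<le> K \<longrightarrow> ratio ^ i * real n1 \<le> real ((cap \<omega> w ^^ i) n1) \<and> (cap \<omega> w ^^ i) n1 \<le> n1
      \<and> lam (emp \<omega> w ((cap \<omega> w ^^ i) n1)) + real i * \<delta> \<le> lam (emp \<omega> w n1)" for i
    proof (induction i)
      case (Suc i)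
      show ?case
      proof
        assume iK: "Suc i \<le> K"
        define n where "n = (cap \<omega> w ^^ i) n1"
        have IH: "ratio ^ i * real n1 \<le> real n" "n \<le> n1"
          "lam (emp \<omega> w n) + real i * \<delta> \<le> lam (emp \<omega> w n1)"
          using Suc iK by (auto simp: n_def)
        have vn: "valid \<omega> w n" by (rule valid_le[OF v IH(2)])
        have sq: "square \<omega> w (cap \<omega> w n) n" by (rule square_cap[OF vn])
        have "real n0 \<le> real n"
          using n1 IH(1) mult_right_mono[OF le(1)[of i], of "real n1"] iK by simp
        then have "lam (emp \<omega> w (cap \<omega> w n)) + \<delta> \<le> lam (emp \<omega> w n)"
          using IH(2) by (intro step) auto
        moreover have "cap \<omega> w n \<le> n" using sq by (simp add: square_def)
        moreover have "ratio * (ratio ^ i * real n1) \<le> ratio * real n"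
          using IH(1) ratio by (intro mult_left_mono) auto
        moreover note square_ratio[OF vn sq]
        ultimately show "ratio ^ Suc i * real n1 \<le> real ((cap \<omega> w ^^ Suc i) n1) \<and> (cap \<omega> w ^^ Suc i) n1 \<le> n1
          \<and> lam (emp \<omega> w ((cap \<omega> w ^^ Suc i) n1)) + real (Suc i) * \<delta> \<le> lam (emp \<omega> w n1)"
          using IH by (simp add: n_def[symmetric] algebra_simps)
      qed
    qed auto
    from this[of K] have "real K * \<delta> \<le> lam (emp \<omega> w n1)"
      using lam_bounds(1)[OF emp_Q, of \<omega> w "(cap \<omega> w ^^ K) n1"] by auto
    then show False using K lam_bounds(2)[OF emp_Q, of \<omega> w n1] by (simp add: L_def)
  qed
  ultimately show ?thesis by (intro exI[of _ n1]) auto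
qed

text \<open>Mass of the cylinder of \<open>n\<close> rows and \<open>k\<close> columns under the
  product measure that chooses a row with probability \<open>q\<close> and then a column in
  proportion to the \<open>t\<close>-th power of its ratio; columns from level \<open>k\<close> on
  are summed out. \<open>emeasure_cylinder\<close> makes this precise.\<close>

definition wt :: "(nat \<Rightarrow> nat \<Rightarrow> real) \<Rightarrow> real \<Rightarrow> (nat \<Rightarrow> nat) \<Rightarrow> nat \<Rightarrow> nat \<Rightarrow> (nat \<Rightarrow> nat \<times> nat) \<Rightarrow> real" where
  "wt q t \<omega> k n w = (\<Prod>l<n. q (\<omega> l) (fst (w l)) *
     (if l < k then ra \<omega> w l powr t / S (\<omega> l) (fst (w l)) t else 1))"

text \<open>A cell with \<open>k \<le> n\<close> only depends on the columns below \<open>k\<close>; the remaining ones are set to 1.\<close>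

definition words :: "(nat \<Rightarrow> nat) \<Rightarrow> nat \<Rightarrow> nat \<Rightarrow> (nat \<Rightarrow> nat \<times> nat) set" where
  "words \<omega> k n = (\<Pi>\<^sub>E l\<in>{..<n}. if l < k then index_set M N (\<omega> l) else {1..M (\<omega> l)} \<times> {1})"

lemma finite_words: "finite (words \<omega> k n)"
  unfolding words_def by (intro finite_PiE) (auto simp: index_set_def)

lemma valid_words:
  assumes "w \<in> words \<omega> k n" "\<And>l. \<omega> l \<in> {1..m}"
  shows "valid \<omega> w n"
  unfolding valid_def
proof (intro allI impI conjI assms)
  fix l assume "l < n"
  then have "w l \<in> (if l < k then index_set M N (\<omega> l) else {1..M (\<omega> l)} \<times> {1})"
    using assms(1) by (auto simp: words_def PiE_iff)
  then show "w l \<in> index_set M N (\<omega> l)"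
    using N1[OF assms(2)[of l]] by (auto simp: index_set_def split: if_splits)
qed

lemma wt_nonneg:
  assumes "valid \<omega> w n" "q \<in> Q" "0 \<le> t" "t \<le> 1"
  shows "0 \<le> wt q t \<omega> k n w"
  unfolding wt_def using QD[OF assms(2)] validD[OF assms(1)] S_bounds(3)[OF _ _ assms(3,4)]
  by (intro prod_nonneg mult_nonneg_nonneg) (auto simp: less_imp_le)

text \<open>The set \<open>words\<close> picks one representative of every cylinder, so this is the
  total mass of a product of probability distributions.\<close>

lemma sum_wt:
  assumes \<omega>: "\<And>l. \<omega> l \<in> {1..m}" and q: "q \<in> Q" and t: "0 \<le> t" "t \<le> 1"
  shows "(\<Sum>w\<in>words \<omega> k n. wt q t \<omega> k n w) = 1"
proof -
  define G where "G l v = q (\<omega> l) (fst v) *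
     (if l < k then a (\<omega> l) (fst v) (snd v) powr t / S (\<omega> l) (fst v) t else 1)" for l v
  define W where "W l = (if l < k then index_set M N (\<omega> l) else {1..M (\<omega> l)} \<times> {1})" for l
  have "(\<Sum>v\<in>W l. G l v) = 1" for l
  proof (cases "l < k")
    case True
    have "(\<Sum>v\<in>W l. G l v) = (\<Sum>j=1..M (\<omega> l). \<Sum>k=1..N (\<omega> l) j. G l (j, k))"
      using True by (simp add: W_def index_set_def sum.Sigma)
    also have "\<dots> = (\<Sum>j=1..M (\<omega> l). q (\<omega> l) j)"
    proof (rule sum.cong[OF refl])
      fix j assume j: "j \<in> {1..M (\<omega> l)}"
      have "(\<Sum>k=1..N (\<omega> l) j. G l (j, k)) = q (\<omega> l) j * (S (\<omega> l) j t / S (\<omega> l) j t)"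
        using True by (simp add: G_def S_def flip: sum_distrib_left sum_divide_distrib)
      then show "(\<Sum>k=1..N (\<omega> l) j. G l (j, k)) = q (\<omega> l) j"
        using S_bounds(3)[OF \<omega> j t] by simp
    qed
    finally show ?thesis by (simp add: QD[OF q \<omega>])
  next
    case False
    have "(\<Sum>v\<in>W l. G l v) = (\<Sum>j=1..M (\<omega> l). \<Sum>k\<in>{1}. G l (j, k))"
      using False by (simp add: W_def sum.cartesian_product')
    also have "\<dots> = (\<Sum>j=1..M (\<omega> l). q (\<omega> l) j)"
      using False by (simp add: G_def)
    finally show ?thesis by (simp add: QD[OF q \<omega>])
  qed
  moreover have "(\<Prod>l\<in>{..<n}. \<Sum>v\<in>W l. G l v) = (\<Sum>w\<in>PiE {..<n} W. \<Prod>l\<in>{..<n}. G l (w l))"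
    by (rule prod_sum_PiE) (auto simp: W_def index_set_def)
  moreover have "words \<omega> k n = PiE {..<n} W" by (simp add: words_def W_def[abs_def])
  moreover have "wt q t \<omega> k n w = (\<Prod>l\<in>{..<n}. G l (w l))" for w by (simp add: wt_def G_def)
  ultimately show ?thesis by simp
qed

text \<open>In logarithms, with \<open>X\<close> for the height and \<open>Y\<close> for the width,
  the weight is exp (H + t Y - Z). Here H is about n av(h q) = lam(q) n av(be q), hence about lam(q)
  X; Y differs from X by at most \<open>- ln amin\<close>; and Z is small compared with n because
  \<open>t\<close> solves av(sg q' t) = 0. As lam(q) + t is at most D + \<delta>, the exponent D + 2
  \<delta> leaves a spare \<delta> X, which pays for the errors and provides exponential
  decay.\<close>

lemma square_cost:
  assumes ty: "typical \<omega>" and \<delta>: "\<delta> > 0" and D: "\<And>q. q \<in> Q \<Longrightarrow> lam q + tt q \<le> D"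
  shows "\<exists>n0 C \<gamma>. 0 < \<gamma> \<and> 0 < C \<and> (\<forall>n k w. n0 \<le> n \<longrightarrow> valid \<omega> w n \<longrightarrow> square \<omega> w k n \<longrightarrow>
       lam (emp \<omega> w n) \<le> lam (emp \<omega> w k) + \<delta> \<longrightarrow>
       (2 * pb \<omega> w n) powr (D + 2 * \<delta>)
         \<le> C * exp (- (\<gamma> * real n)) * wt (emp \<omega> w n) (tt (emp \<omega> w k)) \<omega> k n w)"
proof -
  define L where "L = Bd / (- ln bmax)"
  have Bd: "Bd > 0" using Bd_parts(4)[of 1] m1 by simp
  have neg: "ln bmax < 0" using amin_bmax by simp
  have L: "L \<ge> 0" unfolding L_def using Bd neg by (intro divide_nonneg_pos) auto
  \<comment> \<open>The spare term \<delta> X is at most -2 \<gamma> n: one half compensates the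
    errors, the other half is the decay.\<close>
  define \<gamma> where "\<gamma> = - (\<delta> * ln bmax) / 2"
  have \<gamma>: "\<gamma> > 0" using \<delta> neg by (simp add: \<gamma>_def mult_pos_neg)
  \<comment> \<open>Makes the three averaging errors, that of \<open>be\<close> being multiplied by
    lam(q) \<le> L, add up to \<gamma> n.\<close>
  define e where "e = \<gamma> / ((2 + L) * Bd)"
  have e: "e > 0" "e * Bd * (2 + L) = \<gamma>" using \<gamma> L Bd by (auto simp: e_def)
  obtain n1 where "\<forall>n\<ge>n1. \<forall>f B. (\<forall>i\<in>{1..m}. \<bar>f i\<bar> \<le> B) \<longrightarrow>
     \<bar>(\<Sum>l<n. f (\<omega> l)) - real n * av f\<bar> \<le> e * B * real n"
    using typical_average[OF ty e(1)] by blast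
  then have n1: "\<bar>(\<Sum>l<n. f (\<omega> l)) - real n * av f\<bar> \<le> e * B * real n"
    if "n1 \<le> n" "\<And>i. i \<in> {1..m} \<Longrightarrow> \<bar>f i\<bar> \<le> B" for n f B
    using that by blast
  \<comment> \<open>Averages are also compared at time \<open>k\<close>, which is only known to be
    at least \<open>ratio * n\<close>; this must reach \<open>n1\<close>.\<close>
  define n0 where "n0 = nat \<lceil>real n1 / ratio\<rceil>"
  show ?thesis
  proof (rule exI[of _ n0], rule exI[of _ "2 powr (D + 2 * \<delta>) / amin"], rule exI[of _ \<gamma>],
      intro conjI allI impI)
    fix n k w assume n: "n0 \<le> n" and v: "valid \<omega> w n" and sq: "square \<omega> w k n"
      and lamle: "lam (emp \<omega> w n) \<le> lam (emp \<omega> w k) + \<delta>"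
    have kn: "k \<le> n" and ab: "pa \<omega> w k \<le> pb \<omega> w n" and ba: "amin * pb \<omega> w n \<le> pa \<omega> w k"
      using sq by (auto simp: square_def)
    have vk: "valid \<omega> w k" by (rule valid_le[OF v kn])
    have "real n1 / ratio \<le> real n" using n unfolding n0_def by linarith
    then have "real n1 \<le> ratio * real n" using ratio by (simp add: field_simps)
    then have k1: "n1 \<le> k" using square_ratio[OF v sq] by simp
    then have nn1: "n1 \<le> n" using kn by simp
    define q where "q = emp \<omega> w n"
    define q' where "q' = emp \<omega> w k"
    define t where "t = tt q'"
    have Q: "q \<in> Q" "q' \<in> Q" by (auto simp: q_def q'_def emp_Q)
    have t: "0 \<le> t" "t \<le> 1" "av (sg q' t) = 0"
      unfolding t_def using tt_props[OF Q(2)] by auto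
    define X where "X = ln (pb \<omega> w n)"
    define Y where "Y = ln (pa \<omega> w k)"
    define H where "H = (\<Sum>l<n. ln (q (\<omega> l) (fst (w l))))"
    define Z where "Z = (\<Sum>l<k. ln (S (\<omega> l) (fst (w l)) t))"
    have "X = (\<Sum>l<n. ln (b (\<omega> l) (fst (w l))))"
    proof -
      have "0 < rb \<omega> w l" if "l < n" for l using b_pos validD[OF v that] by blast
      then show ?thesis unfolding X_def pb_def by (intro ln_prod) force+
    qed
    then have X: "X = (\<Sum>l<n. be q (\<omega> l))"
      unfolding be_def q_def emp_average[OF v, of "\<lambda>i j. ln (b i j)"] .
    have Hh: "H = (\<Sum>l<n. h q (\<omega> l))"
      unfolding H_def h_def q_def emp_average[OF v, of "\<lambda>i j. ln (emp \<omega> w n i j)"] ..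
    have Zs: "Z = (\<Sum>l<k. sg q' t (\<omega> l))"
      unfolding Z_def sg_def q'_def emp_average[OF vk, of "\<lambda>i j. ln (S i j t)"] ..
    have X0: "X \<le> 0" "X \<le> real n * ln bmax"
    proof -
      show "X \<le> 0" unfolding X_def using pb_pos[OF v] pb_le_1[OF v] by simp
      have "X \<le> ln (bmax ^ n)" unfolding X_def
        using pb_pos[OF v] pb_le[OF v] amin_bmax by (subst ln_le_cancel_iff) auto
      then show "X \<le> real n * ln bmax" using amin_bmax by (simp add: ln_realpow)
    qed
    have Xn: "X \<le> real n * av (be q) + e * Bd * real n"
      using n1[OF nn1, of "be q" Bd] be_bounds[OF Q(1)] unfolding X by (simp add: abs_le_iff)
    have Hn: "real n * av (h q) \<le> H + e * Bd * real n"
      using n1[OF nn1, of "h q" Bd] h_bounds[OF Q(1)] unfolding Hh by (simp add: abs_le_iff)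
    have Zn: "Z \<le> e * Bd * real n"
    proof -
      have "Z \<le> e * Bd * real k"
        using n1[OF k1, of "sg q' t" Bd] sg_bound[OF Q(2) _ t(1,2)] t(3) unfolding Zs by (simp add: abs_le_iff)
      also have "\<dots> \<le> e * Bd * real n" using kn e Bd by (intro mult_left_mono) auto
      finally show ?thesis .
    qed
    have lam: "0 \<le> lam q" "lam q \<le> L" "lam q * av (be q) = av (h q)"
      using lam_bounds[OF Q(1)] by (auto simp: L_def)
    have 1: "lam q * X \<le> H + (1 + L) * (e * Bd * real n)"
    proof -
      have "lam q * X \<le> lam q * (real n * av (be q) + e * Bd * real n)"
        by (rule mult_left_mono[OF Xn lam(1)])
      also have "\<dots> = real n * av (h q) + lam q * (e * Bd * real n)"
        using lam(3) by (simp add: algebra_simps)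
      also have "\<dots> \<le> real n * av (h q) + L * (e * Bd * real n)"
        using lam(2) e Bd by (intro add_left_mono mult_right_mono) auto
      finally show ?thesis using Hn by (simp add: algebra_simps)
    qed
    \<comment> \<open>Comparability of the sides: as t \<le> 1, replacing the width by the height
      costs at most the constant factor 1 / amin.\<close>
    have 2: "t * X \<le> t * Y - ln amin"
    proof -
      have "ln (amin * pb \<omega> w n) \<le> Y"
        unfolding Y_def using ba amin_bmax pb_pos[OF v] pa_pos[OF vk] by (subst ln_le_cancel_iff) auto
      then have "ln amin + X \<le> Y" using amin_bmax pb_pos[OF v] by (simp add: X_def ln_mult)
      then have "t * (ln amin + X) \<le> t * Y" using t by (intro mult_left_mono) auto
      moreover have "1 * ln amin \<le> t * ln amin"
        using t amin_bmax by (intro mult_right_mono_neg) auto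
      ultimately show ?thesis by (simp add: algebra_simps)
    qed
    \<comment> \<open>Here the comparison of the two values of \<open>lam\<close> enters;
      multiplying by X \<le> 0 reverses the inequality.\<close>
    have 3: "(D + 2 * \<delta>) * X \<le> (lam q + t + \<delta>) * X"
    proof (rule mult_right_mono_neg[OF _ X0(1)])
      show "lam q + t + \<delta> \<le> D + 2 * \<delta>" using lamle D[OF Q(2)] by (simp add: q_def q'_def t_def)
    qed
    have 4: "\<delta> * X \<le> - 2 * \<gamma> * real n"
      using mult_left_mono[OF X0(2), of \<delta>] \<delta> by (simp add: \<gamma>_def mult_ac)
    have "(D + 2 * \<delta>) * X \<le> H + t * Y - Z - ln amin - \<gamma> * real n"
    proof -
      have "(1 + L) * (e * Bd * real n) + e * Bd * real n = \<gamma> * real n"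
        unfolding e(2)[symmetric] by (simp add: algebra_simps)
      then show ?thesis using 1 2 3 4 Zn by (simp add: algebra_simps)
    qed
    moreover have wt: "wt q t \<omega> k n w = exp (H + t * Y - Z)"
    proof -
      have "wt q t \<omega> k n w = (\<Prod>l<n. q (\<omega> l) (fst (w l))) *
         (\<Prod>l<n. if l < k then ra \<omega> w l powr t / S (\<omega> l) (fst (w l)) t else 1)"
        unfolding wt_def by (rule prod.distrib)
      also have "(\<Prod>l<n. if l < k then ra \<omega> w l powr t / S (\<omega> l) (fst (w l)) t else 1)
         = (\<Prod>l<k. ra \<omega> w l powr t / S (\<omega> l) (fst (w l)) t)"
        by (rule prod.mono_neutral_cong_right) (use kn in auto)
      also have "\<dots> = (\<Prod>l<k. ra \<omega> w l powr t) / (\<Prod>l<k. S (\<omega> l) (fst (w l)) t)"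
        by (rule prod_dividef)
      also have "(\<Prod>l<k. ra \<omega> w l powr t) = pa \<omega> w k powr t"
        unfolding pa_def by (rule prod_powr_distrib[symmetric])
      also have "pa \<omega> w k powr t = exp (t * Y)"
        using pa_pos[OF vk] by (simp add: powr_def Y_def)
      also have "(\<Prod>l<k. S (\<omega> l) (fst (w l)) t) = exp Z"
        unfolding Z_def using S_bounds(3)[OF _ _ t(1,2)] validD[OF vk] by (simp add: exp_sum)
      also have "(\<Prod>l<n. q (\<omega> l) (fst (w l))) = exp H"
        unfolding H_def using emp_pos[OF v] by (simp add: exp_sum q_def)
      finally show ?thesis by (simp add: exp_add exp_diff)
    qed
    ultimately have "exp ((D + 2 * \<delta>) * X) \<le> exp (H + t * Y - Z + (- ln amin - \<gamma> * real n))"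
      by simp
    also have "\<dots> = exp (H + t * Y - Z) * (exp (- ln amin) * exp (- (\<gamma> * real n)))"
      unfolding exp_add[symmetric] by (simp add: algebra_simps)
    also have "exp (- ln amin) = 1 / amin"
      using amin_bmax by (simp add: exp_minus inverse_eq_divide)
    finally have "2 powr (D + 2 * \<delta>) * exp ((D + 2 * \<delta>) * X)
        \<le> 2 powr (D + 2 * \<delta>) * (wt q t \<omega> k n w * (1 / amin * exp (- (\<gamma> * real n))))"
      unfolding wt by (intro mult_left_mono) auto
    moreover have "(2 * pb \<omega> w n) powr (D + 2 * \<delta>) = 2 powr (D + 2 * \<delta>) * exp ((D + 2 * \<delta>) * X)"
      using pb_pos[OF v] by (simp add: powr_mult X_def) (simp add: powr_def)
    ultimately show "(2 * pb \<omega> w n) powr (D + 2 * \<delta>) \<le> 2 powr (D + 2 * \<delta>) / amin * exp (- (\<gamma> * real n)) *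
        wt (emp \<omega> w n) (tt (emp \<omega> w k)) \<omega> k n w"
      by (simp add: q_def q'_def t_def mult_ac)
  qed (use \<gamma> amin_bmax in auto)
qed

section \<open>Counting frequency types\<close>

definition types :: "nat \<Rightarrow> (nat \<times> nat \<Rightarrow> nat) set" where
  "types n = (\<Pi>\<^sub>E x\<in>rows. {..n})"

lemma types: "finite (types n)" "card (types n) = (n + 1) ^ card rows"
  using finite_rows by (simp_all add: types_def card_PiE finite_PiE flip: Suc_eq_plus1)

lemma cnt_types: "k \<le> n \<Longrightarrow> restrict (cnt \<omega> w k) rows \<in> types n"
proof -
  assume "k \<le> n"
  have "cnt \<omega> w k x \<le> n" for x
  proof -
    have "cnt \<omega> w k x \<le> card {..<k}"
      unfolding cnt_def by (cases x) (simp del: card_lessThan, intro card_mono, auto)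
    then show ?thesis using \<open>k \<le> n\<close> by simp
  qed
  then show ?thesis by (auto simp: types_def)
qed

text \<open>The parameters of \<open>wt\<close> vary with the word, so \<open>sum_wt\<close> does
  not apply directly. Each term is dominated by the sum over all pairs of types; after exchanging
  the sums every fixed pair contributes 1, and the number of pairs is polynomial in
  \<open>n\<close>.\<close>

lemma sum_wt_emp:
  assumes \<omega>: "\<And>l. \<omega> l \<in> {1..m}" and "k \<le> n"
  shows "(\<Sum>w\<in>words \<omega> k n. wt (emp \<omega> w n) (tt (emp \<omega> w k)) \<omega> k n w) \<le> real (n + 1) ^ (2 * card rows)"
proof -
  let ?T = "types n \<times> types n"
  let ?f = "\<lambda>w (r, r'). wt (normalise r) (tt (normalise r')) \<omega> k n w"
  have "wt (emp \<omega> w n) (tt (emp \<omega> w k)) \<omega> k n w \<le> (\<Sum>x\<in>?T. ?f w x)" if w: "w \<in> words \<omega> k n" for w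
  proof -
    have "?f w (restrict (cnt \<omega> w n) rows, restrict (cnt \<omega> w k) rows) \<le> (\<Sum>x\<in>?T. ?f w x)"
    proof (rule member_le_sum)
      show "(restrict (cnt \<omega> w n) rows, restrict (cnt \<omega> w k) rows) \<in> ?T"
        using cnt_types[of n n] cnt_types[OF \<open>k \<le> n\<close>] by auto
    next
      fix x
      show "0 \<le> ?f w x"
        using wt_nonneg[OF valid_words[OF w \<omega>] normalise_Q] tt_props[OF normalise_Q] by (cases x) auto
    qed (use types in auto)
    then show ?thesis by (simp add: emp_def normalise_restrict)
  qed
  then have "(\<Sum>w\<in>words \<omega> k n. wt (emp \<omega> w n) (tt (emp \<omega> w k)) \<omega> k n w)
    \<le> (\<Sum>w\<in>words \<omega> k n. \<Sum>x\<in>?T. ?f w x)" by (rule sum_mono)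
  also have "\<dots> = (\<Sum>x\<in>?T. \<Sum>w\<in>words \<omega> k n. ?f w x)" by (rule sum.swap)
  also have "\<dots> = (\<Sum>x\<in>?T. 1)"
  proof (rule sum.cong[OF refl])
    fix x
    show "(\<Sum>w\<in>words \<omega> k n. ?f w x) = 1"
      using sum_wt[OF \<omega> normalise_Q] tt_props[OF normalise_Q] by (cases x) auto
  qed
  also have "\<dots> = real (n + 1) ^ (2 * card rows)"
    by (simp add: card_cartesian_product types mult_2 power_add)
  finally show ?thesis .
qed

text \<open>For the passage to the representative in \<open>words\<close>, whose columns from level
  \<open>k\<close> on are reset to 1.\<close>

lemma prefix_cong:
  assumes "\<And>l. l < n \<Longrightarrow> fst (w l) = fst (w' l)" "\<And>l. l < k \<Longrightarrow> w l = w' l" "k \<le> n"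
  shows "square \<omega> w k n = square \<omega> w' k n" "emp \<omega> w n = emp \<omega> w' n" "emp \<omega> w k = emp \<omega> w' k"
proof -
  have "pa \<omega> w k = pa \<omega> w' k" "pb \<omega> w n = pb \<omega> w' n"
    unfolding pa_def pb_def by (rule prod.cong; use assms in simp)+
  then show "square \<omega> w k n = square \<omega> w' k n" by (simp add: square_def)
  have "cnt \<omega> w i = cnt \<omega> w' i" if "i \<le> n" for i
    unfolding cnt_def using assms(1) that
    by (intro ext) (auto intro!: arg_cong[where f = card])
  then show "emp \<omega> w n = emp \<omega> w' n" "emp \<omega> w k = emp \<omega> w' k"
    using assms(3) by (auto simp: emp_def)
qed

lemma hausdorff_dim_carpet_le:
  assumes ty: "typical \<omega>" and \<delta>: "\<delta> > 0" and D: "\<And>q. q \<in> Q \<Longrightarrow> lam q + tt q \<le> D"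
  shows "hausdorff_dim (random_carpet M N a b c d \<omega>) \<le> ereal (D + 2 * \<delta>)"
proof -
  define s where "s = D + 2 * \<delta>"
  obtain q0 where q0: "q0 \<in> Q" using Q_nonempty by blast
  have s: "s > 0" using D[OF q0] lam_bounds(1)[OF q0] tt_props(1)[OF q0] \<delta> by (simp add: s_def)
  have \<omega>: "\<omega> l \<in> {1..m}" for l using ty by (simp add: typical_def)
  obtain n2 C \<gamma> where \<gamma>: "0 < \<gamma>" "0 < C" and cost:
    "\<And>n k w. n2 \<le> n \<Longrightarrow> valid \<omega> w n \<Longrightarrow> square \<omega> w k n \<Longrightarrow> lam (emp \<omega> w n) \<le> lam (emp \<omega> w k) + \<delta> \<Longrightarrow>
       (2 * pb \<omega> w n) powr s \<le> C * exp (- (\<gamma> * real n)) * wt (emp \<omega> w n) (tt (emp \<omega> w k)) \<omega> k n w"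
    using square_cost[OF ty \<delta> D] unfolding s_def by blast
  \<comment> \<open>Cost of all squares with \<open>n\<close> rows: n + 1 values of
    \<open>k\<close>, each with total weight at most (n + 1)^(2 card rows).\<close>
  define G where "G n = C * (real (n + 1) ^ (2 * card rows + 1) * exp (- (\<gamma> * real n)))" for n
  have "summable G" unfolding G_def by (intro summable_mult summable_power_times_exp \<gamma>)
  show ?thesis unfolding s_def[symmetric]
  proof (rule hausdorff_dim_leI)
    fix \<epsilon> \<eta> :: real assume \<epsilon>: "\<epsilon> > 0" and \<eta>: "\<eta> > 0"
    obtain n3 where n3: "\<And>n n'. n3 \<le> n \<Longrightarrow> norm (\<Sum>k=n..n'. G k) < \<eta>"
      using summable_partial_sum_bound[OF \<open>summable G\<close> \<eta>] by blast
    have "(\<lambda>n. 2 * bmax ^ n) \<longlonglongrightarrow> 2 * 0"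
      using amin_bmax by (intro tendsto_intros LIMSEQ_realpow_zero) auto
    then have "eventually (\<lambda>n. 2 * bmax ^ n < \<epsilon>) sequentially"
      using \<epsilon> by (intro order_tendstoD(2)[where a = \<epsilon>]) auto
    then obtain n4 where n4: "\<And>n. n4 \<le> n \<Longrightarrow> 2 * bmax ^ n < \<epsilon>"
      by (auto simp: eventually_sequentially)
    \<comment> \<open>\<open>n2\<close> makes the cost estimate valid, \<open>n3\<close> makes
      blocks of the series \<open>G\<close> small, \<open>n4\<close> makes the diameters small, and
      the intersection defining the carpet starts at 1.\<close>
    define n0 where "n0 = Max {n2, n3, n4, 1}"
    have n0: "n2 \<le> n0" "n3 \<le> n0" "n4 \<le> n0" "1 \<le> n0" by (auto simp: n0_def)
    obtain n1 where n1: "n0 \<le> n1" "\<And>w. valid \<omega> w n1 \<Longrightarrow>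
      \<exists>n\<in>{n0..n1}. lam (emp \<omega> w n) \<le> lam (emp \<omega> w (cap \<omega> w n)) + \<delta>"
      using iterated_cap[OF \<delta>, of n0 \<omega>] by blast
    define good where "good n k = {w \<in> words \<omega> k n. square \<omega> w k n \<and> lam (emp \<omega> w n) \<le> lam (emp \<omega> w k) + \<delta>}" for n k
    \<comment> \<open>Squares of different sizes may overlap: all good ones with \<open>n0\<close>
      to \<open>n1\<close> rows are taken, as the summable costs allow it.\<close>
    define I where "I = (SIGMA n:{n0..n1}. SIGMA k:{..n}. good n k)"
    define V where "V = (\<lambda>(n, k, w). cell \<omega> w k n)"
    have good: "valid \<omega> w n" "square \<omega> w k n" "lam (emp \<omega> w n) \<le> lam (emp \<omega> w k) + \<delta>" if "w \<in> good n k" for w n k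
      using that valid_words[OF _ \<omega>] by (auto simp: good_def)
    have fin_good: "finite (good n k)" for n k
      unfolding good_def by (rule finite_subset[OF _ finite_words]) auto
    have fin: "finite I" unfolding I_def using fin_good by (intro finite_SigmaI) auto
    have V: "bounded (V x) \<and> diameter (V x) \<le> 2 * pb \<omega> w n" if "x = (n, k, w)" "w \<in> good n k" for x n k w
    proof -
      note g = good[OF that(2)]
      have "k \<le> n" "pa \<omega> w k \<le> pb \<omega> w n" using g(2) by (auto simp: square_def)
      then show ?thesis
        using diameter_cell[OF valid_le[OF g(1)] g(1)] that(1) by (auto simp: V_def)
    qed
    have "hausdorff_premeasure s \<epsilon> (random_carpet M N a b c d \<omega>) \<le> (\<Sum>x\<in>I. diam_pow s (V x))"
    proof (rule hausdorff_premeasure_le_finite_sum[OF fin _ _ \<epsilon>])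
      show "random_carpet M N a b c d \<omega> \<subseteq> (\<Union>x\<in>I. V x)"
      proof
        fix z assume "z \<in> random_carpet M N a b c d \<omega>"
        then obtain w where w: "valid \<omega> w n1" "z \<in> cell \<omega> w n1 n1"
          using carpet_subset_cells[of z \<omega> n1] \<omega> n0 n1(1) by (metis order_trans)
        obtain n where n: "n \<in> {n0..n1}" "lam (emp \<omega> w n) \<le> lam (emp \<omega> w (cap \<omega> w n)) + \<delta>"
          using n1(2)[OF w(1)] by blast
        define k where "k = cap \<omega> w n"
        have vn: "valid \<omega> w n" using valid_le[OF w(1)] n by auto
        have sq: "square \<omega> w k n" unfolding k_def by (rule square_cap[OF vn])
        have kn: "k \<le> n" using sq by (simp add: square_def)
        define w' where "w' = (\<lambda>l\<in>{..<n}. if l < k then w l else (fst (w l), 1))"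
        have ag: "fst (w l) = fst (w' l)" if "l < n" for l using that by (simp add: w'_def)
        have ag': "w l = w' l" if "l < k" for l using that kn by (simp add: w'_def)
        have "w' \<in> words \<omega> k n"
          using vn validD(2)[OF vn] by (auto simp: words_def w'_def valid_def)
        moreover have "square \<omega> w k n = square \<omega> w' k n" "emp \<omega> w n = emp \<omega> w' n" "emp \<omega> w k = emp \<omega> w' k"
          using prefix_cong[of n w w' k \<omega>] ag ag' kn by blast+
        ultimately have "w' \<in> good n k" using sq n(2) by (simp add: good_def k_def)
        moreover have "z \<in> cell \<omega> w' k n"
        proof -
          have "cell \<omega> w k n = cell \<omega> w' k n"
            using cell_cong[of n w w' k \<omega>] ag ag' by blast
          then show ?thesis using w(2) cell_antimono[OF w(1) w(1), of k n] kn n by auto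
        qed
        ultimately show "z \<in> (\<Union>x\<in>I. V x)"
          using n kn by (intro UN_I[of "(n, k, w')"]) (auto simp: I_def V_def)
      qed
    next
      fix x assume "x \<in> I"
      then obtain n k w where x: "x = (n, k, w)" "n \<in> {n0..n1}" "w \<in> good n k"
        by (auto simp: I_def)
      have "2 * pb \<omega> w n \<le> \<epsilon>"
        using pb_le[OF good(1)[OF x(3)]] n4[of n] x(2) n0 by auto
      then show "bounded (V x) \<and> diameter (V x) \<le> \<epsilon>" using V[OF x(1,3)] by auto
    qed
    also have "\<dots> = (\<Sum>n=n0..n1. \<Sum>k\<le>n. \<Sum>w\<in>good n k. diam_pow s (V (n, k, w)))"
      unfolding I_def by (simp add: sum.Sigma fin_good finite_SigmaI split_def)
    also have "\<dots> \<le> (\<Sum>n=n0..n1. ennreal (G n))"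
    proof (rule sum_mono)
      fix n assume n: "n \<in> {n0..n1}"
      have "(\<Sum>w\<in>good n k. diam_pow s (V (n, k, w))) \<le> ennreal (C * exp (- (\<gamma> * real n)) * real (n + 1) ^ (2 * card rows))"
        if k: "k \<in> {..n}" for k
      proof -
        let ?e = "C * exp (- (\<gamma> * real n))"
        let ?w = "\<lambda>w. wt (emp \<omega> w n) (tt (emp \<omega> w k)) \<omega> k n w"
        have wt0: "0 \<le> ?w w" if "w \<in> words \<omega> k n" for w
          using wt_nonneg[OF valid_words[OF that \<omega>] emp_Q] tt_props[OF emp_Q] by auto
        have e0: "0 \<le> ?e" using \<gamma> by simp
        have "(\<Sum>w\<in>good n k. diam_pow s (V (n, k, w))) \<le> (\<Sum>w\<in>good n k. ennreal (?e * ?w w))"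
        proof (rule sum_mono)
          fix w assume w: "w \<in> good n k"
          have dp: "diameter (V (n, k, w)) \<le> 2 * pb \<omega> w n" "0 \<le> diameter (V (n, k, w))"
            using V[OF refl w] by (auto simp: diameter_ge_0)
          have "diam_pow s (V (n, k, w)) \<le> ennreal (diameter (V (n, k, w)) powr s)"
            using s by (simp add: diam_pow_def)
          also have "\<dots> \<le> ennreal ((2 * pb \<omega> w n) powr s)"
            using dp s by (intro ennreal_leI powr_mono2) auto
          also have "\<dots> \<le> ennreal (?e * ?w w)"
            using n n0 by (intro ennreal_leI cost good[OF w]) auto
          finally show "diam_pow s (V (n, k, w)) \<le> ennreal (?e * ?w w)" .
        qed
        also have "\<dots> = ennreal (\<Sum>w\<in>good n k. ?e * ?w w)"
          using wt0 \<gamma> by (intro sum_ennreal mult_nonneg_nonneg) (auto simp: good_def)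
        also have "\<dots> \<le> ennreal (?e * real (n + 1) ^ (2 * card rows))"
        proof (rule ennreal_leI)
          have "(\<Sum>w\<in>good n k. ?w w) \<le> (\<Sum>w\<in>words \<omega> k n. ?w w)"
            by (rule sum_mono2[OF finite_words]) (use wt0 in \<open>auto simp: good_def\<close>)
          also have "\<dots> \<le> real (n + 1) ^ (2 * card rows)"
            by (rule sum_wt_emp) (use \<omega> k in auto)
          finally show "(\<Sum>w\<in>good n k. ?e * ?w w) \<le> ?e * real (n + 1) ^ (2 * card rows)"
            unfolding sum_distrib_left[symmetric] using e0 by (rule mult_left_mono)
        qed
        finally show ?thesis .
      qed
      then have "(\<Sum>k\<le>n. \<Sum>w\<in>good n k. diam_pow s (V (n, k, w)))
        \<le> (\<Sum>k\<le>n. ennreal (C * exp (- (\<gamma> * real n)) * real (n + 1) ^ (2 * card rows)))"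
        by (rule sum_mono)
      also have "\<dots> = ennreal (\<Sum>k\<le>n. C * exp (- (\<gamma> * real n)) * real (n + 1) ^ (2 * card rows))"
        using \<gamma> by (intro sum_ennreal) auto
      also have "(\<Sum>k\<le>n. C * exp (- (\<gamma> * real n)) * real (n + 1) ^ (2 * card rows)) = G n"
        by (simp add: G_def power_add add.commute)
      finally show "(\<Sum>k\<le>n. \<Sum>w\<in>good n k. diam_pow s (V (n, k, w))) \<le> ennreal (G n)" .
    qed
    also have "\<dots> = ennreal (\<Sum>n=n0..n1. G n)"
      using \<gamma> by (intro sum_ennreal) (auto simp: G_def)
    also have "\<dots> \<le> ennreal \<eta>"
      using n3[OF n0(2), of n1] by (intro ennreal_leI) auto
    finally show "hausdorff_premeasure s \<epsilon> (random_carpet M N a b c d \<omega>) \<le> ennreal \<eta>" .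
  qed (use s in auto)
qed

end

section \<open>Lower bound\<close>

lemma emeasure_lborel_Icc_Times: "0 \<le> e \<Longrightarrow> 0 \<le> f \<Longrightarrow>
    emeasure lborel ({x..x + e} \<times> {y..y + f} :: (real \<times> real) set) = ennreal (e * f)"
  by (simp add: lborel_prod[symmetric] lborel.emeasure_pair_measure_Times ennreal_mult)

lemma emeasure_lborel_Ioo_Times: "0 \<le> e \<Longrightarrow> 0 \<le> f \<Longrightarrow>
    emeasure lborel ({x<..<x + e} \<times> {y<..<y + f} :: (real \<times> real) set) = ennreal (e * f)"
  by (simp add: lborel_prod[symmetric] lborel.emeasure_pair_measure_Times ennreal_mult)

lemma finite_index_set: "finite (index_set M N i)"
  by (auto simp: index_set_def)

context weighted_carpet
begin

lemma typical_tendsto: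
  assumes "typical \<omega>"
  shows "(\<lambda>n. (\<Sum>l<n. f (\<omega> l)) / real n) \<longlonglongrightarrow> av f"
proof (rule LIMSEQ_I)
  fix r :: real assume "r > 0"
  define B where "B = (\<Sum>i=1..m. \<bar>f i\<bar>) + 1"
  have B: "\<bar>f i\<bar> \<le> B" if "i \<in> {1..m}" for i
    using member_le_sum[of i "{1..m}" "\<lambda>i. \<bar>f i\<bar>"] that by (auto simp: B_def)
  have B0: "B > 0" unfolding B_def by (intro add_nonneg_pos sum_nonneg) auto
  define e where "e = r / (2 * B)"
  have e: "e > 0" "e * B < r" using \<open>r > 0\<close> B0 by (auto simp: e_def)
  obtain n0 where n0: "\<forall>n\<ge>n0. \<forall>f B. (\<forall>i\<in>{1..m}. \<bar>f i\<bar> \<le> B) \<longrightarrow>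
     \<bar>(\<Sum>l<n. f (\<omega> l)) - real n * av f\<bar> \<le> e * B * real n"
    using typical_average[OF assms e(1)] by blast
  have "norm ((\<Sum>l<n. f (\<omega> l)) / real n - av f) < r" if n: "n \<ge> max n0 1" for n
  proof -
    have "\<bar>(\<Sum>l<n. f (\<omega> l)) - real n * av f\<bar> \<le> e * B * real n"
      using n0 n B by auto
    moreover have "(\<Sum>l<n. f (\<omega> l)) / real n - av f = ((\<Sum>l<n. f (\<omega> l)) - real n * av f) / real n"
      using n by (simp add: field_simps)
    ultimately have "norm ((\<Sum>l<n. f (\<omega> l)) / real n - av f) \<le> e * B"
      using n by (simp add: abs_divide divide_le_eq)
    then show ?thesis using e(2) by simp
  qed
  then show "\<exists>n0. \<forall>n\<ge>n0. norm ((\<Sum>l<n. f (\<omega> l)) / real n - av f) < r" by blast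
qed

section \<open>The product measure on words for a fixed driving sequence\<close>

definition nu :: "(nat \<Rightarrow> nat) \<Rightarrow> (nat \<Rightarrow> nat \<Rightarrow> real) \<Rightarrow> real \<Rightarrow> nat \<Rightarrow> (nat \<times> nat) measure" where
  "nu \<omega> q t l = point_measure (index_set M N (\<omega> l))
     (\<lambda>v. ennreal (q (\<omega> l) (fst v) * (a (\<omega> l) (fst v) (snd v) powr t / S (\<omega> l) (fst v) t)))"

definition mu :: "(nat \<Rightarrow> nat) \<Rightarrow> (nat \<Rightarrow> nat \<Rightarrow> real) \<Rightarrow> real \<Rightarrow> (nat \<Rightarrow> nat \<times> nat) measure" where
  "mu \<omega> q t = PiM UNIV (nu \<omega> q t)"

context
  fixes \<omega> :: "nat \<Rightarrow> nat" and q :: "nat \<Rightarrow> nat \<Rightarrow> real" and t :: real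
  assumes \<omega>: "\<And>l. \<omega> l \<in> {1..m}" and q: "q \<in> Q" and t: "0 \<le> t" "t \<le> 1"
begin

lemma space_nu: "space (nu \<omega> q t l) = index_set M N (\<omega> l)"
  by (simp add: nu_def space_point_measure)

lemma sets_nu: "sets (nu \<omega> q t l) = Pow (index_set M N (\<omega> l))"
  by (simp add: nu_def sets_point_measure)

lemma measurable_nu [measurable]: "(f :: _ \<Rightarrow> real) \<in> borel_measurable (nu \<omega> q t l)"
  by (simp add: nu_def)

lemma nu_density_nonneg:
  assumes "v \<in> index_set M N (\<omega> l)"
  shows "0 \<le> q (\<omega> l) (fst v) * (a (\<omega> l) (fst v) (snd v) powr t / S (\<omega> l) (fst v) t)"
proof -
  have "fst v \<in> {1..M (\<omega> l)}" using assms by (auto simp: index_set_def)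
  then show ?thesis
    using QD(1)[OF q \<omega>, of "fst v" l] S_bounds(3)[OF \<omega> _ t, of "fst v" l] by simp
qed

lemma sum_nu_density:
  "(\<Sum>v\<in>index_set M N (\<omega> l). q (\<omega> l) (fst v) * (a (\<omega> l) (fst v) (snd v) powr t / S (\<omega> l) (fst v) t) * g (fst v))
     = (\<Sum>j=1..M (\<omega> l). q (\<omega> l) j * g j)"
proof -
  have "(\<Sum>v\<in>index_set M N (\<omega> l). q (\<omega> l) (fst v) * (a (\<omega> l) (fst v) (snd v) powr t / S (\<omega> l) (fst v) t) * g (fst v))
    = (\<Sum>j=1..M (\<omega> l). \<Sum>k=1..N (\<omega> l) j. q (\<omega> l) j * g j * (a (\<omega> l) j k powr t / S (\<omega> l) j t))"
    unfolding index_set_def by (simp add: sum.Sigma split_def mult_ac)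
  also have "\<dots> = (\<Sum>j=1..M (\<omega> l). q (\<omega> l) j * g j)"
  proof (rule sum.cong[OF refl])
    fix j assume j: "j \<in> {1..M (\<omega> l)}"
    have "(\<Sum>k=1..N (\<omega> l) j. q (\<omega> l) j * g j * (a (\<omega> l) j k powr t / S (\<omega> l) j t))
      = q (\<omega> l) j * g j * (S (\<omega> l) j t / S (\<omega> l) j t)"
      by (simp add: S_def flip: sum_distrib_left sum_divide_distrib)
    then show "(\<Sum>k=1..N (\<omega> l) j. q (\<omega> l) j * g j * (a (\<omega> l) j k powr t / S (\<omega> l) j t)) = q (\<omega> l) j * g j"
      using S_bounds(3)[OF \<omega> j t] by simp
  qed
  finally show ?thesis .
qed

lemma emeasure_nu:
  assumes "A \<subseteq> index_set M N (\<omega> l)"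
  shows "emeasure (nu \<omega> q t l) A =
    ennreal (\<Sum>v\<in>A. q (\<omega> l) (fst v) * (a (\<omega> l) (fst v) (snd v) powr t / S (\<omega> l) (fst v) t))"
  unfolding nu_def using assms nu_density_nonneg
  by (subst emeasure_point_measure_finite) (auto simp: finite_index_set intro!: sum_ennreal)

lemma prob_space_nu: "prob_space (nu \<omega> q t l)"
proof
  show "emeasure (nu \<omega> q t l) (space (nu \<omega> q t l)) = 1"
    using sum_nu_density[of l "\<lambda>_. 1"] QD(2)[OF q \<omega>] by (simp add: space_nu emeasure_nu)
qed

lemma integral_nu: "integral\<^sup>L (nu \<omega> q t l) (\<lambda>v. g (fst v)) = (\<Sum>j=1..M (\<omega> l). q (\<omega> l) j * g j)"
  unfolding nu_def
  by (subst lebesgue_integral_point_measure_finite[OF finite_index_set nu_density_nonneg])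
     (simp_all only: real_scaleR_def sum_nu_density)

lemma prob_space_mu: "prob_space (mu \<omega> q t)"
  unfolding mu_def by (intro prob_space_PiM prob_space_nu)

lemma space_mu: "w \<in> space (mu \<omega> q t) \<longleftrightarrow> (\<forall>l. w l \<in> index_set M N (\<omega> l))"
  by (auto simp: mu_def space_PiM space_nu PiE_iff)

lemma valid_mu: "w \<in> space (mu \<omega> q t) \<Longrightarrow> valid \<omega> w n"
  using \<omega> by (auto simp: valid_def space_mu)

lemma measurable_mu [measurable]: "(\<lambda>w. (f :: _ \<Rightarrow> real) (w l)) \<in> borel_measurable (mu \<omega> q t)"
  unfolding mu_def by measurable

text \<open>Two laws of large numbers: for fixed \<open>\<omega>\<close> the rows are independent
  and their averages follow those of their means; the means depend only on
  \<open>\<omega> l\<close>, so their averages converge by typicality.\<close>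

lemma row_averages:
  assumes ty: "typical \<omega>"
  shows "AE w in mu \<omega> q t. (\<lambda>n. (\<Sum>l<n. g (\<omega> l) (fst (w l))) / real n)
    \<longlonglongrightarrow> av (\<lambda>i. \<Sum>j=1..M i. q i j * g i j)"
proof -
  define F where "F i = (\<Sum>j=1..M i. q i j * g i j)" for i
  define B where "B = (\<Sum>i=1..m. \<Sum>j=1..M i. \<bar>g i j\<bar>)"
  have B: "\<bar>g i j\<bar> \<le> B" if "i \<in> {1..m}" "j \<in> {1..M i}" for i j
  proof -
    have "\<bar>g i j\<bar> \<le> (\<Sum>j=1..M i. \<bar>g i j\<bar>)" using that by (intro member_le_sum) auto
    also have "\<dots> \<le> B" unfolding B_def using that by (intro member_le_sum[of i]) (auto intro: sum_nonneg)
    finally show ?thesis .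
  qed
  have "AE w in PiM UNIV (nu \<omega> q t). (\<lambda>n. (\<Sum>l<n. g (\<omega> l) (fst (w l)) - integral\<^sup>L (nu \<omega> q t l) (\<lambda>v. g (\<omega> l) (fst v))) / real n) \<longlonglongrightarrow> 0"
  proof (rule strong_law_PiM[where B = B])
    fix l v assume "v \<in> space (nu \<omega> q t l)"
    then have "fst v \<in> {1..M (\<omega> l)}" by (auto simp: space_nu index_set_def)
    then show "\<bar>g (\<omega> l) (fst v)\<bar> \<le> B" by (intro B \<omega>)
  qed (auto intro: prob_space_nu)
  then have "AE w in mu \<omega> q t. (\<lambda>n. (\<Sum>l<n. g (\<omega> l) (fst (w l)) - F (\<omega> l)) / real n) \<longlonglongrightarrow> 0"
    unfolding mu_def integral_nu F_def .
  then show ?thesis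
  proof eventually_elim
    case (elim w)
    have "(\<lambda>n. (\<Sum>l<n. g (\<omega> l) (fst (w l)) - F (\<omega> l)) / real n + (\<Sum>l<n. F (\<omega> l)) / real n) \<longlonglongrightarrow> 0 + av F"
      by (intro tendsto_add elim typical_tendsto[OF ty])
    then show ?case by (simp add: sum_subtractf F_def[abs_def] flip: add_divide_distrib)
  qed
qed

lemma emeasure_cylinder:
  assumes w: "\<And>l. w l \<in> index_set M N (\<omega> l)" and kn: "k \<le> n"
  defines "A \<equiv> {w' \<in> space (mu \<omega> q t). (\<forall>l<n. fst (w' l) = fst (w l)) \<and> (\<forall>l<k. w' l = w l)}"
  shows "A \<in> sets (mu \<omega> q t)" "emeasure (mu \<omega> q t) A = ennreal (wt q t \<omega> k n w)"
proof -
  define X where "X l = {v \<in> index_set M N (\<omega> l). fst v = fst (w l) \<and> (l < k \<longrightarrow> v = w l)}" for l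
  have A: "A = prod_emb UNIV (nu \<omega> q t) {..<n} (PiE {..<n} X)"
    using kn unfolding A_def by (auto simp: prod_emb_def space_mu space_PiM PiE_iff X_def space_nu mu_def)
  have X: "X l \<in> sets (nu \<omega> q t l)" for l by (auto simp: X_def sets_nu)
  show "A \<in> sets (mu \<omega> q t)"
    unfolding A mu_def using X by (intro sets_PiM_I) auto
  have G: "emeasure (nu \<omega> q t l) (X l) = ennreal (q (\<omega> l) (fst (w l)) *
     (if l < k then ra \<omega> w l powr t / S (\<omega> l) (fst (w l)) t else 1))" for l
  proof (cases "l < k")
    case True
    then have "X l = {w l}" using w[of l] by (auto simp: X_def)
    then show ?thesis using True w[of l] by (subst emeasure_nu) auto
  next
    case False
    \<comment> \<open>With the column free, the column probabilities within the row add up to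
      1.\<close>
    define j where "j = fst (w l)"
    have j: "j \<in> {1..M (\<omega> l)}" using w[of l] by (auto simp: j_def index_set_def)
    have "X l = Pair j ` {1..N (\<omega> l) j}" using False j by (auto simp: X_def j_def index_set_def)
    then have "(\<Sum>v\<in>X l. q (\<omega> l) (fst v) * (a (\<omega> l) (fst v) (snd v) powr t / S (\<omega> l) (fst v) t))
      = (\<Sum>k=1..N (\<omega> l) j. q (\<omega> l) j * (a (\<omega> l) j k powr t / S (\<omega> l) j t))"
      by (simp add: sum.reindex inj_on_def)
    also have "\<dots> = q (\<omega> l) j * (S (\<omega> l) j t / S (\<omega> l) j t)"
      by (simp add: S_def flip: sum_distrib_left sum_divide_distrib)
    also have "\<dots> = q (\<omega> l) j" using S_bounds(3)[OF \<omega> j t] by simp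
    finally show ?thesis using False by (subst emeasure_nu) (auto simp: X_def j_def)
  qed
  have "0 \<le> q (\<omega> l) (fst (w l)) * (if l < k then ra \<omega> w l powr t / S (\<omega> l) (fst (w l)) t else 1)" for l
  proof -
    have "fst (w l) \<in> {1..M (\<omega> l)}" using w[of l] by (auto simp: index_set_def)
    then show ?thesis
      using QD(1)[OF q \<omega>, of "fst (w l)" l] S_bounds(3)[OF \<omega> _ t, of "fst (w l)" l] by simp
  qed
  then show "emeasure (mu \<omega> q t) A = ennreal (wt q t \<omega> k n w)"
    unfolding A mu_def wt_def using X
    by (subst emeasure_PiM_emb) (auto intro: prob_space_nu simp: G prod_ennreal)
qed

end

section \<open>Cells at a given scale\<close>

definition nb :: "(nat \<Rightarrow> nat) \<Rightarrow> real \<Rightarrow> (nat \<Rightarrow> nat \<times> nat) \<Rightarrow> nat" where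
  "nb \<omega> r w = (LEAST n. pb \<omega> w n \<le> r)"
definition na :: "(nat \<Rightarrow> nat) \<Rightarrow> real \<Rightarrow> (nat \<Rightarrow> nat \<times> nat) \<Rightarrow> nat" where
  "na \<omega> r w = (LEAST n. pa \<omega> w n \<le> r)"
text \<open>Interior of the cell whose sides have both just dropped to \<open>r\<close>; comparing
  both sides with \<open>r\<close>, rather than with each other, makes cells of different words
  comparable. Closed cells may share boundary points, while intersecting interiors force the same
  cylinder.\<close>

definition open_cell :: "(nat \<Rightarrow> nat) \<Rightarrow> real \<Rightarrow> (nat \<Rightarrow> nat \<times> nat) \<Rightarrow> (real \<times> real) set" where
  "open_cell \<omega> r w =
     {xo \<omega> w (na \<omega> r w)<..<xo \<omega> w (na \<omega> r w) + pa \<omega> w (na \<omega> r w)} \<times>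
     {yo \<omega> w (nb \<omega> r w)<..<yo \<omega> w (nb \<omega> r w) + pb \<omega> w (nb \<omega> r w)}"

text \<open>Minimality of the stopping times, as in \<open>square_cap\<close>. The last claim comes
  from r < bmax^(nb - 1): \<open>nb\<close> grows at most linearly in \<open>- ln r\<close>, which
  later turns errors linear in \<open>nb\<close> into powers of \<open>r\<close>.\<close>

lemma stopping:
  assumes v: "\<And>n. valid \<omega> w n" and r: "0 < r" "r < 1"
  shows "pb \<omega> w (nb \<omega> r w) \<le> r" "amin * r \<le> pb \<omega> w (nb \<omega> r w)"
    "pa \<omega> w (na \<omega> r w) \<le> r" "amin * r \<le> pa \<omega> w (na \<omega> r w)"
    "na \<omega> r w \<le> nb \<omega> r w" "(real (nb \<omega> r w) - 1) * ln bmax \<ge> ln r"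
proof -
  obtain n where "bmax ^ n < r" using real_arch_pow_inv[of r bmax] amin_bmax r by auto
  then have ex: "pb \<omega> w n \<le> r" using pb_le[OF v] by (meson le_less_trans less_imp_le)
  show b: "pb \<omega> w (nb \<omega> r w) \<le> r" unfolding nb_def by (rule LeastI, rule ex)
  then have b': "pa \<omega> w (nb \<omega> r w) \<le> r" using pa_le_pb[OF v] by (rule order_trans[rotated])
  show "pa \<omega> w (na \<omega> r w) \<le> r" unfolding na_def by (rule LeastI, rule b')
  show "na \<omega> r w \<le> nb \<omega> r w" unfolding na_def by (rule Least_le, rule b')
  have "nb \<omega> r w \<noteq> 0"
  proof
    assume "nb \<omega> r w = 0"
    then have "pb \<omega> w 0 \<le> r" using b by simp
    then show False using r by (simp add: pb_def)
  qed
  then obtain n' where n': "nb \<omega> r w = Suc n'" using not0_implies_Suc by blast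
  then have "\<not> pb \<omega> w n' \<le> r" unfolding nb_def by (metis lessI not_less_Least)
  then have rn': "r < pb \<omega> w n'" by simp
  have "amin * r \<le> rb \<omega> w n' * pb \<omega> w n'"
    using rn' amin_le_b[OF validD(1,2)[OF v, of n' "Suc n'"]] r amin_bmax by (intro mult_mono) auto
  then show "amin * r \<le> pb \<omega> w (nb \<omega> r w)" by (simp add: n' pb_def mult.commute)
  have "r < bmax ^ n'" using rn' pb_le[OF v, of n'] by simp
  then have "ln r < ln (bmax ^ n')" using r amin_bmax by (subst ln_less_cancel_iff) auto
  then show "(real (nb \<omega> r w) - 1) * ln bmax \<ge> ln r" using amin_bmax by (simp add: n' ln_realpow)
  have "na \<omega> r w \<noteq> 0"
  proof
    assume "na \<omega> r w = 0"
    then have "pa \<omega> w 0 \<le> r" using \<open>pa \<omega> w (na \<omega> r w) \<le> r\<close> by simp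
    then show False using r by (simp add: pa_def)
  qed
  then obtain k' where k': "na \<omega> r w = Suc k'" using not0_implies_Suc by blast
  then have "\<not> pa \<omega> w k' \<le> r" unfolding na_def by (metis lessI not_less_Least)
  then have rk': "r < pa \<omega> w k'" by simp
  have "amin * r \<le> ra \<omega> w k' * pa \<omega> w k'"
    using rk' amin_le[OF validD[OF v, of k' "Suc k'"]] r amin_bmax by (intro mult_mono) auto
  then show "amin * r \<le> pa \<omega> w (na \<omega> r w)" by (simp add: k' pa_def mult.commute)
qed

text \<open>At the first level with different rows \<open>d_separated\<close> puts the vertical
  intervals side by side, and \<open>offset_separated\<close> keeps them so at every depth, which
  excludes a common interior point.\<close>

lemma rows_agree:
  assumes v: "\<And>n. valid \<omega> w n" "\<And>n. valid \<omega> w' n"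
    and y: "y \<in> {yo \<omega> w n<..<yo \<omega> w n + pb \<omega> w n}" "y \<in> {yo \<omega> w' n'<..<yo \<omega> w' n' + pb \<omega> w' n'}"
    and l: "l < n" "l < n'"
  shows "fst (w l) = fst (w' l)"
  using l
proof (induction l rule: less_induct)
  case (less l)
  \<comment> \<open>Stated for an ordered pair, to be applied with the words exchanged as
    well.\<close>
  have *: "\<not> fst (u l) < fst (u' l)"
    if u: "\<And>n. valid \<omega> u n" "\<And>n. valid \<omega> u' n" "l < i" "l < i'" "\<And>l'. l' < l \<Longrightarrow> fst (u l') = fst (u' l')"
      and y': "y \<in> {yo \<omega> u i<..<yo \<omega> u i + pb \<omega> u i}" "y \<in> {yo \<omega> u' i'<..<yo \<omega> u' i' + pb \<omega> u' i'}" for u u' i i'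
  proof
    assume "fst (u l) < fst (u' l)"
    then have sep: "sd \<omega> u l + rb \<omega> u l \<le> sd \<omega> u' l"
      using validD[OF u(1), of l "Suc l"] validD[OF u(2), of l "Suc l"] by (intro d_separated) auto
    have "offset (rb \<omega> u) (sd \<omega> u) i + prod (rb \<omega> u) {..<i} \<le> offset (rb \<omega> u') (sd \<omega> u') i'"
      by (rule offset_separated[where l = l])
         (use valid_ratios(2)[OF u(1)] valid_ratios(2)[OF u(2)] u(3-5) sep in auto)
    then show False using y' by (simp add: yo_def pb_def)
  qed
  have IH: "fst (w l') = fst (w' l')" if "l' < l" for l'
    using less that by auto
  show ?case
    using *[of w w' n n'] *[of w' w n' n] v y less.prems IH by (metis linorder_neqE_nat)
qed

text \<open>The horizontal analogue; columns are separated only within one row, so the rows have to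
  agree beforehand.\<close>

lemma columns_agree:
  assumes v: "\<And>n. valid \<omega> w n" "\<And>n. valid \<omega> w' n"
    and x: "x \<in> {xo \<omega> w n<..<xo \<omega> w n + pa \<omega> w n}" "x \<in> {xo \<omega> w' n'<..<xo \<omega> w' n' + pa \<omega> w' n'}"
    and eq: "\<And>l. l < n \<Longrightarrow> l < n' \<Longrightarrow> fst (w l) = fst (w' l)"
    and l: "l < n" "l < n'"
  shows "w l = w' l"
  using l
proof (induction l rule: less_induct)
  case (less l)
  have *: "\<not> snd (u l) < snd (u' l)"
    if u: "\<And>n. valid \<omega> u n" "\<And>n. valid \<omega> u' n" "l < i" "l < i'" "\<And>l'. l' < l \<Longrightarrow> u l' = u' l'" "fst (u l) = fst (u' l)"
      and x': "x \<in> {xo \<omega> u i<..<xo \<omega> u i + pa \<omega> u i}" "x \<in> {xo \<omega> u' i'<..<xo \<omega> u' i' + pa \<omega> u' i'}" for u u' i i'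
  proof
    assume less: "snd (u l) < snd (u' l)"
    have sep: "sc \<omega> u l + ra \<omega> u l \<le> sc \<omega> u' l"
      unfolding u(6)[symmetric] using validD[OF u(1), of l "Suc l"] validD[OF u(2), of l "Suc l"] u(6) less
      by (intro c_separated) auto
    have "offset (ra \<omega> u) (sc \<omega> u) i + prod (ra \<omega> u) {..<i} \<le> offset (ra \<omega> u') (sc \<omega> u') i'"
      by (rule offset_separated[where l = l])
         (use valid_ratios(1)[OF u(1)] valid_ratios(1)[OF u(2)] u(3-5) sep in auto)
    then show False using x' by (simp add: xo_def pa_def)
  qed
  have IH: "w l' = w' l'" if "l' < l" for l'
    using less that by auto
  have "snd (w l) = snd (w' l)"
    using *[of w w' n n'] *[of w' w n' n] v x less.prems IH eq[of l] by (metis linorder_neqE_nat)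
  then show ?case using eq less.prems by (simp add: prod_eq_iff)
qed

text \<open>A common point forces the words to agree as long as neither has stopped. Stopping
  depends only on the prefix read so far, so both stop at the same level, first for the rows and
  then for the columns.\<close>

lemma open_cells_disjoint:
  assumes v: "\<And>n. valid \<omega> w n" "\<And>n. valid \<omega> w' n" and r: "0 < r" "r < 1"
    and z: "z \<in> open_cell \<omega> r w" "z \<in> open_cell \<omega> r w'"
  shows "nb \<omega> r w = nb \<omega> r w'" "na \<omega> r w = na \<omega> r w'"
    "\<And>l. l < nb \<omega> r w \<Longrightarrow> fst (w l) = fst (w' l)" "\<And>l. l < na \<omega> r w \<Longrightarrow> w l = w' l"
proof -
  have fst_eq: "fst (w l) = fst (w' l)" if "l < nb \<omega> r w" "l < nb \<omega> r w'" for l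
    using z that by (intro rows_agree[OF v, of "snd z" "nb \<omega> r w" "nb \<omega> r w'"]) (auto simp: open_cell_def)
  have pb_eq: "pb \<omega> w n = pb \<omega> w' n" if "n \<le> nb \<omega> r w" "n \<le> nb \<omega> r w'" for n
    unfolding pb_def by (rule prod.cong) (use fst_eq that in auto)
  show nb_eq: "nb \<omega> r w = nb \<omega> r w'"
  proof (rule ccontr)
    assume "nb \<omega> r w \<noteq> nb \<omega> r w'"
    then consider "nb \<omega> r w < nb \<omega> r w'" | "nb \<omega> r w' < nb \<omega> r w" by linarith
    then show False
    proof cases
      case 1
      then have "pb \<omega> w' (nb \<omega> r w) \<le> r" using pb_eq stopping(1)[OF v(1) r] by simp
      then have "nb \<omega> r w' \<le> nb \<omega> r w" unfolding nb_def[of _ _ w'] by (rule Least_le)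
      then show False using 1 by simp
    next
      case 2
      then have "pb \<omega> w (nb \<omega> r w') \<le> r" using pb_eq stopping(1)[OF v(2) r] by simp
      then have "nb \<omega> r w \<le> nb \<omega> r w'" unfolding nb_def[of _ _ w] by (rule Least_le)
      then show False using 2 by simp
    qed
  qed
  then show F: "fst (w l) = fst (w' l)" if "l < nb \<omega> r w" for l using fst_eq that by simp
  have le: "na \<omega> r w \<le> nb \<omega> r w" by (rule stopping(5)[OF v(1) r])
  have w_eq: "w l = w' l" if "l < na \<omega> r w" "l < na \<omega> r w'" for l
    using z that F le
    by (intro columns_agree[OF v, of "fst z" "na \<omega> r w" "na \<omega> r w'"]) (auto simp: open_cell_def)
  have pa_eq: "pa \<omega> w n = pa \<omega> w' n" if "n \<le> na \<omega> r w" "n \<le> na \<omega> r w'" for n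
    unfolding pa_def by (rule prod.cong) (use w_eq that in auto)
  show na_eq: "na \<omega> r w = na \<omega> r w'"
  proof (rule ccontr)
    assume "na \<omega> r w \<noteq> na \<omega> r w'"
    then consider "na \<omega> r w < na \<omega> r w'" | "na \<omega> r w' < na \<omega> r w" by linarith
    then show False
    proof cases
      case 1
      then have "pa \<omega> w' (na \<omega> r w) \<le> r" using pa_eq stopping(3)[OF v(1) r] by simp
      then have "na \<omega> r w' \<le> na \<omega> r w" unfolding na_def[of _ _ w'] by (rule Least_le)
      then show False using 1 by simp
    next
      case 2
      then have "pa \<omega> w (na \<omega> r w') \<le> r" using pa_eq stopping(3)[OF v(2) r] by simp
      then have "na \<omega> r w \<le> na \<omega> r w'" unfolding na_def[of _ _ w] by (rule Least_le)
      then show False using 2 by simp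
    qed
  qed
  then show "w l = w' l" if "l < na \<omega> r w" for l using w_eq that by simp
qed

text \<open>Comparison of areas: disjoint rectangles with sides at least amin r in a square of side
  4 r number at most 16 / amin^2.\<close>

lemma card_separated_cells:
  assumes T: "finite T" "\<And>w n. w \<in> T \<Longrightarrow> valid \<omega> w n" and r: "0 < r" "r < 1"
    and disj: "\<And>w w'. w \<in> T \<Longrightarrow> w' \<in> T \<Longrightarrow> w \<noteq> w' \<Longrightarrow> open_cell \<omega> r w \<inter> open_cell \<omega> r w' = {}"
    and near: "\<And>w. w \<in> T \<Longrightarrow> \<exists>z\<in>cell \<omega> w (na \<omega> r w) (nb \<omega> r w). dist z z0 \<le> r"
  shows "real (card T) \<le> 16 / amin\<^sup>2"
proof -
  \<comment> \<open>Each cell comes within \<open>r\<close> of \<open>z0\<close> and has sides at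
    most \<open>r\<close>, hence the margin 2 r on either side.\<close>
  define R where "R = {fst z0 - 2 * r..fst z0 - 2 * r + 4 * r} \<times> {snd z0 - 2 * r..snd z0 - 2 * r + 4 * r}"
  have area: "ennreal ((amin * r)\<^sup>2) \<le> emeasure lborel (open_cell \<omega> r w)" if "w \<in> T" for w
  proof -
    note st = stopping[OF T(2)[OF that] r]
    have "(amin * r)\<^sup>2 \<le> pa \<omega> w (na \<omega> r w) * pb \<omega> w (nb \<omega> r w)"
      unfolding power2_eq_square using st amin_bmax r pa_pos[OF T(2)[OF that]]
      by (intro mult_mono) (auto simp: less_imp_le)
    then show ?thesis
      unfolding open_cell_def using pa_pos[OF T(2)[OF that]] pb_pos[OF T(2)[OF that]]
      by (subst emeasure_lborel_Ioo_Times) (auto intro: ennreal_leI less_imp_le)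
  qed
  have sub: "open_cell \<omega> r w \<subseteq> R" if w: "w \<in> T" for w
  proof -
    obtain z where z: "z \<in> cell \<omega> w (na \<omega> r w) (nb \<omega> r w)" "dist z z0 \<le> r"
      using near[OF w] by blast
    have "\<bar>fst z - fst z0\<bar> \<le> r" "\<bar>snd z - snd z0\<bar> \<le> r"
      using z(2) dist_fst_le[of z z0] dist_snd_le[of z z0] by (auto simp: dist_real_def)
    moreover have "pa \<omega> w (na \<omega> r w) \<le> r" "pb \<omega> w (nb \<omega> r w) \<le> r"
      using stopping[OF T(2)[OF w] r] by auto
    ultimately show ?thesis
      using z(1) by (auto simp: open_cell_def cell_def R_def)
  qed
  have "ennreal (real (card T) * (amin * r)\<^sup>2) = (\<Sum>w\<in>T. ennreal ((amin * r)\<^sup>2))"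
    by (simp add: ennreal_mult ennreal_of_nat_eq_real_of_nat)
  also have "\<dots> \<le> (\<Sum>w\<in>T. emeasure lborel (open_cell \<omega> r w))"
    by (rule sum_mono[OF area])
  also have "\<dots> = emeasure lborel (\<Union>w\<in>T. open_cell \<omega> r w)"
  proof (rule sum_emeasure)
    show "(\<lambda>w. open_cell \<omega> r w) ` T \<subseteq> sets lborel"
      by (auto simp: open_cell_def intro!: borel_open open_Times)
    show "disjoint_family_on (open_cell \<omega> r) T"
      using disj by (auto simp: disjoint_family_on_def)
  qed (rule T)
  also have "\<dots> \<le> emeasure lborel R"
    using sub by (intro emeasure_mono) (auto simp: R_def intro!: borel_closed closed_Times)
  also have "\<dots> = ennreal (4 * r * (4 * r))"
    unfolding R_def using r by (subst emeasure_lborel_Icc_Times) auto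
  finally have "real (card T) * (amin * r)\<^sup>2 \<le> 4 * r * (4 * r)"
    using r by (subst (asm) ennreal_le_iff) auto
  then have "real (card T) * amin\<^sup>2 * r\<^sup>2 \<le> 16 * r\<^sup>2"
    by (simp add: power_mult_distrib power2_eq_square mult_ac)
  then have "real (card T) * amin\<^sup>2 \<le> 16" using r by simp
  then show ?thesis using amin_bmax by (simp add: field_simps)
qed

text \<open>An argument of Egorov type: the averages converge almost surely, so on a set of positive
  measure the estimates \<open>A n w\<close> hold for all n \<ge> n0 with a common
  \<open>n0\<close>. This makes the bound on the mass of cylinders uniform there.\<close>

lemma local_dimension:
  assumes ty: "typical \<omega>" and q: "q \<in> Q" and s: "s < lam q + tt q"
  shows "\<exists>E r0 C. E \<in> sets (mu \<omega> q (tt q)) \<and> emeasure (mu \<omega> q (tt q)) E > 0 \<and> 0 < r0 \<and> r0 < 1 \<and> 0 < C \<and>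
    (\<forall>w\<in>E. \<forall>r. 0 < r \<longrightarrow> r < r0 \<longrightarrow> wt q (tt q) \<omega> (na \<omega> r w) (nb \<omega> r w) w \<le> C * r powr s)"
proof -
  define t where "t = tt q"
  have t: "0 \<le> t" "t \<le> 1" "av (sg q t) = 0" unfolding t_def using tt_props[OF q] by auto
  have \<omega>: "\<omega> l \<in> {1..m}" for l using ty by (simp add: typical_def)
  note ctx = \<omega> q t(1,2)
  interpret prob_space "mu \<omega> q t" by (rule prob_space_mu[OF ctx])
  have neg: "ln bmax < 0" using amin_bmax by simp
  have lam: "0 \<le> lam q" "lam q * av (be q) = av (h q)" using lam_bounds[OF q] by auto
  \<comment> \<open>Entropy, \<open>S\<close> and \<open>be\<close> cause errors \<theta> n,
    \<theta> n and lam(q) \<theta> n. Their sum equals n (lam(q) + t - s) (- ln bmax), which the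
    bound on \<open>nb\<close> converts into the spare power of \<open>r\<close> and the constant
    \<open>C\<close>.\<close>
  define \<theta> where "\<theta> = (lam q + t - s) * (- ln bmax) / (2 + lam q)"
  have \<theta>: "\<theta> > 0" unfolding \<theta>_def using s neg lam
    by (intro divide_pos_pos mult_pos_pos) (auto simp: t_def)
  define A where "A n w \<longleftrightarrow> (\<Sum>l<n. ln (q (\<omega> l) (fst (w l)))) \<le> real n * (av (h q) + \<theta>) \<and>
     real n * (av (be q) - \<theta>) \<le> (\<Sum>l<n. ln (b (\<omega> l) (fst (w l)))) \<and>
     - (\<theta> * real n) \<le> (\<Sum>l<n. ln (S (\<omega> l) (fst (w l)) t))" for n and w :: "nat \<Rightarrow> nat \<times> nat"
  define E where "E n0 = {w \<in> space (mu \<omega> q t). \<forall>n\<in>{n0..}. A n w}" for n0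
  have sum_meas: "(\<lambda>w. \<Sum>l<n. g (\<omega> l) (fst (w l))) \<in> borel_measurable (mu \<omega> q t)"
    for g :: "nat \<Rightarrow> nat \<Rightarrow> real" and n
  proof (rule borel_measurable_sum)
    show "(\<lambda>w. g (\<omega> l) (fst (w l))) \<in> borel_measurable (mu \<omega> q t)" for l
      using measurable_mu[OF ctx, of "\<lambda>v. g (\<omega> l) (fst v)" l] .
  qed
  note [measurable] = sum_meas[of "\<lambda>i j. ln (q i j)"] sum_meas[of "\<lambda>i j. ln (b i j)"]
    sum_meas[of "\<lambda>i j. ln (S i j t)"]
  have E_sets: "E n0 \<in> sets (mu \<omega> q t)" for n0
    unfolding E_def A_def by measurable
  have "AE w in mu \<omega> q t. \<exists>n0. w \<in> E n0"
    using row_averages[OF ctx ty, of "\<lambda>i j. ln (q i j)"] row_averages[OF ctx ty, of "\<lambda>i j. ln (b i j)"]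
      row_averages[OF ctx ty, of "\<lambda>i j. ln (S i j t)"] AE_space
  proof eventually_elim
    case (elim w)
    have 1: "(\<lambda>n. (\<Sum>l<n. ln (q (\<omega> l) (fst (w l)))) / real n) \<longlonglongrightarrow> av (h q)"
      "(\<lambda>n. (\<Sum>l<n. ln (b (\<omega> l) (fst (w l)))) / real n) \<longlonglongrightarrow> av (be q)"
      "(\<lambda>n. (\<Sum>l<n. ln (S (\<omega> l) (fst (w l)) t)) / real n) \<longlonglongrightarrow> 0"
      using elim(1-3) t(3) by (simp_all add: h_def[abs_def] be_def[abs_def] sg_def[abs_def])
    have "eventually (\<lambda>n. (\<Sum>l<n. ln (q (\<omega> l) (fst (w l)))) / real n < av (h q) + \<theta>) sequentially"
      by (rule order_tendstoD(2)[OF 1(1)]) (use \<theta> in simp)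
    moreover have "eventually (\<lambda>n. av (be q) - \<theta> < (\<Sum>l<n. ln (b (\<omega> l) (fst (w l)))) / real n) sequentially"
      by (rule order_tendstoD(1)[OF 1(2)]) (use \<theta> in simp)
    moreover have "eventually (\<lambda>n. - \<theta> < (\<Sum>l<n. ln (S (\<omega> l) (fst (w l)) t)) / real n) sequentially"
      by (rule order_tendstoD(1)[OF 1(3)]) (use \<theta> in simp)
    ultimately have "eventually (\<lambda>n. A n w) sequentially"
      using eventually_gt_at_top[of 0]
      by eventually_elim (auto simp: A_def field_simps)
    then show ?case using elim(4) by (auto simp: eventually_sequentially E_def)
  qed
  then have E_AE: "AE w in mu \<omega> q t. \<exists>n0. w \<in> E n0" .
  have "\<exists>n0. emeasure (mu \<omega> q t) (E n0) > 0"
  proof (rule ccontr)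
    assume "\<not> (\<exists>n0. emeasure (mu \<omega> q t) (E n0) > 0)"
    then have "E n0 \<in> null_sets (mu \<omega> q t)" for n0
      using E_sets by (auto simp: null_sets_def)
    then have "AE w in mu \<omega> q t. \<forall>n0. w \<notin> E n0"
      by (simp add: AE_all_countable AE_not_in)
    with E_AE have "AE w in mu \<omega> q t. False" by eventually_elim auto
    then show False by simp
  qed
  then obtain n0 where n0: "emeasure (mu \<omega> q t) (E n0) > 0" by blast
  define C where "C = exp (\<theta> * (2 + lam q))"
  have "wt q t \<omega> (na \<omega> r w) (nb \<omega> r w) w \<le> C * r powr s"
    if w: "w \<in> E n0" and r: "0 < r" "r < amin ^ (n0 + 1)" for w r
  proof -
    have v: "valid \<omega> w n" for n using w by (auto simp: E_def intro: valid_mu[OF ctx])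
    have "amin ^ (n0 + 1) \<le> 1" using amin_bmax by (intro power_le_one) auto
    then have r1: "r < 1" using r by simp
    note st = stopping[OF v r(1) r1]
    define n where "n = nb \<omega> r w"
    define k where "k = na \<omega> r w"
    \<comment> \<open>The bound on \<open>r\<close> forces n0 \<le> k, the smaller of the two times,
      so the uniform estimates hold at both.\<close>
    have "amin ^ k < amin ^ (n0 + 1)"
      using pa_ge[OF v, of k] st(3) r by (simp add: k_def)
    then have "n0 \<le> k" using amin_bmax by (simp add: power_strict_decreasing_iff)
    moreover have kn: "k \<le> n" using st(5) by (simp add: k_def n_def)
    ultimately have A: "A n w" "A k w" using w by (auto simp: E_def)
    have q0: "0 \<le> q (\<omega> l) (fst (w l))" for l
      using QD(1)[OF q \<omega>] validD(2)[OF v, of l "Suc l"] by auto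
    have S0: "0 < S (\<omega> l) (fst (w l)) t" for l
      using S_bounds(3)[OF \<omega> _ t(1,2)] validD(2)[OF v, of l "Suc l"] by auto
    have b0: "0 < rb \<omega> w l" for l
      using b_pos[OF \<omega>] validD(2)[OF v, of l "Suc l"] by auto
    have "wt q t \<omega> k n w = (\<Prod>l<n. q (\<omega> l) (fst (w l))) *
       (\<Prod>l<n. if l < k then ra \<omega> w l powr t / S (\<omega> l) (fst (w l)) t else 1)"
      unfolding wt_def by (rule prod.distrib)
    also have "(\<Prod>l<n. if l < k then ra \<omega> w l powr t / S (\<omega> l) (fst (w l)) t else 1)
       = (\<Prod>l<k. ra \<omega> w l powr t / S (\<omega> l) (fst (w l)) t)"
      by (rule prod.mono_neutral_cong_right) (use kn in auto)
    also have "\<dots> = (\<Prod>l<k. ra \<omega> w l powr t) / (\<Prod>l<k. S (\<omega> l) (fst (w l)) t)"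
      by (rule prod_dividef)
    also have "(\<Prod>l<k. ra \<omega> w l powr t) = pa \<omega> w k powr t"
      unfolding pa_def by (rule prod_powr_distrib[symmetric])
    also have "(\<Prod>l<k. S (\<omega> l) (fst (w l)) t) = exp (\<Sum>l<k. ln (S (\<omega> l) (fst (w l)) t))"
      using S0 by (simp add: exp_sum)
    also have "(\<Prod>l<n. q (\<omega> l) (fst (w l))) * (pa \<omega> w k powr t / exp (\<Sum>l<k. ln (S (\<omega> l) (fst (w l)) t)))
       \<le> exp (real n * (av (h q) + \<theta>)) * (r powr t / exp (- (\<theta> * real n)))"
    proof (rule mult_mono)
      \<comment> \<open>Only an inequality: where \<open>q\<close> vanishes, \<open>ln 0 = 0\<close>
        makes the factor on the right equal to 1.\<close>
      have "(\<Prod>l<n. q (\<omega> l) (fst (w l))) \<le> (\<Prod>l<n. exp (ln (q (\<omega> l) (fst (w l)))))"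
      proof (rule prod_mono)
        fix l assume "l \<in> {..<n}"
        show "0 \<le> q (\<omega> l) (fst (w l)) \<and> q (\<omega> l) (fst (w l)) \<le> exp (ln (q (\<omega> l) (fst (w l))))"
          using q0[of l] by (cases "q (\<omega> l) (fst (w l)) = 0") auto
      qed
      also have "\<dots> = exp (\<Sum>l<n. ln (q (\<omega> l) (fst (w l))))" by (simp add: exp_sum)
      also have "\<dots> \<le> exp (real n * (av (h q) + \<theta>))" using A(1) by (simp add: A_def)
      finally show "(\<Prod>l<n. q (\<omega> l) (fst (w l))) \<le> exp (real n * (av (h q) + \<theta>))" .
      have "- (\<theta> * real n) \<le> - (\<theta> * real k)" using kn \<theta> by simp
      then have "- (\<theta> * real n) \<le> (\<Sum>l<k. ln (S (\<omega> l) (fst (w l)) t))" using A(2) by (simp add: A_def)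
      moreover have "pa \<omega> w k powr t \<le> r powr t"
        using st(3) pa_pos[OF v, of k] t by (intro powr_mono2) (auto simp: k_def)
      ultimately show "pa \<omega> w k powr t / exp (\<Sum>l<k. ln (S (\<omega> l) (fst (w l)) t)) \<le> r powr t / exp (- (\<theta> * real n))"
        by (intro frac_le) auto
    qed auto
    also have "\<dots> = exp (real n * (av (h q) + \<theta>) + t * ln r + \<theta> * real n)"
      using r by (simp add: powr_def exp_minus exp_add divide_inverse)
    also have "\<dots> \<le> exp (\<theta> * (2 + lam q) + s * ln r)"
    proof -
      have "(\<Sum>l<n. ln (b (\<omega> l) (fst (w l)))) = ln (pb \<omega> w n)"
        unfolding pb_def
      proof (rule ln_prod[symmetric])
        show "rb \<omega> w i \<noteq> 0" for i using b0[of i] by simp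
      qed auto
      also have "\<dots> \<le> ln r" using st(1) pb_pos[OF v, of n] r by (simp add: n_def)
      finally have "real n * av (be q) \<le> ln r + \<theta> * real n"
        using A(1) by (simp add: A_def algebra_simps)
      then have "lam q * (real n * av (be q)) \<le> lam q * (ln r + \<theta> * real n)"
        using lam(1) by (rule mult_left_mono)
      then have 1: "real n * av (h q) \<le> lam q * ln r + lam q * \<theta> * real n"
        unfolding lam(2)[symmetric] by (simp add: algebra_simps)
      have "real n * (- ln bmax) \<le> - ln bmax - ln r"
        using st(6) by (simp add: n_def algebra_simps)
      then have "(real n * (- ln bmax)) * (lam q + t - s) \<le> (- ln bmax - ln r) * (lam q + t - s)"
        using s by (intro mult_right_mono) (auto simp: t_def)
      moreover have 2: "\<theta> * (2 + lam q) = (lam q + t - s) * (- ln bmax)"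
        using lam unfolding \<theta>_def by simp
      ultimately have "real n * (\<theta> * (2 + lam q)) \<le> \<theta> * (2 + lam q) - ln r * (lam q + t - s)"
        unfolding 2 by (simp add: algebra_simps)
      then show ?thesis using 1 by (simp add: algebra_simps)
    qed
    also have "\<dots> = C * r powr s" using r by (simp add: C_def exp_add powr_def)
    finally show ?thesis by (simp add: n_def k_def)
  qed
  moreover have "0 < amin ^ (n0 + 1)" "amin ^ (n0 + 1) < 1"
    using amin_bmax power_Suc_less_one[of amin n0] by (auto simp: power_less_one_iff)
  moreover have "0 < C" by (simp add: C_def)
  ultimately show ?thesis using n0 E_sets[of n0] unfolding t_def by blast
qed

lemma hausdorff_measure_carpet_pos:
  assumes ty: "typical \<omega>" and q: "q \<in> Q" and s: "0 < s" "s < lam q + tt q"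
  shows "hausdorff_measure s (random_carpet M N a b c d \<omega>) \<noteq> 0"
proof -
  define t where "t = tt q"
  have t: "0 \<le> t" "t \<le> 1" unfolding t_def using tt_props[OF q] by auto
  have \<omega>: "\<omega> l \<in> {1..m}" for l using ty by (simp add: typical_def)
  note ctx = \<omega> q t
  define \<mu> where "\<mu> = mu \<omega> q t"
  obtain E r0 C where E: "E \<in> sets \<mu>" "emeasure \<mu> E > 0" and r0: "0 < r0" "r0 < 1" and C: "0 < C"
    and wt_le: "\<And>w r. w \<in> E \<Longrightarrow> 0 < r \<Longrightarrow> r < r0 \<Longrightarrow>
       wt q t \<omega> (na \<omega> r w) (nb \<omega> r w) w \<le> C * r powr s"
    using local_dimension[OF ty q s(2)] unfolding t_def \<mu>_def by blast
  \<comment> \<open>Words with different cylinders may receive the same point on a common boundary;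
    the counting of cylinders below allows for this.\<close>
  define f where "f w = (SOME z. z \<in> random_carpet M N a b c d \<omega> \<and> (\<forall>k n. z \<in> cell \<omega> w k n))" for w
  have valid: "valid \<omega> w n" if "w \<in> space \<mu>" for w n
    using that unfolding \<mu>_def by (rule valid_mu[OF ctx])
  have f: "f w \<in> random_carpet M N a b c d \<omega>" "f w \<in> cell \<omega> w k n" if w: "w \<in> space \<mu>" for w k n
  proof -
    obtain z where "z \<in> random_carpet M N a b c d \<omega>" "\<And>k n. z \<in> cell \<omega> w k n"
      using coded_point[of \<omega> w] valid[OF w] by blast
    then have "f w \<in> random_carpet M N a b c d \<omega> \<and> (\<forall>k n. f w \<in> cell \<omega> w k n)"
      unfolding f_def by (intro someI[of "\<lambda>z. z \<in> random_carpet M N a b c d \<omega> \<and> (\<forall>k n. z \<in> cell \<omega> w k n)" z]) auto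
    then show "f w \<in> random_carpet M N a b c d \<omega>" "f w \<in> cell \<omega> w k n" by auto
  qed
  define K where "K = 16 / amin\<^sup>2"
  have K: "K > 0" using amin_bmax by (simp add: K_def)
  have E_space: "w \<in> space \<mu>" if "w \<in> E" for w
    using E(1) that sets.sets_into_space by blast
  have mass: "\<exists>G\<in>sets \<mu>. E \<inter> f -` U \<subseteq> G \<and> emeasure \<mu> G \<le> ennreal (K * C * r powr s)"
    if U: "bounded U" "diameter U \<le> r" and r: "0 < r" "r < r0" for U r
  proof -
    have r1: "r < 1" using r r0 by simp
    define cyl where "cyl w = {w' \<in> space \<mu>. (\<forall>l<nb \<omega> r w. fst (w' l) = fst (w l)) \<and> (\<forall>l<na \<omega> r w. w' l = w l)}" for w
    define W where "W = E \<inter> f -` U"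
    have W: "w \<in> space \<mu>" "w \<in> E" "f w \<in> U" if "w \<in> W" for w using that E_space by (auto simp: W_def)
    have cyl: "cyl w \<in> sets \<mu>" "emeasure \<mu> (cyl w) = ennreal (wt q t \<omega> (na \<omega> r w) (nb \<omega> r w) w)"
      if w: "w \<in> space \<mu>" for w
    proof -
      have "w l \<in> index_set M N (\<omega> l)" for l
        using w unfolding \<mu>_def space_mu[OF ctx] by blast
      moreover have "na \<omega> r w \<le> nb \<omega> r w" by (rule stopping(5)[OF valid[OF w] r(1) r1])
      ultimately show "cyl w \<in> sets \<mu>" "emeasure \<mu> (cyl w) = ennreal (wt q t \<omega> (na \<omega> r w) (nb \<omega> r w) w)"
        unfolding cyl_def \<mu>_def by (rule emeasure_cylinder[OF ctx])+
    qed
    \<comment> \<open>Infinitely many words may be sent into \<open>U\<close>. Any finite set of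
      their cylinders has at most \<open>K\<close> members, which then yields finiteness of the
      whole family.\<close>
    have bound: "finite F \<and> real (card F) \<le> K" if F: "F \<subseteq> cyl ` W" "finite F" for F
    proof -
      \<comment> \<open>One word per cylinder, so that distinct words of \<open>T\<close> have
        disjoint open cells.\<close>
      obtain T where T: "T \<subseteq> W" "inj_on cyl T" "F = cyl ` T"
        using F(1) by (meson subset_image_inj)
      have finT: "finite T" using F(2) T finite_imageD by blast
      show ?thesis
      proof (cases "T = {}")
        case True
        then show ?thesis using T K by simp
      next
        case False
        then obtain w0 where w0: "w0 \<in> T" by blast
        have "real (card T) \<le> K" unfolding K_def
        proof (rule card_separated_cells[OF finT _ r(1) r1])
          show "valid \<omega> w n" if "w \<in> T" for w n using valid W(1) T(1) that by blast
        next
          fix w w' assume w: "w \<in> T" "w' \<in> T" "w \<noteq> w'"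
          show "open_cell \<omega> r w \<inter> open_cell \<omega> r w' = {}"
          proof (rule ccontr)
            assume "open_cell \<omega> r w \<inter> open_cell \<omega> r w' \<noteq> {}"
            then obtain z where z: "z \<in> open_cell \<omega> r w" "z \<in> open_cell \<omega> r w'" by blast
            have v: "valid \<omega> w n" "valid \<omega> w' n" for n using valid W(1) T(1) w by blast+
            note d = open_cells_disjoint[OF v r(1) r1 z]
            have "cyl w = cyl w'"
              unfolding cyl_def d(1,2)[symmetric] using d(3,4) by auto
            then show False using inj_onD[OF T(2)] w by blast
          qed
        next
          fix w assume w: "w \<in> T"
          then have "f w \<in> U" "f w0 \<in> U" using W(3) T(1) w0 by blast+
          then have "dist (f w) (f w0) \<le> r"
            using diameter_bounded_bound[OF U(1)] U(2) by (meson order_trans)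
          moreover have "f w \<in> cell \<omega> w (na \<omega> r w) (nb \<omega> r w)"
            using f(2) W(1) T(1) w by blast
          ultimately show "\<exists>z\<in>cell \<omega> w (na \<omega> r w) (nb \<omega> r w). dist z (f w0) \<le> r" by blast
        qed
        then show ?thesis using F(2) T card_image[OF T(2)] by simp
      qed
    qed
    have fin: "finite (cyl ` W)"
    proof (rule ccontr)
      assume "infinite (cyl ` W)"
      then obtain F where F: "finite F" "card F = Suc (nat \<lceil>K\<rceil>)" "F \<subseteq> cyl ` W"
        using infinite_arbitrarily_large by blast
      have "real (Suc (nat \<lceil>K\<rceil>)) \<le> K" using bound[OF F(3,1)] unfolding F(2) by blast
      then show False by linarith
    qed
    define G where "G = \<Union>(cyl ` W)"
    have sets: "Z \<in> sets \<mu>" if "Z \<in> cyl ` W" for Z using that cyl(1) W(1) by blast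
    have "G \<in> sets \<mu>" unfolding G_def using fin sets by (intro sets.finite_Union) auto
    moreover have "E \<inter> f -` U \<subseteq> G"
    proof
      fix w assume "w \<in> E \<inter> f -` U"
      then have w: "w \<in> W" by (simp add: W_def)
      then have "w \<in> cyl w" using W(1) by (simp add: cyl_def)
      then show "w \<in> G" using w by (auto simp: G_def)
    qed
    moreover have "emeasure \<mu> G \<le> ennreal (K * C * r powr s)"
    proof -
      have "emeasure \<mu> (\<Union>Z\<in>cyl ` W. Z) \<le> (\<Sum>Z\<in>cyl ` W. emeasure \<mu> Z)"
        using fin sets by (intro emeasure_subadditive_finite) auto
      also have "\<dots> \<le> (\<Sum>Z\<in>cyl ` W. ennreal (C * r powr s))"
      proof (rule sum_mono)
        fix Z assume "Z \<in> cyl ` W"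
        then obtain w where w: "w \<in> W" "Z = cyl w" by blast
        show "emeasure \<mu> Z \<le> ennreal (C * r powr s)"
          unfolding w(2) cyl(2)[OF W(1)[OF w(1)]]
          by (intro ennreal_leI wt_le W(2) w(1) r)
      qed
      also have "\<dots> = ennreal (real (card (cyl ` W)) * (C * r powr s))"
        using C by (simp add: ennreal_mult ennreal_of_nat_eq_real_of_nat)
      also have "\<dots> \<le> ennreal (K * (C * r powr s))"
        using bound[OF subset_refl fin] C by (intro ennreal_leI mult_right_mono) auto
      finally show ?thesis by (simp add: G_def mult.assoc)
    qed
    ultimately show ?thesis by blast
  qed
  show ?thesis
  proof (rule mass_distribution[OF E])
    show "f ` E \<subseteq> random_carpet M N a b c d \<omega>" using f(1) E_space by blast
    show "0 < K * C" using K C by simp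
    show "0 < r0 / 2" using r0 by simp
    fix U :: "(real \<times> real) set" assume U: "bounded U" "diameter U \<le> r0 / 2"
    show "\<exists>G\<in>sets \<mu>. E \<inter> f -` U \<subseteq> G \<and> emeasure \<mu> G \<le> ennreal (K * C) * diam_pow s U"
    proof (cases "diameter U = 0")
      case False
      then have pos: "diameter U > 0" using diameter_ge_0[OF U(1)] by simp
      then have "U \<noteq> {}" by (auto simp: diameter_empty)
      then have "ennreal (K * C) * diam_pow s U = ennreal (K * C * diameter U powr s)"
        using s K C by (simp add: diam_pow_def ennreal_mult)
      then show ?thesis using mass[OF U(1) order_refl pos] U(2) r0 by simp
    next
      case True
      \<comment> \<open>A set of diameter 0 has gauge 0 as s > 0, so its preimage must be caught in
        a null set: the estimate holds at every small scale, and the sets obtained along a null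
        sequence of scales are intersected.\<close>
      define r where "r j = r0 * (1 / 2) ^ Suc j" for j :: nat
      have r: "0 < r j" "r j < r0" for j
        using r0 power_Suc_less_one[of "1 / 2 :: real" j] mult_strict_left_mono[of "(1 / 2) ^ Suc j" 1 r0]
        by (auto simp: r_def simp del: power_Suc)
      have "\<exists>G\<in>sets \<mu>. E \<inter> f -` U \<subseteq> G \<and> emeasure \<mu> G \<le> ennreal (K * C * r j powr s)" for j
        using mass[OF U(1) _ r[of j]] True r(1)[of j] by simp
      then obtain G where G: "\<And>j. G j \<in> sets \<mu>" "\<And>j. E \<inter> f -` U \<subseteq> G j"
        "\<And>j. emeasure \<mu> (G j) \<le> ennreal (K * C * r j powr s)" by metis
      have "(\<lambda>j. r0 * (1 / 2) ^ Suc j) \<longlonglongrightarrow> r0 * 0"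
        by (intro tendsto_mult tendsto_const LIMSEQ_Suc LIMSEQ_realpow_zero) auto
      then have "r \<longlonglongrightarrow> 0" by (simp add: r_def[abs_def])
      then have "(\<lambda>j. ennreal (K * C * r j powr s)) \<longlonglongrightarrow> ennreal (K * C * 0 powr s)"
        using s r by (intro tendsto_ennrealI tendsto_intros) (auto simp: less_imp_le)
      moreover have "emeasure \<mu> (\<Inter>j. G j) \<le> ennreal (K * C * r j powr s)" for j
        using G by (intro order_trans[OF emeasure_mono G(3)]) auto
      ultimately have "emeasure \<mu> (\<Inter>j. G j) \<le> ennreal (K * C * 0 powr s)"
        by (intro LIMSEQ_le_const) auto
      then have "emeasure \<mu> (\<Inter>j. G j) \<le> ennreal (K * C) * diam_pow s U" by simp
      moreover have "(\<Inter>j. G j) \<in> sets \<mu>" using G(1) by (intro sets.countable_INT) auto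
      moreover have "E \<inter> f -` U \<subseteq> (\<Inter>j. G j)" using G(2) by blast
      ultimately show ?thesis by blast
    qed
  qed
qed

lemma carpet_nonempty:
  assumes "\<And>l. \<omega> l \<in> {1..m}"
  shows "random_carpet M N a b c d \<omega> \<noteq> {}"
proof -
  have "valid \<omega> (\<lambda>_. (1, 1)) n" for n
    using assms M1 N1 by (simp add: valid_def index_set_def)
  then show ?thesis using coded_point[of \<omega> "\<lambda>_. (1, 1)"] by blast
qed

lemma hausdorff_dim_carpet_ge:
  assumes ty: "typical \<omega>" and q: "q \<in> Q"
  shows "ereal (lam q + tt q) \<le> hausdorff_dim (random_carpet M N a b c d \<omega>)"
proof (rule hausdorff_dim_geI)
  fix s assume s: "0 \<le> s" "s < lam q + tt q"
  show "hausdorff_measure s (random_carpet M N a b c d \<omega>) \<noteq> 0"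
  proof (cases "s = 0")
    case False
    then show ?thesis using hausdorff_measure_carpet_pos[OF ty q, of s] s by simp
  next
    case True
    \<comment> \<open>For s = 0 every nonempty set has gauge 1, so counting measure on a single
      point of the carpet can serve as the mass.\<close>
    obtain z where z: "z \<in> random_carpet M N a b c d \<omega>"
      using carpet_nonempty[of \<omega>] ty by (auto simp: typical_def)
    show ?thesis
    proof (rule mass_distribution[where \<mu> = "count_space {z}" and E = "{z}" and f = id and C = 1 and \<delta> = 1])
      fix U :: "(real \<times> real) set"
      show "\<exists>G\<in>sets (count_space {z}). {z} \<inter> id -` U \<subseteq> G \<and> emeasure (count_space {z}) G \<le> ennreal 1 * diam_pow s U"
        using True by (intro bexI[of _ "{z} \<inter> U"]) (auto simp: diam_pow_def Int_insert_left)
    qed (use z in auto)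
  qed
qed

theorem hausdorff_dim_carpet:
  assumes ty: "typical \<omega>"
  shows "hausdorff_dim (random_carpet M N a b c d \<omega>) =
    (SUP P\<in>row_distributions m p M. ereal (lambda_dim m p M b P + t_dim m M N a P))"
  unfolding SUP_row_distributions
proof (rule antisym)
  show "(SUP q\<in>Q. ereal (lam q + tt q)) \<le> hausdorff_dim (random_carpet M N a b c d \<omega>)"
    by (rule SUP_least) (rule hausdorff_dim_carpet_ge[OF ty])
  show "hausdorff_dim (random_carpet M N a b c d \<omega>) \<le> (SUP q\<in>Q. ereal (lam q + tt q))"
  proof (cases "SUP q\<in>Q. ereal (lam q + tt q)")
    case (real D)
    have D: "lam q + tt q \<le> D" if "q \<in> Q" for q
      using SUP_upper[OF that, of "\<lambda>q. ereal (lam q + tt q)"] real by simp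
    show ?thesis unfolding real
    proof (rule ereal_le_epsilon2)
      fix e :: real assume "0 < e"
      then show "hausdorff_dim (random_carpet M N a b c d \<omega>) \<le> ereal D + ereal e"
        using hausdorff_dim_carpet_le[OF ty, of "e / 2" D] D by simp
    qed
  next
    case PInf
    then show ?thesis by simp
  next
    case MInf
    obtain q where "q \<in> Q" using Q_nonempty by blast
    then have "ereal (lam q + tt q) \<le> - \<infinity>"
      using SUP_upper[of q Q "\<lambda>q. ereal (lam q + tt q)"] MInf by simp
    then show ?thesis by simp
  qed
qed

end

theorem theoremA:
  fixes m :: nat and p :: "nat \<Rightarrow> real"
    and M :: "nat \<Rightarrow> nat" and N :: "nat \<Rightarrow> nat \<Rightarrow> nat"
  assumes "1 \<le> m"
    and "\<And>i. i \<in> {1..m} \<Longrightarrow> 0 < p i"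
    and "(\<Sum>i=1..m. p i) = 1"
    and "\<And>i. i \<in> {1..m} \<Longrightarrow> 1 \<le> M i"
    and "\<And>i j. i \<in> {1..m} \<Longrightarrow> j \<in> {1..M i} \<Longrightarrow> 1 \<le> N i j"
  shows "\<exists>\<epsilon>>0. \<forall>a b c d.
    admissible m M N a b c d \<longrightarrow>
    generic_family m M N a \<longrightarrow>
    nearly_homogeneous \<epsilon> m M N a b \<or> nearly_conformal \<epsilon> m M N a b \<longrightarrow>
    (AE \<omega> in bernoulli_seq m p.
       hausdorff_dim (random_carpet M N a b c d \<omega>) =
       (SUP P\<in>row_distributions m p M. ereal (lambda_dim m p M b P + t_dim m M N a P)))"
proof (intro exI[of _ 1] conjI allI impI)
  fix a b c d
  assume "admissible m M N a b c d"
  then interpret weighted_carpet m M N a b c d p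
    by unfold_locales (use assms in blast)+
  have "AE \<omega> in bernoulli_seq m p. typical \<omega>"
    unfolding typical_def using assms(2,3) by (intro random_frequencies) (auto simp: less_imp_le)
  then show "AE \<omega> in bernoulli_seq m p. hausdorff_dim (random_carpet M N a b c d \<omega>) =
       (SUP P\<in>row_distributions m p M. ereal (lambda_dim m p M b P + t_dim m M N a P))"
    by eventually_elim (rule hausdorff_dim_carpet)
qed simp

end
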